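(* Let $A$ be a unital C*-algebra and let $\mu$, $\lambda$, $\tau$ be positive linear functionals (PLFs) on $A$ such that $N_\lambda \subseteq N_\mu$ and $N_\lambda \subseteq N_\tau$. Then: (i) $\mu$ has a unique weak* Lebesgue decomposition $\mu=\mu_{wc}+\mu_{ws}$ with respect to $\lambda$, where $\mu_{wc}$ and $\mu_{ws}$ are PLFs on $A$, $\mu_{wc}$ is weak* continuous with respect to $\lambda$, $\mu_{ws}$ is weak* singular with respect to $\lambda$, and $\mu_{wc}$ is the maximal weak* continuous PLF (with respect to $\lambda$) such that $\mu_{wc}\le\mu$. (ii) $WC[\lambda]$ and $WS[\lambda]$ are hereditary cones in $A^*_+$. (iii) $(\mu+\tau)_{wc}=\mu_{wc}+\tau_{wc}$ and $(\mu+\tau)_{ws}=\mu_{ws}+\tau_{ws}$. (iv) If $\mu\le\tau$, then $\mu_{wc}\le\tau_{wc}$ and $\mu_{ws}\le\tau_{ws}$. Here, in (iii) and (iv), the subscripts $wc$ and $ws$ denote the parts of the weak* Lebesgue decomposition with respect to $\lambda$ from (i).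
   Context: A PLF on a unital C*-algebra $A$ is a positive linear functional $A\to\mathbb{C}$; $A^*_+$ is the cone of all PLFs on $A$, ordered by $\nu\le\mu$ iff $\mu-\nu$ is positive. For a PLF $\tau$, $N_\tau=\{a\in A:\tau(a^*a)=0\}$. Let $(\pi_\lambda,L^2(\lambda),\xi_\lambda)$ be the GNS representation of $\lambda$, with cyclic vector $\xi_\lambda=1+N_\lambda$. Put $L^\infty(\lambda)=\pi_\lambda(A)''\subseteq\mathscr{B}(L^2(\lambda))$, a von Neumann algebra, with predual denoted $L^1(\lambda)$; the weak* topology on $L^\infty(\lambda)$ is the one induced by this predual. If $N_\lambda\subseteq N_\mu$, then $\mu'(\pi_\lambda(a)):=\mu(a)$ is a well-defined PLF on $\pi_\lambda(A)$, which is identified with $\mu$. An extension of $\mu$ to $L^\infty(\lambda)$ means a PLF $\hat\mu$ on $L^\infty(\lambda)$ with $\hat\mu(\pi_\lambda(a))=\mu(a)$ for all $a\in A$. For a PLF $\mu$ on $A$ with $N_\lambda\subseteq N_\mu$: - $\mu$ is weak* continuous with respect to $\lambda$ if it has an extension to a PLF on $L^\infty(\lambda)$ that is weak*-continuous. $WC[\lambda]$ is the set of all such PLFs. - $\mu$ is weak* singular with respect to $\lambda$ if no extension of $\mu$ to $L^\infty(\lambda)$ majorizes a non-zero weak*-continuous PLF on $L^\infty(\lambda)$. $WS[\lambda]$ is the set of all such PLFs. - The zero functional is both weak* continuous and weak* singular with respect to $\lambda$. A sub-cone $\mathcal{S}$ of a positive cone $\mathcal{C}$ is hereditary if $s\in\mathcal{S}$,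 $c\in\mathcal{C}$ and $c\le s$ imply $c\in\mathcal{S}$. *)

theory Defs
  imports "HOL-Analysis.Analysis"
begin

section \<open>Unital C*-algebras\<close>

text \<open>The classes \<^class>\<open>real_normed_algebra_1\<close> and \<^class>\<open>banach\<close> only know real scalars; complex
  scalars and the involution are added on top of them. Since \<^class>\<open>real_normed_algebra_1\<close> has
  \<open>norm 1 = 1\<close>, the algebra is nonzero.\<close>

class cstar_algebra = real_normed_algebra_1 + banach +
  fixes scaleC :: "complex \<Rightarrow> 'a \<Rightarrow> 'a"  (infixr \<open>*\<^sub>C\<close> 75)
    and star :: "'a \<Rightarrow> 'a"
  assumes scaleC_add_right: "c *\<^sub>C (a + b) = c *\<^sub>C a + c *\<^sub>C b"
    and scaleC_add_left: "(c + d) *\<^sub>C a = c *\<^sub>C a + d *\<^sub>C a"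
    and scaleC_scaleC: "c *\<^sub>C d *\<^sub>C a = (c * d) *\<^sub>C a"
    and scaleC_of_real: "complex_of_real r *\<^sub>C a = r *\<^sub>R a"
    and mult_scaleC_left: "(c *\<^sub>C a) * b = c *\<^sub>C (a * b)"
    and mult_scaleC_right: "a * (c *\<^sub>C b) = c *\<^sub>C (a * b)"
    and norm_scaleC: "norm (c *\<^sub>C a) = cmod c * norm a"
    and star_star: "star (star a) = a"
    and star_add: "star (a + b) = star a + star b"
    and star_scaleC: "star (c *\<^sub>C a) = cnj c *\<^sub>C star a"
    and star_mult: "star (a * b) = star b * star a"
    and cstar_identity: "norm (star a * a) = (norm a)\<^sup>2"

instantiation complex :: cstar_algebra
begin

definition scaleC_complex :: "complex \<Rightarrow> complex \<Rightarrow> complex" where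
  "scaleC_complex c z = c * z"

definition star_complex :: "complex \<Rightarrow> complex" where
  "star_complex z = cnj z"

instance
  by standard
    (auto simp: scaleC_complex_def star_complex_def algebra_simps norm_mult power2_eq_square
      scaleR_conv_of_real)

end


section \<open>Positive linear functionals\<close>

definition plf :: "('a::cstar_algebra \<Rightarrow> complex) \<Rightarrow> bool" where
  "plf \<mu> \<longleftrightarrow>
     (\<forall>a b. \<mu> (a + b) = \<mu> a + \<mu> b) \<and>
     (\<forall>c a. \<mu> (c *\<^sub>C a) = c * \<mu> a) \<and>
     (\<forall>a. \<mu> (star a * a) \<in> \<real>\<^sub>\<ge>\<^sub>0)"

definition plf_le :: "('a::cstar_algebra \<Rightarrow> complex) \<Rightarrow> ('a \<Rightarrow> complex) \<Rightarrow> bool" where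
  "plf_le \<nu> \<mu> \<longleftrightarrow> plf (\<lambda>a. \<mu> a - \<nu> a)"

definition null_ideal :: "('a::cstar_algebra \<Rightarrow> complex) \<Rightarrow> 'a set" where
  "null_ideal \<tau> = {a. \<tau> (star a * a) = 0}"

definition subcone :: "('a \<Rightarrow> complex) set \<Rightarrow> ('a \<Rightarrow> complex) set \<Rightarrow> bool" where
  "subcone S C \<longleftrightarrow>
     S \<subseteq> C \<and> (\<lambda>a. 0) \<in> S \<and>
     (\<forall>s\<in>S. \<forall>t\<in>S. (\<lambda>a. s a + t a) \<in> S) \<and>
     (\<forall>r\<ge>0. \<forall>s\<in>S. (\<lambda>a. complex_of_real r * s a) \<in> S)"

definition hereditary_cone ::
    "('a::cstar_algebra \<Rightarrow> complex) set \<Rightarrow> ('a \<Rightarrow> complex) set \<Rightarrow> bool" where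
  "hereditary_cone S C \<longleftrightarrow> subcone S C \<and> (\<forall>s\<in>S. \<forall>c\<in>C. plf_le c s \<longrightarrow> c \<in> S)"


section \<open>Operators on a complex Hilbert space with explicit carrier\<close>

text \<open>The Hilbert space of a GNS representation depends on the functional, so it cannot be a type.
  Inner products are linear in the first argument. Operators are extensional functions on the
  carrier, so that equal operators are equal as functions.\<close>

record 'h hspace =
  hcarrier :: "'h set"
  hadd :: "'h \<Rightarrow> 'h \<Rightarrow> 'h"
  hscale :: "complex \<Rightarrow> 'h \<Rightarrow> 'h"
  hinner :: "'h \<Rightarrow> 'h \<Rightarrow> complex"

definition hnorm :: "'h hspace \<Rightarrow> 'h \<Rightarrow> real" where
  "hnorm H x = sqrt (Re (hinner H x x))"

definition bounded_ops :: "'h hspace \<Rightarrow> ('h \<Rightarrow> 'h) set" where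
  "bounded_ops H = {T \<in> hcarrier H \<rightarrow>\<^sub>E hcarrier H.
     (\<forall>x\<in>hcarrier H. \<forall>y\<in>hcarrier H. T (hadd H x y) = hadd H (T x) (T y)) \<and>
     (\<forall>c. \<forall>x\<in>hcarrier H. T (hscale H c x) = hscale H c (T x)) \<and>
     (\<exists>K. \<forall>x\<in>hcarrier H. hnorm H (T x) \<le> K * hnorm H x)}"

definition op_add :: "'h hspace \<Rightarrow> ('h \<Rightarrow> 'h) \<Rightarrow> ('h \<Rightarrow> 'h) \<Rightarrow> 'h \<Rightarrow> 'h" where
  "op_add H S T = (\<lambda>x\<in>hcarrier H. hadd H (S x) (T x))"

definition op_scale :: "'h hspace \<Rightarrow> complex \<Rightarrow> ('h \<Rightarrow> 'h) \<Rightarrow> 'h \<Rightarrow> 'h" where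
  "op_scale H c T = (\<lambda>x\<in>hcarrier H. hscale H c (T x))"

definition op_mult :: "'h hspace \<Rightarrow> ('h \<Rightarrow> 'h) \<Rightarrow> ('h \<Rightarrow> 'h) \<Rightarrow> 'h \<Rightarrow> 'h" where
  "op_mult H S T = compose (hcarrier H) S T"

definition op_adj :: "'h hspace \<Rightarrow> ('h \<Rightarrow> 'h) \<Rightarrow> 'h \<Rightarrow> 'h" where
  "op_adj H T = (THE S. S \<in> bounded_ops H \<and>
     (\<forall>x\<in>hcarrier H. \<forall>y\<in>hcarrier H. hinner H (T x) y = hinner H x (S y)))"

definition commutant :: "'h hspace \<Rightarrow> ('h \<Rightarrow> 'h) set \<Rightarrow> ('h \<Rightarrow> 'h) set" where
  "commutant H S = {T \<in> bounded_ops H. \<forall>s\<in>S. op_mult H T s = op_mult H s T}"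

text \<open>The predual of a von Neumann algebra \<open>M\<close> acting on \<open>H\<close>, realised in the usual way as the space
  of functionals \<open>T \<mapsto> tr (T \<rho>)\<close> on \<open>M\<close> with \<open>\<rho>\<close> of trace class, that is,
  \<open>T \<mapsto> \<Sum>n. \<langle>T (u n), v n\<rangle>\<close> for square-summable sequences of vectors \<open>u\<close> and \<open>v\<close>.\<close>

definition predual :: "'h hspace \<Rightarrow> ('h \<Rightarrow> 'h) set \<Rightarrow> (('h \<Rightarrow> 'h) \<Rightarrow> complex) set" where
  "predual H M = {(\<lambda>T\<in>M. \<Sum>n. hinner H (T (u n)) (v n)) | u v.
     (\<forall>n::nat. u n \<in> hcarrier H \<and> v n \<in> hcarrier H) \<and>
     summable (\<lambda>n. (hnorm H (u n))\<^sup>2) \<and> summable (\<lambda>n. (hnorm H (v n))\<^sup>2)}"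

definition weak_star_topology :: "'h hspace \<Rightarrow> ('h \<Rightarrow> 'h) set \<Rightarrow> ('h \<Rightarrow> 'h) topology" where
  "weak_star_topology H M =
     topology_generated_by {{T \<in> M. f T \<in> U} | f U. f \<in> predual H M \<and> open U}"

text \<open>Functionals on \<open>M\<close> are only looked at on \<open>M\<close>; their values elsewhere are irrelevant.\<close>

definition op_plf :: "'h hspace \<Rightarrow> ('h \<Rightarrow> 'h) set \<Rightarrow> (('h \<Rightarrow> 'h) \<Rightarrow> complex) \<Rightarrow> bool" where
  "op_plf H M f \<longleftrightarrow>
     (\<forall>S\<in>M. \<forall>T\<in>M. f (op_add H S T) = f S + f T) \<and>
     (\<forall>c. \<forall>T\<in>M. f (op_scale H c T) = c * f T) \<and>
     (\<forall>T\<in>M. f (op_mult H (op_adj H T) T) \<in> \<real>\<^sub>\<ge>\<^sub>0)"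

definition op_plf_le ::
    "'h hspace \<Rightarrow> ('h \<Rightarrow> 'h) set \<Rightarrow> (('h \<Rightarrow> 'h) \<Rightarrow> complex) \<Rightarrow> (('h \<Rightarrow> 'h) \<Rightarrow> complex) \<Rightarrow> bool" where
  "op_plf_le H M g f \<longleftrightarrow> op_plf H M (\<lambda>T. f T - g T)"

definition weak_star_continuous ::
    "'h hspace \<Rightarrow> ('h \<Rightarrow> 'h) set \<Rightarrow> (('h \<Rightarrow> 'h) \<Rightarrow> complex) \<Rightarrow> bool" where
  "weak_star_continuous H M f \<longleftrightarrow> continuous_map (weak_star_topology H M) euclidean f"


section \<open>The GNS representation\<close>

text \<open>\<open>L2 lam\<close> is the Hilbert space completion of \<open>A / N\<close>, \<open>N = null_ideal lam\<close>, with inner product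
  \<open>\<langle>a + N, b + N\<rangle> = lam (b* a)\<close>: its points are the Cauchy sequences in \<open>A\<close> for the seminorm
  \<open>a \<mapsto> sqrt (lam (a* a))\<close> modulo sequences tending to zero in that seminorm. The class of a constant
  sequence \<open>a\<close> is the image of \<open>a + N\<close>, and \<open>gns_pi lam a\<close> is the continuous extension of
  \<open>b + N \<mapsto> a b + N\<close>. All operations are independent of the representatives picked by \<open>gns_rep\<close>.\<close>

definition gns_seminorm :: "('a::cstar_algebra \<Rightarrow> complex) \<Rightarrow> 'a \<Rightarrow> real" where
  "gns_seminorm lam a = sqrt (Re (lam (star a * a)))"

definition gns_cauchy :: "('a::cstar_algebra \<Rightarrow> complex) \<Rightarrow> (nat \<Rightarrow> 'a) set" where
  "gns_cauchy lam = {x. \<forall>e>0. \<exists>N. \<forall>m\<ge>N. \<forall>n\<ge>N. gns_seminorm lam (x m - x n) < e}"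

definition gns_rel :: "('a::cstar_algebra \<Rightarrow> complex) \<Rightarrow> ((nat \<Rightarrow> 'a) \<times> (nat \<Rightarrow> 'a)) set" where
  "gns_rel lam = {(x, y). x \<in> gns_cauchy lam \<and> y \<in> gns_cauchy lam \<and>
     (\<lambda>n. gns_seminorm lam (x n - y n)) \<longlonglongrightarrow> 0}"

definition gns_class :: "('a::cstar_algebra \<Rightarrow> complex) \<Rightarrow> (nat \<Rightarrow> 'a) \<Rightarrow> (nat \<Rightarrow> 'a) set" where
  "gns_class lam x = gns_rel lam `` {x}"

definition gns_rep :: "(nat \<Rightarrow> 'a) set \<Rightarrow> nat \<Rightarrow> 'a" where
  "gns_rep X = (SOME x. x \<in> X)"

definition L2 :: "('a::cstar_algebra \<Rightarrow> complex) \<Rightarrow> (nat \<Rightarrow> 'a) set hspace" where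
  "L2 lam = \<lparr>
     hcarrier = gns_cauchy lam // gns_rel lam,
     hadd = (\<lambda>X Y. gns_class lam (\<lambda>n. gns_rep X n + gns_rep Y n)),
     hscale = (\<lambda>c X. gns_class lam (\<lambda>n. c *\<^sub>C gns_rep X n)),
     hinner = (\<lambda>X Y. lim (\<lambda>n. lam (star (gns_rep Y n) * gns_rep X n)))\<rparr>"

definition gns_pi ::
    "('a::cstar_algebra \<Rightarrow> complex) \<Rightarrow> 'a \<Rightarrow> (nat \<Rightarrow> 'a) set \<Rightarrow> (nat \<Rightarrow> 'a) set" where
  "gns_pi lam a = (\<lambda>X\<in>hcarrier (L2 lam). gns_class lam (\<lambda>n. a * gns_rep X n))"

definition Linf ::
    "('a::cstar_algebra \<Rightarrow> complex) \<Rightarrow> ((nat \<Rightarrow> 'a) set \<Rightarrow> (nat \<Rightarrow> 'a) set) set" where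
  "Linf lam = commutant (L2 lam) (commutant (L2 lam) (range (gns_pi lam)))"


section \<open>Weak* continuous and weak* singular functionals\<close>

definition extends_to_Linf ::
    "('a::cstar_algebra \<Rightarrow> complex) \<Rightarrow> ('a \<Rightarrow> complex) \<Rightarrow>
     (((nat \<Rightarrow> 'a) set \<Rightarrow> (nat \<Rightarrow> 'a) set) \<Rightarrow> complex) \<Rightarrow> bool" where
  "extends_to_Linf lam \<mu> f \<longleftrightarrow> op_plf (L2 lam) (Linf lam) f \<and> (\<forall>a. f (gns_pi lam a) = \<mu> a)"

definition WC :: "('a::cstar_algebra \<Rightarrow> complex) \<Rightarrow> ('a \<Rightarrow> complex) set" where
  "WC lam = {\<mu>. plf \<mu> \<and> null_ideal lam \<subseteq> null_ideal \<mu> \<and>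
     (\<exists>f. extends_to_Linf lam \<mu> f \<and> weak_star_continuous (L2 lam) (Linf lam) f)}"

definition WS :: "('a::cstar_algebra \<Rightarrow> complex) \<Rightarrow> ('a \<Rightarrow> complex) set" where
  "WS lam = {\<mu>. plf \<mu> \<and> null_ideal lam \<subseteq> null_ideal \<mu> \<and>
     \<not> (\<exists>f g. extends_to_Linf lam \<mu> f \<and>
          op_plf (L2 lam) (Linf lam) g \<and> weak_star_continuous (L2 lam) (Linf lam) g \<and>
          (\<exists>T\<in>Linf lam. g T \<noteq> 0) \<and> op_plf_le (L2 lam) (Linf lam) g f)}"

definition weak_star_lebesgue ::
    "('a::cstar_algebra \<Rightarrow> complex) \<Rightarrow> ('a \<Rightarrow> complex) \<Rightarrow> ('a \<Rightarrow> complex) \<Rightarrow> ('a \<Rightarrow> complex) \<Rightarrow> bool"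
  where
  "weak_star_lebesgue lam \<mu> \<nu> \<sigma> \<longleftrightarrow> \<nu> \<in> WC lam \<and> \<sigma> \<in> WS lam \<and> \<mu> = (\<lambda>a. \<nu> a + \<sigma> a)"

text \<open>The parts of the decomposition; meaningful when the decomposition exists and is unique.\<close>

definition wc_part :: "('a::cstar_algebra \<Rightarrow> complex) \<Rightarrow> ('a \<Rightarrow> complex) \<Rightarrow> 'a \<Rightarrow> complex" where
  "wc_part lam \<mu> = (THE \<nu>. \<exists>\<sigma>. weak_star_lebesgue lam \<mu> \<nu> \<sigma>)"

definition ws_part :: "('a::cstar_algebra \<Rightarrow> complex) \<Rightarrow> ('a \<Rightarrow> complex) \<Rightarrow> 'a \<Rightarrow> complex" where
  "ws_part lam \<mu> = (THE \<sigma>. \<exists>\<nu>. weak_star_lebesgue lam \<mu> \<nu> \<sigma>)"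

end

theory Submission
  imports Defs
begin

text \<open>Write \<open>\<omega> x a = \<langle>\<pi> a x, x\<rangle>\<close> for vector functionals. A positive functional on \<open>A\<close> extends to a weak*
  continuous positive functional on \<open>L\<^sup>\<infinity>(lam)\<close> iff it is a sum \<open>\<Sum>n. \<omega> (w n)\<close> with square-summable \<open>w n\<close>
  in \<open>L\<^sup>2(lam)\<close>, and iff it is dominated by such a sum; call these functionals normal. A positive
  functional \<open>\<theta>\<close> whose null ideal contains that of \<open>lam\<close> extends to \<open>L\<^sup>\<infinity>(lam)\<close> by Hahn-Banach, because
  \<open>\<pi> a \<ge> 0\<close> implies \<open>\<theta> a \<ge> 0\<close>. Applied to \<open>\<mu> - \<nu>\<close>, this shows that \<open>\<mu>\<close> is weak* singular iff no normal
  \<open>\<nu> \<noteq> 0\<close> satisfies \<open>\<nu> \<le> \<mu>\<close>. In \<open>L\<^sup>2(\<mu>)\<close> the vectors \<open>x\<close> with \<open>\<omega> x\<close> normal form a closed invariant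
  subspace, and the weak* continuous part of \<open>\<mu>\<close> is the vector functional of the projection of the
  cyclic vector to it.\<close>

text \<open>The definition of \<open>WS\<close> quantifies over all extensions of a functional to
  \<open>Linf\<close>, which need not be unique. The proof therefore moves everything back to
  \<open>A\<close>: a positive functional is known through the real numbers
  \<open>sq \<phi> b\<close>, the order is pointwise comparison of these, and normality is inherited
  by every functional below a convergent sum of normal ones. The hypothesis on null ideals is much
  weaker than domination by a multiple of \<open>lam\<close>. It yields positivity of
  \<open>\<theta>\<close> on positive operators only through the negative part of a self-adjoint
  element; the absolute value behind it comes from the binomial series of the square root, whose
  coefficients are absolutely summable. Once a maximal normal functional below \<open>\<mu>\<close>
  exists, uniqueness is formal. What is not formal is that a sum of two singular functionals is
  singular, and additivity and monotonicity of the parts rest on it: in the space of the sum, the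
  cyclic vector splits into two vectors orthogonal to the subspace of normal vectors.\<close>

lemma scaleC_zero_left [simp]: "0 *\<^sub>C (a::'a::cstar_algebra) = 0"
  using scaleC_of_real[of 0 a] by simp

lemma scaleC_one [simp]: "1 *\<^sub>C (a::'a::cstar_algebra) = a"
  using scaleC_of_real[of 1 a] by simp

lemma scaleC_minus_one: "(-1) *\<^sub>C (a::'a::cstar_algebra) = - a"
  using scaleC_of_real[of "-1" a] by simp

lemma scaleC_zero_right [simp]: "c *\<^sub>C (0::'a::cstar_algebra) = 0"
  using scaleC_scaleC[of c 0 "0::'a"] by simp

lemma scaleC_minus_right: "c *\<^sub>C (- a::'a::cstar_algebra) = - (c *\<^sub>C a)"
  using scaleC_add_right[of c a "-a"] by (simp add: eq_neg_iff_add_eq_0 add.commute)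

lemma scaleC_diff_right: "c *\<^sub>C (a - b::'a::cstar_algebra) = c *\<^sub>C a - c *\<^sub>C b"
  using scaleC_add_right[of c a "-b"] by (simp add: scaleC_minus_right)

lemma star_scaleR: "star (r *\<^sub>R (a::'a::cstar_algebra)) = r *\<^sub>R star a"
  by (metis complex_cnj_complex_of_real scaleC_of_real star_scaleC)

lemma star_zero [simp]: "star (0::'a::cstar_algebra) = 0"
  using star_scaleR[of 0 "0::'a"] by simp

lemma star_minus: "star (- a::'a::cstar_algebra) = - star a"
  using star_scaleR[of "-1" a] by simp

lemma star_diff: "star (a - b::'a::cstar_algebra) = star a - star b"
  using star_add[of a "-b"] by (simp add: star_minus)

lemma star_one [simp]: "star (1::'a::cstar_algebra) = 1"
  by (metis mult.right_neutral star_mult star_star)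

lemma star_power: "star ((a::'a::cstar_algebra) ^ n) = star a ^ n"
  by (induction n) (simp_all add: star_mult power_commutes)

text \<open>The C*-identity and submultiplicativity give
  \<open>norm b ^ 2 \<le> norm (star b) * norm b\<close>; this applies to \<open>a\<close> and to
  \<open>star a\<close>.\<close>

lemma norm_star [simp]: "norm (star (a::'a::cstar_algebra)) = norm a"
proof -
  have *: "norm b \<le> norm (star b)" for b :: 'a
  proof (cases "norm b = 0")
    case False
    have "norm b * norm b \<le> norm (star b) * norm b"
      using cstar_identity[of b] norm_mult_ineq[of "star b" b] by (simp add: power2_eq_square)
    then show ?thesis using False by (simp add: mult_le_cancel_right)
  qed simp
  show ?thesis using *[of a] *[of "star a"] by (simp add: star_star)
qed

lemma bounded_linear_star: "bounded_linear (star :: 'a::cstar_algebra \<Rightarrow> 'a)"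
  by (rule bounded_linear_intro[of _ 1]) (auto simp: star_add star_scaleR)

section \<open>Positive linear functionals\<close>

text \<open>Discriminant criterion with a complex parameter. The Cauchy-Schwarz inequalities for
  functionals on \<open>A\<close>, for vectors and for functionals on \<open>Linf\<close>, as well
  as the variational step in \<open>Riesz\<close>, are instances of it.\<close>

lemma quadratic_nonneg_imp_discrim:
  fixes A B :: real and z :: complex
  assumes "\<And>c. 0 \<le> A + 2 * Re (c * z) + (cmod c)\<^sup>2 * B" "0 \<le> B"
  shows "(cmod z)\<^sup>2 \<le> A * B"
proof -
  have zz: "Re (cnj z * z) = (cmod z)\<^sup>2"
    by (simp add: cmod_power2) (simp add: power2_eq_square)
  \<comment> \<open>The choice \<open>c = - t * cnj z\<close> makes \<open>c * z\<close> real, which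
    reduces the claim to a real quadratic in \<open>t\<close>.\<close>
  have t: "0 \<le> A - 2 * t * (cmod z)\<^sup>2 + t\<^sup>2 * (cmod z)\<^sup>2 * B" for t :: real
  proof -
    have "Re (complex_of_real (-t) * cnj z * z) = - t * (cmod z)\<^sup>2"
      by (simp only: mult.assoc Re_complex_of_real zz Re_complex_of_real[symmetric])
         (simp add: zz[symmetric] algebra_simps)
    then show ?thesis
      using assms(1)[of "of_real (-t) * cnj z"] by (simp add: norm_mult power_mult_distrib)
  qed
  show ?thesis
  proof (cases "B = 0")
    case True
    have "(cmod z)\<^sup>2 = 0"
    proof (rule ccontr)
      assume ne: "(cmod z)\<^sup>2 \<noteq> 0"
      \<comment> \<open>For \<open>B = 0\<close> the bound is affine in \<open>t\<close>; this value
        of \<open>t\<close> makes it equal to \<open>-1\<close>.\<close>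
      show False using t[of "(A + 1) / (2 * (cmod z)\<^sup>2)"] True ne by (simp add: field_simps)
    qed
    with True show ?thesis by simp
  next
    case False
    with assms(2) have "B > 0" by simp
    have "(1/B)\<^sup>2 * (cmod z)\<^sup>2 * B = (cmod z)\<^sup>2 / B"
      using \<open>B > 0\<close> by (simp add: power2_eq_square)
    with t[of "1/B"] have "0 \<le> A - (cmod z)\<^sup>2 / B" by simp
    with \<open>B > 0\<close> show ?thesis by (simp add: field_simps)
  qed
qed

lemma plf_add: "plf \<phi> \<Longrightarrow> \<phi> (a + b) = \<phi> a + \<phi> b"
  and plf_scaleC: "plf \<phi> \<Longrightarrow> \<phi> (c *\<^sub>C a) = c * \<phi> a"
  and plf_star_mult: "plf \<phi> \<Longrightarrow> \<phi> (star a * a) \<in> \<real>\<^sub>\<ge>\<^sub>0"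
  by (auto simp: plf_def)

lemma plf_scaleR: "plf \<phi> \<Longrightarrow> \<phi> (r *\<^sub>R a) = of_real r * \<phi> a"
  by (metis plf_scaleC scaleC_of_real)

lemma plf_zero: "plf \<phi> \<Longrightarrow> \<phi> 0 = 0"
  using plf_scaleR[of \<phi> 0 0] by simp

lemma plf_minus: "plf \<phi> \<Longrightarrow> \<phi> (- a) = - \<phi> a"
  using plf_scaleR[of \<phi> "-1" a] by simp

lemma plf_diff: "plf \<phi> \<Longrightarrow> \<phi> (a - b) = \<phi> a - \<phi> b"
  using plf_add[of \<phi> a "-b"] by (simp add: plf_minus)

lemmas plf_simps = plf_add plf_scaleC plf_scaleR plf_zero plf_minus plf_diff

text \<open>The square of the GNS seminorm of \<open>\<phi>\<close>. By polarization these real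
  numbers determine a positive functional, and they turn the order of functionals into pointwise
  inequalities between reals.\<close>

definition sq :: "('a::cstar_algebra \<Rightarrow> complex) \<Rightarrow> 'a \<Rightarrow> real" where
  "sq \<phi> b = Re (\<phi> (star b * b))"

lemma plf_sq: "plf \<phi> \<Longrightarrow> \<phi> (star b * b) = of_real (sq \<phi> b)"
  using plf_star_mult[of \<phi> b] by (auto simp: sq_def complex_eq_iff complex_nonneg_Reals_iff)

lemma sq_nonneg: "plf \<phi> \<Longrightarrow> 0 \<le> sq \<phi> b"
  using plf_star_mult[of \<phi> b] by (auto simp: sq_def complex_nonneg_Reals_iff)

lemma plf_one: "plf \<phi> \<Longrightarrow> \<phi> 1 = of_real (sq \<phi> 1)"
  using plf_sq[of \<phi> 1] by simp

lemma null_ideal_sq: "plf \<phi> \<Longrightarrow> a \<in> null_ideal \<phi> \<longleftrightarrow> sq \<phi> a = 0"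
  by (simp add: null_ideal_def plf_sq)

lemma plf_star_add_scaleC:
  assumes "plf \<phi>"
  shows "\<phi> (star (a + c *\<^sub>C b) * (a + c *\<^sub>C b)) =
    \<phi> (star a * a) + c * \<phi> (star a * b) + cnj c * \<phi> (star b * a) + cnj c * c * \<phi> (star b * b)"
  using assms
  by (simp add: star_add star_scaleC ring_distribs plf_simps mult_scaleC_left mult_scaleC_right)

text \<open>Positivity on \<open>a + c b\<close> makes the sum of the cross terms real for every
  \<open>c\<close>; the values \<open>c = 1\<close> and \<open>c = \<i>\<close> compare imaginary
  and real parts.\<close>

lemma plf_hermitian:
  assumes "plf \<phi>"
  shows "\<phi> (star b * a) = cnj (\<phi> (star a * b))"
proof -
  have "c * \<phi> (star a * b) + cnj c * \<phi> (star b * a) \<in> \<real>" for c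
  proof -
    have "c * \<phi> (star a * b) + cnj c * \<phi> (star b * a) =
      of_real (sq \<phi> (a + c *\<^sub>C b)) - of_real (sq \<phi> a) - cnj c * c * of_real (sq \<phi> b)"
      using plf_star_add_scaleC[OF assms, of a c b] assms by (simp add: plf_sq)
    also have "\<dots> \<in> \<real>"
      by (simp add: complex_is_Real_iff)
    finally show ?thesis .
  qed
  from this[of 1] this[of \<i>] show ?thesis
    by (simp add: complex_is_Real_iff complex_eq_iff)
qed

lemma plf_star: "plf \<phi> \<Longrightarrow> \<phi> (star a) = cnj (\<phi> a)"
  using plf_hermitian[of \<phi> a 1] by simp

lemma plf_selfadjoint: "plf \<phi> \<Longrightarrow> star a = a \<Longrightarrow> \<phi> a = of_real (Re (\<phi> a))"
  using plf_star[of \<phi> a] by (simp add: complex_eq_iff)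

lemma sq_add_scaleC:
  assumes "plf \<phi>"
  shows "sq \<phi> (a + c *\<^sub>C b) = sq \<phi> a + 2 * Re (c * \<phi> (star a * b)) + (cmod c)\<^sup>2 * sq \<phi> b"
proof -
  have "Re (cnj c * \<phi> (star b * a)) = Re (c * \<phi> (star a * b))"
    by (subst plf_hermitian[OF assms, of b a]) simp
  moreover have "Re (cnj c * c * \<phi> (star b * b)) = (cmod c)\<^sup>2 * sq \<phi> b"
    by (simp add: plf_sq assms cmod_power2) (simp add: power2_eq_square algebra_simps)
  ultimately show ?thesis
    using arg_cong[where f = Re, OF plf_star_add_scaleC[OF assms, of a c b]]
    by (simp add: sq_def del: times_complex.sel)
qed

lemma plf_Cauchy_Schwarz:
  assumes "plf \<phi>"
  shows "(cmod (\<phi> (star a * b)))\<^sup>2 \<le> sq \<phi> a * sq \<phi> b"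
  using sq_nonneg[OF assms]
  by (intro quadratic_nonneg_imp_discrim) (simp_all only: sq_add_scaleC[OF assms, symmetric])

lemma plf_Cauchy_Schwarz_one:
  assumes "plf \<phi>"
  shows "(cmod (\<phi> b))\<^sup>2 \<le> sq \<phi> 1 * sq \<phi> b"
  using plf_Cauchy_Schwarz[OF assms, of 1 b] by simp

lemma plf_zero_functional [simp]: "plf (\<lambda>a. 0)"
  by (simp add: plf_def)

lemma plf_plus: "plf \<phi> \<Longrightarrow> plf \<psi> \<Longrightarrow> plf (\<lambda>a. \<phi> a + \<psi> a)"
  by (auto simp: plf_def algebra_simps)

lemma plf_times: "plf \<phi> \<Longrightarrow> 0 \<le> r \<Longrightarrow> plf (\<lambda>a. complex_of_real r * \<phi> a)"
  by (auto simp: plf_def algebra_simps complex_nonneg_Reals_iff)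

lemma plf_conj:
  assumes "plf \<phi>"
  shows "plf (\<lambda>b. \<phi> (star a * b * a))"
  unfolding plf_def
proof (intro conjI allI)
  fix b
  have "star a * (star b * b) * a = star (b * a) * (b * a)"
    by (simp add: star_mult mult.assoc)
  then show "\<phi> (star a * (star b * b) * a) \<in> \<real>\<^sub>\<ge>\<^sub>0"
    using plf_star_mult[OF assms] by simp
qed (use assms in \<open>simp_all add: ring_distribs plf_simps mult_scaleC_left mult_scaleC_right\<close>)

lemma sq_conj: "sq (\<lambda>b. \<phi> (star a * b * a)) b = sq \<phi> (b * a)"
  by (simp add: sq_def star_mult mult.assoc)

text \<open>Polarization of \<open>star 1 * a\<close>: every element is a combination of elements
  \<open>star b * b\<close>, so linear functionals are determined by their values on those.\<close>

lemma polarization_one: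
  "4 *\<^sub>C (a::'a::cstar_algebra) =
     star (a + 1) * (a + 1) - star (a - 1) * (a - 1)
     + \<i> *\<^sub>C (star (a + \<i> *\<^sub>C 1) * (a + \<i> *\<^sub>C 1)) - \<i> *\<^sub>C (star (a - \<i> *\<^sub>C 1) * (a - \<i> *\<^sub>C 1))"
proof -
  have r: "4 *\<^sub>C a = a + a + a + a"
    using scaleC_add_left[of 2 2 a] scaleC_add_left[of 1 1 a] by (simp add: add_ac)
  show ?thesis unfolding r
    by (simp add: star_add star_diff star_scaleC ring_distribs mult_scaleC_left mult_scaleC_right
        scaleC_add_right scaleC_diff_right scaleC_scaleC scaleC_minus_right scaleC_minus_one)
qed

lemma linear_functional_eqI:
  fixes \<phi> \<psi> :: "'a::cstar_algebra \<Rightarrow> complex"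
  assumes "\<And>a b. \<phi> (a + b) = \<phi> a + \<phi> b" "\<And>c a. \<phi> (c *\<^sub>C a) = c * \<phi> a"
    and "\<And>a b. \<psi> (a + b) = \<psi> a + \<psi> b" "\<And>c a. \<psi> (c *\<^sub>C a) = c * \<psi> a"
    and eq: "\<And>b. \<phi> (star b * b) = \<psi> (star b * b)"
  shows "\<phi> = \<psi>"
proof
  fix a
  have m: "\<phi> (- x) = - \<phi> x" "\<psi> (- x) = - \<psi> x" for x
    using assms(2)[of "-1" x] assms(4)[of "-1" x] by (simp_all add: scaleC_minus_one)
  have d: "\<phi> (x - y) = \<phi> x - \<phi> y" "\<psi> (x - y) = \<psi> x - \<psi> y" for x y
    using assms(1)[of x "-y"] assms(3)[of x "-y"] by (simp_all add: m)
  have "\<phi> (4 *\<^sub>C a) = \<psi> (4 *\<^sub>C a)"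
    unfolding polarization_one by (simp only: assms(1-4) d eq)
  then show "\<phi> a = \<psi> a" by (simp add: assms)
qed

lemma plf_eqI: "plf \<phi> \<Longrightarrow> plf \<psi> \<Longrightarrow> (\<And>b. sq \<phi> b = sq \<psi> b) \<Longrightarrow> \<phi> = \<psi>"
  by (rule linear_functional_eqI) (simp_all add: plf_simps plf_sq)

lemma plf_le_iff:
  assumes "plf \<mu>" "plf \<nu>"
  shows "plf_le \<nu> \<mu> \<longleftrightarrow> (\<forall>b. sq \<nu> b \<le> sq \<mu> b)"
proof -
  have "\<mu> (star b * b) - \<nu> (star b * b) \<in> \<real>\<^sub>\<ge>\<^sub>0 \<longleftrightarrow> sq \<nu> b \<le> sq \<mu> b" for b
    using assms by (simp add: plf_sq complex_nonneg_Reals_iff)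
  then show ?thesis using assms by (auto simp: plf_le_def plf_def algebra_simps)
qed

lemma sq_diff: "sq (\<lambda>a. \<mu> a - \<nu> a) b = sq \<mu> b - sq \<nu> b"
  and sq_plus: "sq (\<lambda>a. \<mu> a + \<nu> a) b = sq \<mu> b + sq \<nu> b"
  and sq_times: "sq (\<lambda>a. complex_of_real r * \<mu> a) b = r * sq \<mu> b"
  and sq_zero: "sq (\<lambda>a. 0) b = 0"
  by (simp_all add: sq_def)

lemma plf_minus_functional:
  "plf \<mu> \<Longrightarrow> plf \<nu> \<Longrightarrow> (\<And>b. sq \<nu> b \<le> sq \<mu> b) \<Longrightarrow> plf (\<lambda>a. \<mu> a - \<nu> a)"
  using plf_le_iff[of \<mu> \<nu>] by (simp add: plf_le_def)

lemma null_ideal_mono: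
  assumes "plf \<mu>" "plf \<nu>" "\<And>b. sq \<nu> b \<le> sq \<mu> b"
  shows "null_ideal \<mu> \<subseteq> null_ideal \<nu>"
proof
  fix a assume "a \<in> null_ideal \<mu>"
  then show "a \<in> null_ideal \<nu>"
    using assms(3)[of a] sq_nonneg[OF assms(2), of a] assms by (simp add: null_ideal_sq)
qed

section \<open>Binomial series\<close>

text \<open>The binomial series of \<open>1 + z\<close> to the real power \<open>\<alpha>\<close>,
  for \<open>norm z < 1\<close>. It takes the place of a functional calculus: square roots, fourth
  roots and inverse square roots all obey one exponent law.\<close>

definition binser :: "real \<Rightarrow> 'a::{real_normed_algebra_1,banach} \<Rightarrow> 'a" where
  "binser \<alpha> z = (\<Sum>n. (\<alpha> gchoose n) *\<^sub>R z ^ n)"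

lemma gbinomial_abs_summable:
  fixes r :: real
  assumes "0 \<le> r" "r < 1"
  shows "summable (\<lambda>n. \<bar>\<alpha> gchoose n\<bar> * r ^ n)"
proof -
  have "ereal (norm r) < conv_radius (\<lambda>n. \<alpha> gchoose n)"
    using assms by (auto simp: conv_radius_gchoose)
  from abs_summable_in_conv_radius[OF this] show ?thesis
    using assms by (simp add: abs_mult power_abs)
qed

lemma binser_abs_summable:
  fixes z :: "'a::{real_normed_algebra_1,banach}"
  assumes "norm z < 1"
  shows "summable (\<lambda>n. norm ((\<alpha> gchoose n) *\<^sub>R z ^ n))"
proof (rule summable_comparison_test)
  show "\<exists>N. \<forall>n\<ge>N. norm (norm ((\<alpha> gchoose n) *\<^sub>R z ^ n)) \<le> \<bar>\<alpha> gchoose n\<bar> * norm z ^ n"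
    by (auto intro!: mult_left_mono norm_power_ineq)
qed (use assms in \<open>auto intro!: gbinomial_abs_summable\<close>)

text \<open>Cauchy product of the two series; the coefficients combine by the Vandermonde
  identity.\<close>

lemma binser_mult:
  fixes z :: "'a::{real_normed_algebra_1,banach}"
  assumes "norm z < 1"
  shows "binser \<alpha> z * binser \<beta> z = binser (\<alpha> + \<beta>) z"
proof -
  have "binser \<alpha> z * binser \<beta> z =
    (\<Sum>k. \<Sum>i\<le>k. ((\<alpha> gchoose i) *\<^sub>R z ^ i) * ((\<beta> gchoose (k - i)) *\<^sub>R z ^ (k - i)))"
    unfolding binser_def by (rule Cauchy_product[OF binser_abs_summable[OF assms] binser_abs_summable[OF assms]])
  also have "\<dots> = binser (\<alpha> + \<beta>) z"
    unfolding binser_def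
  proof (rule suminf_cong)
    fix k
    have "(\<Sum>i\<le>k. ((\<alpha> gchoose i) *\<^sub>R z ^ i) * ((\<beta> gchoose (k - i)) *\<^sub>R z ^ (k - i))) =
       (\<Sum>i\<le>k. ((\<alpha> gchoose i) * (\<beta> gchoose (k - i))) *\<^sub>R z ^ k)"
      by (intro sum.cong) (auto simp: mult.commute simp flip: power_add)
    also have "\<dots> = ((\<alpha> + \<beta>) gchoose k) *\<^sub>R z ^ k"
      by (simp add: atLeast0AtMost flip: scaleR_sum_left gbinomial_Vandermonde)
    finally show "(\<Sum>i\<le>k. ((\<alpha> gchoose i) *\<^sub>R z ^ i) * ((\<beta> gchoose (k - i)) *\<^sub>R z ^ (k - i))) =
       ((\<alpha> + \<beta>) gchoose k) *\<^sub>R z ^ k" .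
  qed
  finally show ?thesis .
qed

lemma binser_0: "binser 0 z = 1"
proof -
  have "(\<lambda>n. ((0::real) gchoose n) *\<^sub>R z ^ n) sums (\<Sum>n\<in>{0}. ((0::real) gchoose n) *\<^sub>R z ^ n)"
    by (rule sums_finite) (auto simp: gbinomial_0_left)
  then show ?thesis by (simp add: binser_def sums_iff)
qed

lemma binser_1: "binser 1 z = 1 + z"
proof -
  have "(\<lambda>n. ((1::real) gchoose n) *\<^sub>R z ^ n) sums (\<Sum>n\<in>{0,1}. ((1::real) gchoose n) *\<^sub>R z ^ n)"
  proof (rule sums_finite)
    fix n :: nat assume "n \<notin> {0, 1}"
    then have "(1::nat) choose n = 0" by (intro binomial_eq_0) auto
    then have "(1::real) gchoose n = 0" by (metis binomial_gbinomial of_nat_0 of_nat_1)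
    then show "((1::real) gchoose n) *\<^sub>R z ^ n = 0" by simp
  qed simp
  then show ?thesis by (simp add: binser_def sums_iff)
qed

lemma star_suminf:
  fixes f :: "nat \<Rightarrow> 'a::cstar_algebra"
  shows "summable f \<Longrightarrow> star (suminf f) = (\<Sum>n. star (f n))"
  by (rule bounded_linear.suminf[OF bounded_linear_star])

lemma star_binser:
  fixes z :: "'a::cstar_algebra"
  assumes "norm z < 1" "star z = z"
  shows "star (binser \<alpha> z) = binser \<alpha> z"
  unfolding binser_def
  by (subst star_suminf) (use assms binser_abs_summable[OF assms(1)] in
      \<open>auto simp: star_scaleR star_power summable_norm_cancel\<close>)

lemma commute_power_series:
  fixes z y :: "'a::{real_normed_algebra_1,banach}"
  assumes "summable (\<lambda>n. c n *\<^sub>R z ^ n)" "z * y = y * z"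
  shows "(\<Sum>n. c n *\<^sub>R z ^ n) * y = y * (\<Sum>n. c n *\<^sub>R z ^ n)"
proof -
  have "z ^ n * y = y * z ^ n" for n
    by (rule power_commuting_commutes) (rule assms(2))
  then show ?thesis
    using assms(1) by (simp add: suminf_mult2 flip: suminf_mult)
qed

lemma binser_commute:
  fixes z y :: "'a::{real_normed_algebra_1,banach}"
  assumes "norm z < 1" "z * y = y * z"
  shows "binser \<alpha> z * y = y * binser \<alpha> z"
  unfolding binser_def using assms
  by (intro commute_power_series) (auto intro: summable_norm_cancel binser_abs_summable)

section \<open>Norm bounds for positive functionals\<close>

text \<open>For \<open>norm h < 1\<close> the element \<open>1 - h\<close> is the square of its
  self-adjoint binomial root, so \<open>\<phi>\<close> is nonnegative on it. Continuity is not part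
  of \<open>plf\<close>; it is derived from this lemma.\<close>

lemma plf_one_minus_nonneg:
  assumes "plf \<phi>" "star h = h" "norm h < 1"
  shows "Re (\<phi> h) \<le> sq \<phi> 1"
proof -
  define k where "k = binser (1/2) (- h)"
  have "k * k = 1 - h"
    using assms(3) by (simp add: k_def binser_mult binser_1)
  moreover have "star k = k"
    unfolding k_def using assms by (intro star_binser) (auto simp: star_minus)
  ultimately have "\<phi> (1 - h) = of_real (sq \<phi> k)"
    using plf_sq[OF assms(1), of k] by simp
  then show ?thesis
    using sq_nonneg[OF assms(1), of k] assms(1) by (simp add: plf_simps plf_one complex_eq_iff)
qed

lemma plf_le_norm_selfadjoint:
  assumes "plf \<phi>" "star h = h"
  shows "Re (\<phi> h) \<le> norm h * sq \<phi> 1"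
proof (rule field_le_epsilon)
  fix e :: real assume "e > 0"
  define s where "s = sq \<phi> 1"
  have s: "s \<ge> 0" using assms by (simp add: s_def sq_nonneg)
  \<comment> \<open>Slightly more than \<open>norm h\<close>, so that \<open>h / r\<close> has norm
    below 1. The denominator \<open>s + 1\<close> cannot vanish and keeps the error
    \<open>e * s / (s + 1)\<close> at most \<open>e\<close>.\<close>
  define r where "r = norm h + e / (s + 1)"
  have d: "e / (s + 1) > 0" using \<open>e > 0\<close> s by simp
  then have r: "r > norm h" "r > 0" using norm_ge_zero[of h] by (auto simp: r_def simp del: norm_ge_zero)
  have "Re (\<phi> ((1/r) *\<^sub>R h)) \<le> s"
    unfolding s_def using r assms by (intro plf_one_minus_nonneg) (auto simp: star_scaleR)
  then have "Re (\<phi> h) \<le> r * s"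
    using r assms by (simp add: plf_simps field_simps)
  also have "\<dots> \<le> norm h * s + e"
    using \<open>e > 0\<close> s by (simp add: r_def field_simps)
  finally show "Re (\<phi> h) \<le> norm h * sq \<phi> 1 + e" by (simp add: s_def)
qed

lemma sq_le_norm:
  assumes "plf \<phi>"
  shows "sq \<phi> a \<le> (norm a)\<^sup>2 * sq \<phi> 1"
  using plf_le_norm_selfadjoint[OF assms, of "star a * a"]
  by (simp add: star_mult star_star cstar_identity flip: sq_def)

lemma plf_norm_bound:
  assumes "plf \<phi>"
  shows "cmod (\<phi> a) \<le> sq \<phi> 1 * norm a"
proof (rule power2_le_imp_le)
  have "(cmod (\<phi> a))\<^sup>2 \<le> sq \<phi> 1 * sq \<phi> a" by (rule plf_Cauchy_Schwarz_one[OF assms])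
  also have "\<dots> \<le> sq \<phi> 1 * ((norm a)\<^sup>2 * sq \<phi> 1)"
    using assms by (intro mult_left_mono sq_le_norm sq_nonneg)
  finally show "(cmod (\<phi> a))\<^sup>2 \<le> (sq \<phi> 1 * norm a)\<^sup>2"
    by (simp add: power2_eq_square mult_ac)
qed (use assms in \<open>simp add: sq_nonneg\<close>)

lemma bounded_linear_plf:
  assumes "plf \<phi>"
  shows "bounded_linear \<phi>"
  by (rule bounded_linear_intro[of _ "sq \<phi> 1"])
     (use plf_norm_bound[OF assms] assms in
       \<open>auto simp: plf_simps mult.commute[of "norm _"] scaleR_conv_of_real[where 'a = complex]\<close>)

text \<open>\<open>sq_le_norm\<close> for the positive functional
  \<open>x \<mapsto> \<phi> (star b * x * b)\<close>. This is what makes left multiplication bounded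
  for the GNS seminorm.\<close>

lemma sq_mult_le:
  assumes "plf \<phi>"
  shows "sq \<phi> (a * b) \<le> (norm a)\<^sup>2 * sq \<phi> b"
  using sq_le_norm[OF plf_conj[OF assms, of b], of a] by (simp add: sq_conj)

text \<open>\<open>w + \<i> x\<close> is an isometry because \<open>w\<close> and \<open>x\<close>
  commute, so it has norm 1, and \<open>w\<close> is its real part.\<close>

lemma norm_le_1_of_circle:
  fixes w x :: "'a::cstar_algebra"
  assumes "star w = w" "star x = x" "w * x = x * w" "w * w + x * x = 1"
  shows "norm w \<le> 1"
proof -
  define v where "v = w + \<i> *\<^sub>C x"
  have sv: "star v = w - \<i> *\<^sub>C x"
    using assms by (simp add: v_def star_add star_scaleC)
       (metis complex_cnj_i diff_conv_add_uminus mult_minus1 scaleC_minus_one scaleC_scaleC)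
  have "star v * v = 1"
    unfolding sv using assms(3,4)
    by (simp add: v_def scaleC_diff_right ring_distribs mult_scaleC_left mult_scaleC_right scaleC_scaleC scaleC_minus_one)
  then have "(norm v)\<^sup>2 = 1"
    using cstar_identity[of v] by simp
  then have "norm v = 1"
    using norm_ge_zero[of v] unfolding power2_eq_1_iff by linarith
  moreover have "w = (1/2) *\<^sub>R (v + star v)"
    by (simp only: sv) (simp add: v_def flip: scaleR_2)
  then have "norm w \<le> (1/2) * (norm v + norm (star v))"
    by (metis abs_of_pos half_gt_zero mult_le_cancel_left_pos norm_scaleR norm_triangle_ineq zero_less_one)
  ultimately show ?thesis by simp
qed

section \<open>Absolute values of self-adjoint elements\<close>

lemma gbinomial_minus_half_sign: "0 \<le> (- 1) ^ n * ((- 1 / 2 :: real) gchoose n)"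
proof (induction n)
  case (Suc n)
  have "((- 1 / 2 :: real) gchoose Suc n) = ((- 1 / 2) gchoose n) * ((- 1 / 2 - real n) / real (Suc n))"
    using gbinomial_mult_1[of "- 1 / 2 :: real" n] by (simp add: field_simps del: of_nat_Suc)
  moreover have "(- 1 / 2 - real n) / real (Suc n) = - ((1 / 2 + real n) / real (Suc n))"
    by (simp add: field_simps)
  ultimately have e: "((- 1 / 2 :: real) gchoose Suc n) = ((- 1 / 2) gchoose n) * - ((1 / 2 + real n) / real (Suc n))"
    by metis
  have "(- 1) ^ Suc n * ((- 1 / 2 :: real) gchoose Suc n) =
    ((- 1) ^ n * ((- 1 / 2) gchoose n)) * ((1 / 2 + real n) / real (Suc n))"
    unfolding e by (simp del: of_nat_Suc)
  also have "\<dots> \<ge> 0" by (intro mult_nonneg_nonneg Suc.IH) simp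
  finally show ?case .
qed simp

text \<open>The series of the root of \<open>1 - x\<close> has no positive coefficient after the
  constant one: absorption reduces its coefficients to those of the power -1/2, whose signs are
  known.\<close>

lemma gbinomial_half_sign: "(- 1) ^ Suc n * ((1 / 2 :: real) gchoose Suc n) \<le> 0"
proof -
  have "((1 / 2 :: real) gchoose Suc n) = (1 / 2) / real (Suc n) * ((- 1 / 2) gchoose n)"
    using gbinomial_absorption[of n "1/2 :: real"] by (simp add: field_simps del: of_nat_Suc)
  then have "(- 1) ^ Suc n * ((1 / 2 :: real) gchoose Suc n) =
    - ((1 / 2) / real (Suc n) * ((- 1) ^ n * ((- 1 / 2) gchoose n)))"
    by simp
  also have "\<dots> \<le> 0"
    using gbinomial_minus_half_sign[of n] by (simp del: of_nat_Suc)
  finally show ?thesis .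
qed

text \<open>Since the signs are known, each partial sum of absolute values is 2 minus a signed
  partial sum, which has the closed form \<open>(-1) ^ n * ((-1/2) gchoose n)\<close> and is
  nonnegative. Absolute summability lets the root series be used up to
  \<open>norm z = 1\<close>.\<close>

lemma summable_gbinomial_half: "summable (\<lambda>n. \<bar>(1 / 2 :: real) gchoose n\<bar>)"
proof (rule bounded_imp_summable)
  fix n
  \<comment> \<open>At \<open>k = 0\<close> the coefficient is 1, with the sign opposite to all
    later terms; the summand 2 corrects for it.\<close>
  have *: "\<bar>(1 / 2 :: real) gchoose k\<bar> = (if k = 0 then 2 else 0) - ((1 / 2) gchoose k) * (- 1) ^ k" for k
  proof (cases k)
    case (Suc m)
    have "\<bar>(1 / 2 :: real) gchoose k\<bar> = \<bar>(- 1) ^ k * ((1 / 2 :: real) gchoose k)\<bar>"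
      by (simp add: abs_mult)
    with gbinomial_half_sign[of m] show ?thesis by (simp add: Suc mult.commute)
  qed simp
  have "(\<Sum>k\<le>n. \<bar>(1 / 2 :: real) gchoose k\<bar>) = 2 - (- 1) ^ n * ((- 1 / 2) gchoose n)"
    using gbinomial_sum_lower_neg[of "1/2 :: real" n] by (simp add: * sum_subtractf)
  also have "\<dots> \<le> 2" using gbinomial_minus_half_sign[of n] by simp
  finally show "(\<Sum>k\<le>n. \<bar>(1 / 2 :: real) gchoose k\<bar>) \<le> 2" .
qed simp

text \<open>\<open>h\<close> is the root of \<open>(1 - r) + r a^2\<close>, an invertible substitute
  for the absolute value of \<open>a\<close>. With \<open>w = sqrt r a / h\<close> and
  \<open>x = sqrt (1 - r) / h\<close> one has \<open>w^2 + x^2 = 1\<close>, so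
  \<open>norm w \<le> 1\<close>; conjugating by the root \<open>k\<close> of \<open>h\<close> turns
  this into \<open>sqrt r a \<le> h\<close> under \<open>\<phi>\<close>.\<close>

lemma cstar_abs_approx:
  fixes a :: "'a::cstar_algebra"
  assumes "star a = a" "norm (a * a - 1) \<le> 1" "0 < r" "r < 1" "plf \<phi>"
  defines "h \<equiv> binser (1/2) (r *\<^sub>R (a * a - 1))"
  shows "h * h = 1 + r *\<^sub>R (a * a - 1)" "sqrt r * Re (\<phi> a) \<le> Re (\<phi> h)"
proof -
  define z where "z = r *\<^sub>R (a * a - 1)"
  have "norm z \<le> r" using assms(2,3) by (simp add: z_def)
  then have nz: "norm z < 1" using assms by linarith
  have sz: "star z = z" using assms(1) by (simp add: z_def star_scaleR star_diff star_mult)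
  have za: "z * a = a * z" by (simp add: z_def algebra_simps)
  \<comment> \<open>The fourth root and the inverse square root of \<open>1 + z\<close>, that is,
    the root and the inverse of \<open>h\<close>; as power series in \<open>z\<close> they commute
    with \<open>a\<close> and with each other.\<close>
  define k l where "k = binser (1/4) z" and "l = binser (-1/2) z"
  have h: "h = binser (1/2) z" by (simp add: h_def z_def)
  have kk: "k * k = h" and hl: "h * l = 1" "l * h = 1" and hh: "h * h = 1 + z"
    using nz by (simp_all add: h k_def l_def binser_mult binser_1 binser_0)
  have lk: "l * k = k * l" using nz by (simp add: k_def l_def binser_mult)
  have la: "l * a = a * l" and ka: "k * a = a * k" and ha: "h * a = a * h"
    using nz za by (simp_all add: l_def k_def h binser_commute)
  have s: "star k = k" "star l = l" using nz sz by (simp_all add: k_def l_def star_binser)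
  show "h * h = 1 + r *\<^sub>R (a * a - 1)" using hh by (simp add: z_def)
  define w x where "w = sqrt r *\<^sub>R (a * l)" and "x = sqrt (1 - r) *\<^sub>R l"
  have "w * w + x * x = r *\<^sub>R (a * l * (a * l)) + (1 - r) *\<^sub>R (l * l)"
    using assms by (simp add: w_def x_def)
  also have "a * l * (a * l) = (a * a) * (l * l)"
    by (metis la mult.assoc)
  also have "r *\<^sub>R ((a * a) * (l * l)) + (1 - r) *\<^sub>R (l * l) = (1 + z) * (l * l)"
    by (simp add: z_def algebra_simps)
  also have "\<dots> = 1"
    using hl hh by (metis mult.assoc mult.right_neutral)
  finally have wx: "w * w + x * x = 1" .
  have nw: "norm w \<le> 1"
  proof (rule norm_le_1_of_circle)
    show "star w = w" by (simp add: w_def star_scaleR star_mult s assms(1) la)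
    show "star x = x" by (simp add: x_def star_scaleR s)
    have "a * l * l = l * (a * l)" by (metis la mult.assoc)
    then show "w * x = x * w" by (simp add: w_def x_def mult.commute)
  qed (rule wx)
  have sw: "star w = w" by (simp add: w_def star_scaleR star_mult s assms(1) la)
  let ?\<psi> = "\<lambda>b. \<phi> (star k * b * k)"
  have "Re (?\<psi> w) \<le> norm w * sq ?\<psi> 1"
    by (rule plf_le_norm_selfadjoint[OF plf_conj[OF assms(5)] sw])
  also have "\<dots> \<le> sq ?\<psi> 1"
    using nw sq_nonneg[OF plf_conj[OF assms(5), of k], of 1] by (simp add: mult_left_le_one_le)
  also have "sq ?\<psi> 1 = Re (\<phi> h)" by (simp add: sq_def s kk)
  finally have "Re (\<phi> (k * w * k)) \<le> Re (\<phi> h)" by (simp add: s)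
  also have "k * w * k = sqrt r *\<^sub>R a"
  proof -
    have "k * (a * l) * k = a * l * (k * k)"
      by (metis ka lk mult.assoc)
    also have "\<dots> = a" by (simp add: kk hl mult.assoc)
    finally show ?thesis by (simp add: w_def)
  qed
  finally show "sqrt r * Re (\<phi> a) \<le> Re (\<phi> h)" by (simp add: plf_simps assms(5))
qed

text \<open>\<open>h\<close> is the absolute value of \<open>a\<close>, the root of
  \<open>1 + (a^2 - 1)\<close>. Here \<open>a^2 - 1\<close> may have norm exactly 1, so the series
  is obtained as the limit of the approximations with \<open>r\<close> tending to 1. Using both
  \<open>a\<close> and \<open>- a\<close> gives the two-sided bound.\<close>

lemma cstar_abs:
  fixes a :: "'a::cstar_algebra"
  assumes "star a = a" "norm a < 1"
  obtains h where "star h = h" "h * h = a * a" "h * a = a * h"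
    "\<And>\<phi>. plf \<phi> \<Longrightarrow> \<bar>Re (\<phi> a)\<bar> \<le> Re (\<phi> h)"
proof -
  \<comment> \<open>The root of \<open>1 - a^2\<close> satisfies the circle identity together with
    \<open>a\<close>, so \<open>norm s \<le> 1\<close> and hence
    \<open>norm (a^2 - 1) \<le> 1\<close>.\<close>
  define s where "s = binser (1/2) (- (a * a))"
  have "norm (a * a) \<le> norm a * norm a" by (rule norm_mult_ineq)
  also have "\<dots> < 1" using assms(2) by (metis abs_norm_cancel abs_square_less_1 power2_eq_square)
  finally have na: "norm (- (a * a)) < 1" by simp
  have ss: "s * s = 1 - a * a" using na by (simp add: s_def binser_mult binser_1)
  have s: "star s = s" unfolding s_def
    using na assms by (intro star_binser) (auto simp: star_minus star_mult)
  have sa: "s * a = a * s" unfolding s_def using na by (intro binser_commute) (auto simp: mult.assoc)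
  have "norm s \<le> 1"
    using s assms(1) sa ss by (intro norm_le_1_of_circle[of s a]) auto
  have nz: "norm (a * a - 1) \<le> 1"
  proof -
    have "norm (a * a - 1) = norm (s * s)" by (simp add: ss norm_minus_commute)
    also have "\<dots> \<le> norm s * norm s" by (rule norm_mult_ineq)
    also have "\<dots> \<le> 1" using \<open>norm s \<le> 1\<close> by (simp add: mult_le_one)
    finally show ?thesis .
  qed
  define z where "z = a * a - 1"
  define c where "c = (\<lambda>n. (1/2::real) gchoose n)"
  \<comment> \<open>The shift by 2 keeps \<open>r m\<close> strictly between 0 and 1 already at
    \<open>m = 0\<close>.\<close>
  define r where "r = (\<lambda>m::nat. 1 - 1 / (real m + 2))"
  define h where "h = (\<Sum>n. c n *\<^sub>R z ^ n)"
  have r: "0 < r m" "r m < 1" for m by (simp_all add: r_def field_simps)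
  have r1: "r \<longlonglongrightarrow> 1"
  proof -
    have "(\<lambda>m. 1 / real (m + 2)) \<longlonglongrightarrow> 0"
      by (rule LIMSEQ_ignore_initial_segment[OF lim_1_over_n])
    from tendsto_diff[OF tendsto_const[of 1] this] show ?thesis
      by (simp add: r_def[abs_def] add.commute)
  qed
  have bound: "norm (c n *\<^sub>R (t *\<^sub>R z) ^ n) \<le> \<bar>c n\<bar>" if "0 \<le> t" "t \<le> 1" for t n
  proof -
    have "norm ((t *\<^sub>R z) ^ n) \<le> norm (t *\<^sub>R z) ^ n" by (rule norm_power_ineq)
    also have "\<dots> \<le> 1" using nz that by (intro power_le_one) (auto simp: z_def mult_le_one)
    finally have "\<bar>c n\<bar> * norm ((t *\<^sub>R z) ^ n) \<le> \<bar>c n\<bar>" by (intro mult_left_le) auto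
    then show ?thesis by (simp only: norm_scaleR)
  qed
  have sc: "summable (\<lambda>n. \<bar>c n\<bar>)" using summable_gbinomial_half by (simp add: c_def)
  \<comment> \<open>Tannery's theorem, dominated convergence for series, with the absolute binomial
    coefficients as majorant.\<close>
  have "((\<lambda>m. \<Sum>n. c n *\<^sub>R (r m *\<^sub>R z) ^ n) \<longlongrightarrow> h) sequentially"
    unfolding h_def
  proof (rule conjunct2[OF conjunct2[OF tannerys_theorem[where M = "\<lambda>n. \<bar>c n\<bar>"]]])
    show "(\<lambda>m. c n *\<^sub>R (r m *\<^sub>R z) ^ n) \<longlonglongrightarrow> c n *\<^sub>R z ^ n" for n
      by (rule tendsto_eq_intros r1 refl)+ simp
    show "\<forall>\<^sub>F (n, m) in sequentially \<times>\<^sub>F sequentially. norm (c n *\<^sub>R (r m *\<^sub>R z) ^ n) \<le> \<bar>c n\<bar>"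
      using bound r by (intro always_eventually) (auto simp: less_imp_le)
  qed (use sc in auto)
  then have lim: "(\<lambda>m. binser (1/2) (r m *\<^sub>R z)) \<longlonglongrightarrow> h"
    by (simp add: binser_def c_def)
  have summ: "summable (\<lambda>n. c n *\<^sub>R z ^ n)"
    using bound[of 1] sc by (intro summable_comparison_test[OF _ sc]) auto
  have appr: "binser (1/2) (r m *\<^sub>R z) * binser (1/2) (r m *\<^sub>R z) = 1 + r m *\<^sub>R z"
     "plf \<phi> \<Longrightarrow> sqrt (r m) * \<bar>Re (\<phi> a)\<bar> \<le> Re (\<phi> (binser (1/2) (r m *\<^sub>R z)))" for m \<phi>
    using cstar_abs_approx[OF assms(1) nz r[of m]] cstar_abs_approx[of "-a", OF _ _ r[of m]] assms(1) nz
    by (auto simp: z_def star_minus plf_simps abs_if intro: plf_zero_functional)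
  show ?thesis
  proof
    have sz: "star z = z" using assms(1) by (simp add: z_def star_diff star_mult)
    show "star h = h"
      unfolding h_def by (simp add: star_suminf[OF summ] star_scaleR star_power sz)
    have "(\<lambda>m. 1 + r m *\<^sub>R z) \<longlonglongrightarrow> h * h"
      using tendsto_mult[OF lim lim] by (simp add: appr)
    moreover have "(\<lambda>m. 1 + r m *\<^sub>R z) \<longlonglongrightarrow> 1 + 1 *\<^sub>R z"
      by (intro tendsto_intros r1)
    ultimately show "h * h = a * a" using LIMSEQ_unique by (fastforce simp: z_def)
    show "h * a = a * h"
      unfolding h_def by (rule commute_power_series[OF summ]) (simp add: z_def algebra_simps)
    fix \<phi> :: "'a \<Rightarrow> complex" assume p: "plf \<phi>"
    have "(\<lambda>m. sqrt (r m) * \<bar>Re (\<phi> a)\<bar>) \<longlonglongrightarrow> sqrt 1 * \<bar>Re (\<phi> a)\<bar>"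
      by (intro tendsto_intros r1)
    moreover have "(\<lambda>m. Re (\<phi> (binser (1/2) (r m *\<^sub>R z)))) \<longlonglongrightarrow> Re (\<phi> h)"
      by (intro tendsto_intros bounded_linear.tendsto[OF bounded_linear_plf[OF p]] lim)
    ultimately show "\<bar>Re (\<phi> a)\<bar> \<le> Re (\<phi> h)"
      using LIMSEQ_le[of _ "sqrt 1 * \<bar>Re (\<phi> a)\<bar>"] appr(2)[OF p] by fastforce
  qed
qed

text \<open>With \<open>n = \<bar>a\<bar> - a\<close> one has \<open>n a n = - n\<^sup>3 / 2\<close>, so the assumption forces \<open>n\<^sup>2\<close> into the null ideal
  of \<open>lam\<close>, and hence \<open>\<theta> n = 0\<close>.\<close>

lemma plf_nonneg_of_null_ideal:
  assumes lam: "plf lam" and th: "plf \<theta>" and null: "null_ideal lam \<subseteq> null_ideal \<theta>"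
    and a: "star a = a" and pos: "\<And>b. 0 \<le> Re (lam (star b * a * b))"
  shows "0 \<le> Re (\<theta> a)"
proof -
  have *: "0 \<le> Re (\<theta> a)" if a: "star a = a" "norm a < 1" and pos: "\<And>b. 0 \<le> Re (lam (star b * a * b))" for a
  proof -
    obtain h where h: "star h = h" "h * h = a * a" "h * a = a * h"
      "\<And>\<phi>. plf \<phi> \<Longrightarrow> \<bar>Re (\<phi> a)\<bar> \<le> Re (\<phi> h)"
      using cstar_abs[OF a] by blast
    define n where "n = h - a"
    have sn: "star n = n" by (simp add: n_def star_diff h a)
    have n2: "n * (h + a) = 0" by (simp add: n_def algebra_simps h(2,3))
    have nan: "n * a * n = (- 1 / 2) *\<^sub>R (n * n * n)"
    proof -
      have "2 *\<^sub>R (n * a) = n * (h + a) - n * n"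
        by (simp add: n_def algebra_simps scaleR_2)
      then have "n * a = (- 1 / 2) *\<^sub>R (n * n)" by (simp add: n2 scaleR_left_imp_eq[of 2])
      then show ?thesis by simp
    qed
    have le: "Re (lam (star c * (n * n * n) * c)) \<le> 0" for c
    proof -
      have "star (n * c) * a * (n * c) = (- 1 / 2) *\<^sub>R (star c * (n * n * n) * c)"
        using arg_cong[where f = "\<lambda>x. star c * x * c", OF nan] by (simp add: star_mult sn mult.assoc)
      then show ?thesis using pos[of "n * c"] lam by (simp add: plf_simps)
    qed
    \<comment> \<open>The opposite sign: \<open>n = h - a\<close>, and \<open>h\<close> dominates
      \<open>a\<close> under the functional conjugated by \<open>n * c\<close>.\<close>
    have ge: "Re (lam (star c * (n * n * n) * c)) \<ge> 0" for c
    proof -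
      have "\<bar>Re (lam (star (n * c) * a * (n * c)))\<bar> \<le> Re (lam (star (n * c) * h * (n * c)))"
        by (rule h(4)[OF plf_conj[OF lam]])
      moreover have "star (n * c) * h * (n * c) - star (n * c) * a * (n * c) = star c * (n * n * n) * c"
      proof -
        have "star (n * c) * h * (n * c) - star (n * c) * a * (n * c) = star (n * c) * n * (n * c)"
          by (simp add: n_def left_diff_distrib right_diff_distrib)
        then show ?thesis by (simp add: star_mult sn mult.assoc)
      qed
      ultimately show ?thesis using plf_diff[OF lam]
        by (metis abs_ge_self diff_ge_0_iff_ge minus_complex.sel(1) order_trans)
    qed
    have z: "lam (star c * (n * n * n) * c) = 0" for c
    proof -
      have "star (star c * (n * n * n) * c) = star c * (n * n * n) * c"
        by (simp add: star_mult sn star_star mult.assoc)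
      from plf_selfadjoint[OF lam this] show ?thesis using le[of c] ge[of c] by simp
    qed
    have "sq lam (n * n) = 0"
    proof -
      \<comment> \<open>Expanding at \<open>c = 1 + n\<close> isolates the cross term
        \<open>2 n^4\<close>, since the terms at \<open>1\<close> and at \<open>n\<close> vanish;
        and \<open>lam (n^4)\<close> is \<open>sq lam (n^2)\<close>.\<close>
      have "star (1 + n) * (n * n * n) * (1 + n) =
         star 1 * (n * n * n) * 1 + 2 *\<^sub>R (n * n * (n * n)) + star n * (n * n * n) * n"
        by (simp add: star_add sn algebra_simps scaleR_2)
      then have "lam (n * n * (n * n)) = 0"
        using z[of "1 + n"] z[of 1] z[of n] lam by (simp add: plf_simps)
      then show ?thesis by (simp add: sq_def star_mult sn)
    qed
    then have nn: "sq \<theta> (n * n) = 0" using null lam th by (auto simp: null_ideal_sq subset_iff)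
    \<comment> \<open>Two applications of Cauchy-Schwarz pass from \<open>\<theta> (n^4) = 0\<close>
      to \<open>\<theta> (n^2) = 0\<close> and on to \<open>\<theta> n = 0\<close>.\<close>
    have "(cmod (\<theta> (n * n)))\<^sup>2 \<le> sq \<theta> 1 * sq \<theta> (n * n)" by (rule plf_Cauchy_Schwarz_one[OF th])
    then have "sq \<theta> n = 0" by (simp add: nn) (simp add: sq_def sn)
    then have "\<theta> n = 0" using plf_Cauchy_Schwarz_one[OF th, of n] by simp
    then have "\<theta> a = \<theta> h" using th by (simp add: n_def plf_simps)
    with h(4)[OF th] show ?thesis by simp
  qed
  define t where "t = 1 / (norm a + 1)"
  have t: "t > 0" "norm (t *\<^sub>R a) < 1"
    using norm_ge_zero[of a] by (auto simp: t_def field_simps intro: add_nonneg_pos simp del: norm_ge_zero)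
  have "0 \<le> Re (\<theta> (t *\<^sub>R a))"
    using a t pos lam by (intro *) (auto simp: star_scaleR plf_simps)
  then show ?thesis using t th by (simp add: plf_simps zero_le_mult_iff)
qed

section \<open>Hilbert spaces with explicit carrier\<close>

definition hsub :: "'h hspace \<Rightarrow> 'h \<Rightarrow> 'h \<Rightarrow> 'h" where
  "hsub H x y = hadd H x (hscale H (-1) y)"

text \<open>The record has no zero vector; scaling any vector of the carrier by 0 produces
  it.\<close>

definition hzero :: "'h hspace \<Rightarrow> 'h" where
  "hzero H = hscale H 0 (SOME x. x \<in> hcarrier H)"

definition hlim :: "'h hspace \<Rightarrow> (nat \<Rightarrow> 'h) \<Rightarrow> 'h \<Rightarrow> bool" where
  "hlim H X x \<longleftrightarrow> (\<lambda>n. hnorm H (hsub H (X n) x)) \<longlonglongrightarrow> 0"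

text \<open>The vector space laws are not listed as axioms: \<open>definite\<close> identifies
  vectors at distance zero, so an identity between vectors follows by comparing inner products with
  the whole carrier, see \<open>eqI\<close>.\<close>

locale hilbert =
  fixes H :: "'h hspace"
  assumes carrier_nonempty: "hcarrier H \<noteq> {}"
    and add_closed [simp, intro]: "x \<in> hcarrier H \<Longrightarrow> y \<in> hcarrier H \<Longrightarrow> hadd H x y \<in> hcarrier H"
    and scale_closed [simp, intro]: "x \<in> hcarrier H \<Longrightarrow> hscale H c x \<in> hcarrier H"
    and inner_add_left [simp]: "x \<in> hcarrier H \<Longrightarrow> y \<in> hcarrier H \<Longrightarrow> z \<in> hcarrier H \<Longrightarrow>
      hinner H (hadd H x y) z = hinner H x z + hinner H y z"
    and inner_scale_left [simp]: "x \<in> hcarrier H \<Longrightarrow> z \<in> hcarrier H \<Longrightarrow>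
      hinner H (hscale H c x) z = c * hinner H x z"
    and inner_sym: "x \<in> hcarrier H \<Longrightarrow> y \<in> hcarrier H \<Longrightarrow> hinner H y x = cnj (hinner H x y)"
    and inner_self_nonneg: "x \<in> hcarrier H \<Longrightarrow> 0 \<le> Re (hinner H x x)"
    and definite: "x \<in> hcarrier H \<Longrightarrow> y \<in> hcarrier H \<Longrightarrow>
      Re (hinner H (hsub H x y) (hsub H x y)) = 0 \<Longrightarrow> x = y"
    and complete: "(\<And>n. X n \<in> hcarrier H) \<Longrightarrow>
      (\<And>e. e > 0 \<Longrightarrow> \<exists>N. \<forall>m\<ge>N. \<forall>n\<ge>N. hnorm H (hsub H (X m) (X n)) < e) \<Longrightarrow>
      \<exists>x\<in>hcarrier H. hlim H X x"
begin

abbreviation "C \<equiv> hcarrier H"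
abbreviation "ip \<equiv> hinner H"
abbreviation "nrm \<equiv> hnorm H"
abbreviation plus (infixl \<open>\<oplus>\<close> 65) where "x \<oplus> y \<equiv> hadd H x y"
abbreviation minus (infixl \<open>\<ominus>\<close> 65) where "x \<ominus> y \<equiv> hsub H x y"
abbreviation scale (infixr \<open>\<odot>\<close> 75) where "c \<odot> x \<equiv> hscale H c x"
abbreviation zer (\<open>\<zero>\<close>) where "\<zero> \<equiv> hzero H"

lemma inner_add_right [simp]: "x \<in> C \<Longrightarrow> y \<in> C \<Longrightarrow> z \<in> C \<Longrightarrow> ip z (x \<oplus> y) = ip z x + ip z y"
  by (simp add: inner_sym[of _ z])

lemma inner_scale_right [simp]: "x \<in> C \<Longrightarrow> z \<in> C \<Longrightarrow> ip z (c \<odot> x) = cnj c * ip z x"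
  by (simp add: inner_sym[of _ z])

lemma sub_closed [simp, intro]: "x \<in> C \<Longrightarrow> y \<in> C \<Longrightarrow> x \<ominus> y \<in> C"
  by (simp add: hsub_def)

lemma inner_sub_left [simp]: "x \<in> C \<Longrightarrow> y \<in> C \<Longrightarrow> z \<in> C \<Longrightarrow> ip (x \<ominus> y) z = ip x z - ip y z"
  by (simp add: hsub_def)

lemma inner_sub_right [simp]: "x \<in> C \<Longrightarrow> y \<in> C \<Longrightarrow> z \<in> C \<Longrightarrow> ip z (x \<ominus> y) = ip z x - ip z y"
  by (simp add: hsub_def)

lemma zero_closed [simp, intro]: "\<zero> \<in> C"
  using carrier_nonempty by (simp add: hzero_def some_in_eq)

lemma inner_zero_left [simp]: "z \<in> C \<Longrightarrow> ip \<zero> z = 0"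
  using carrier_nonempty inner_scale_left[of "SOME x. x \<in> C" z 0]
  by (simp add: hzero_def some_in_eq)

lemma inner_zero_right [simp]: "z \<in> C \<Longrightarrow> ip z \<zero> = 0"
  by (simp add: inner_sym[of _ z])

lemma norm_sq: "x \<in> C \<Longrightarrow> (nrm x)\<^sup>2 = Re (ip x x)"
  by (simp add: hnorm_def inner_self_nonneg)

lemma inner_self: "x \<in> C \<Longrightarrow> ip x x = of_real ((nrm x)\<^sup>2)"
  using arg_cong[where f = Im, OF inner_sym[of x x]] by (simp add: norm_sq complex_eq_iff)

lemma nrm_nonneg [simp]: "x \<in> C \<Longrightarrow> 0 \<le> nrm x"
  by (simp add: hnorm_def inner_self_nonneg)

lemma nrm_zero [simp]: "nrm \<zero> = 0"
  by (simp add: hnorm_def)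

lemma eqI:
  assumes "x \<in> C" "y \<in> C" "\<And>z. z \<in> C \<Longrightarrow> ip x z = ip y z"
  shows "x = y"
  by (rule definite) (use assms in auto)

lemma eqI_nrm: "x \<in> C \<Longrightarrow> y \<in> C \<Longrightarrow> nrm (x \<ominus> y) = 0 \<Longrightarrow> x = y"
  using norm_sq[of "x \<ominus> y"] by (intro definite) auto

lemma nrm_add_scale:
  assumes "x \<in> C" "y \<in> C"
  shows "(nrm (x \<oplus> c \<odot> y))\<^sup>2 = (nrm x)\<^sup>2 + 2 * Re (c * ip y x) + (cmod c)\<^sup>2 * (nrm y)\<^sup>2"
proof -
  have "Re (cnj c * ip x y) = Re (c * ip y x)" using inner_sym[of x y] assms by simp
  moreover have "Re (c * (cnj c * ip y y)) = (cmod c)\<^sup>2 * (nrm y)\<^sup>2"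
    using assms by (simp add: inner_self cmod_power2) (simp add: power2_eq_square algebra_simps)
  ultimately show ?thesis using assms by (simp add: norm_sq algebra_simps del: times_complex.sel)
qed

lemma nrm_add_sq:
  assumes "x \<in> C" "y \<in> C"
  shows "(nrm (x \<oplus> y))\<^sup>2 = (nrm x)\<^sup>2 + 2 * Re (ip y x) + (nrm y)\<^sup>2"
  using inner_sym[of x y] assms by (simp add: norm_sq)

lemma nrm_sub_sq:
  assumes "x \<in> C" "y \<in> C"
  shows "(nrm (x \<ominus> y))\<^sup>2 = (nrm x)\<^sup>2 - 2 * Re (ip y x) + (nrm y)\<^sup>2"
  using inner_sym[of x y] assms by (simp add: norm_sq)

lemma nrm_scale:
  assumes "x \<in> C"
  shows "nrm (c \<odot> x) = cmod c * nrm x"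
proof -
  have "Re (cnj c * (c * ip x x)) = (cmod c)\<^sup>2 * (nrm x)\<^sup>2"
    using assms by (simp add: inner_self cmod_power2) (simp add: power2_eq_square algebra_simps)
  then have "(nrm (c \<odot> x))\<^sup>2 = (cmod c * nrm x)\<^sup>2"
    using assms by (simp add: norm_sq power_mult_distrib del: times_complex.sel)
  then show ?thesis using assms by (simp add: power2_eq_iff_nonneg)
qed

lemma Cauchy_Schwarz:
  assumes "x \<in> C" "y \<in> C"
  shows "cmod (ip x y) \<le> nrm x * nrm y"
proof -
  have "(cmod (ip x y))\<^sup>2 \<le> (nrm y)\<^sup>2 * (nrm x)\<^sup>2"
    by (rule quadratic_nonneg_imp_discrim)
       (simp_all only: nrm_add_scale[OF assms(2,1), symmetric] zero_le_power2)
  then have "(cmod (ip x y))\<^sup>2 \<le> (nrm x * nrm y)\<^sup>2"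
    by (simp add: power_mult_distrib mult.commute)
  then show ?thesis by (rule power2_le_imp_le) (use assms in simp)
qed

lemma nrm_triangle:
  assumes "x \<in> C" "y \<in> C"
  shows "nrm (x \<oplus> y) \<le> nrm x + nrm y"
proof (rule power2_le_imp_le)
  have "Re (ip y x) \<le> nrm y * nrm x"
    using Cauchy_Schwarz[of y x] complex_Re_le_cmod[of "ip y x"] assms by simp
  then show "(nrm (x \<oplus> y))\<^sup>2 \<le> (nrm x + nrm y)\<^sup>2"
    using assms by (simp add: nrm_add_sq power2_sum mult.commute)
qed (use assms in simp)

lemma nrm_sub_commute:
  assumes "x \<in> C" "y \<in> C"
  shows "nrm (x \<ominus> y) = nrm (y \<ominus> x)"
  using assms by (simp add: hnorm_def algebra_simps)

lemma nrm_sub_triangle: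
  assumes "x \<in> C" "y \<in> C" "z \<in> C"
  shows "nrm (x \<ominus> z) \<le> nrm (x \<ominus> y) + nrm (y \<ominus> z)"
proof -
  have "x \<ominus> z = (x \<ominus> y) \<oplus> (y \<ominus> z)" using assms by (intro eqI) auto
  then show ?thesis using assms by (simp add: nrm_triangle)
qed

lemma nrm_diff_le:
  assumes "x \<in> C" "y \<in> C"
  shows "\<bar>nrm x - nrm y\<bar> \<le> nrm (x \<ominus> y)"
proof -
  have *: "nrm a \<le> nrm b + nrm (a \<ominus> b)" if "a \<in> C" "b \<in> C" for a b
  proof -
    have "a = b \<oplus> (a \<ominus> b)" using that by (intro eqI) auto
    then show ?thesis using that by (metis nrm_triangle sub_closed)
  qed
  show ?thesis
    using *[of x y] *[of y x] assms nrm_sub_commute[of x y] by linarith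
qed

lemma hlim_nrm:
  assumes "\<And>n. X n \<in> C" "x \<in> C" "hlim H X x"
  shows "(\<lambda>n. nrm (X n)) \<longlonglongrightarrow> nrm x"
proof -
  have "(\<lambda>n. nrm (X n) - nrm x) \<longlonglongrightarrow> 0"
    by (rule Lim_null_comparison[OF _ assms(3)[unfolded hlim_def]])
       (use nrm_diff_le assms in auto)
  then show ?thesis by (simp add: LIM_zero_iff)
qed

lemma hlim_inner:
  assumes "\<And>n. X n \<in> C" "x \<in> C" "hlim H X x" "y \<in> C"
  shows "(\<lambda>n. ip (X n) y) \<longlonglongrightarrow> ip x y"
proof -
  have "(\<lambda>n. nrm (X n \<ominus> x) * nrm y) \<longlonglongrightarrow> 0"
    using assms(3) by (auto simp: hlim_def intro: tendsto_mult_left_zero)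
  then have "(\<lambda>n. ip (X n) y - ip x y) \<longlonglongrightarrow> 0"
    by (rule Lim_null_comparison[rotated])
       (use Cauchy_Schwarz[OF sub_closed] assms in \<open>auto simp flip: inner_sub_left\<close>)
  then show ?thesis by (simp add: LIM_zero_iff)
qed

lemma hlim_contraction:
  assumes "hlim H X x" "\<And>n. nrm (Y n \<ominus> y) \<le> K * nrm (X n \<ominus> x)" "\<And>n. Y n \<in> C" "y \<in> C"
  shows "hlim H Y y"
proof -
  have "(\<lambda>n. K * nrm (X n \<ominus> x)) \<longlonglongrightarrow> 0"
    using assms(1) by (auto simp: hlim_def intro: tendsto_mult_right_zero)
  then show ?thesis unfolding hlim_def
    by (rule Lim_null_comparison[rotated]) (use assms in auto)
qed

text \<open>The index set \<open>I\<close> carries no algebraic structure of its own, so that the lemma applies to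
  subspaces and to images of linear maps alike. The representing vector is the limit of a maximizing
  sequence of \<open>2 Re (\<phi> i) - \<parallel>j i\<parallel>\<^sup>2\<close>.\<close>

lemma Riesz:
  assumes ne: "I \<noteq> {}" and j: "\<And>i. i \<in> I \<Longrightarrow> j i \<in> C"
    and comb: "\<And>i k c. i \<in> I \<Longrightarrow> k \<in> I \<Longrightarrow> \<exists>l\<in>I. j l = j i \<oplus> c \<odot> j k \<and> \<phi> l = \<phi> i + c * \<phi> k"
    and bound: "\<And>i. i \<in> I \<Longrightarrow> cmod (\<phi> i) \<le> K * nrm (j i)"
  obtains v s where "v \<in> C" "\<And>i. i \<in> I \<Longrightarrow> \<phi> i = ip (j i) v" "\<And>n. s n \<in> I" "hlim H (\<lambda>n. j (s n)) v"
proof -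
  define J where "J i = 2 * Re (\<phi> i) - (nrm (j i))\<^sup>2" for i
  have J_le: "J i \<le> K\<^sup>2" if "i \<in> I" for i
  proof -
    have "Re (\<phi> i) \<le> K * nrm (j i)"
      using bound[OF that] complex_Re_le_cmod[of "\<phi> i"] by linarith
    moreover have "0 \<le> (K - nrm (j i))\<^sup>2" by simp
    ultimately show ?thesis by (simp add: J_def power2_diff)
  qed
  define S where "S = Sup (J ` I)"
  have bdd: "bdd_above (J ` I)" using J_le by (auto intro!: bdd_aboveI)
  have J_S: "J i \<le> S" if "i \<in> I" for i using that bdd by (auto simp: S_def intro: cSup_upper)
  have "\<exists>i\<in>I. S - 1 / (real n + 1) < J i" for n
    using less_cSup_iff[of "J ` I" "S - 1 / (real n + 1)"] ne bdd by (auto simp: S_def)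
  then obtain s where s: "s n \<in> I" "S - 1 / (real n + 1) < J (s n)" for n by metis
  \<comment> \<open>Parallelogram law: \<open>J\<close> at the midpoint is at most \<open>S\<close>,
    so two near-maximizers are close to each other.\<close>
  have par: "(nrm (j i \<ominus> j k))\<^sup>2 \<le> 4 * S - 2 * J i - 2 * J k" if i: "i \<in> I" and k: "k \<in> I" for i k
  proof -
    \<comment> \<open>The midpoint of \<open>i\<close> and \<open>k\<close> is built in two steps
      because \<open>comb\<close> leaves the first vector unscaled.\<close>
    obtain l1 where l1: "l1 \<in> I" "j l1 = j i \<oplus> (- 1 / 2) \<odot> j i" "\<phi> l1 = \<phi> i + (- 1 / 2) * \<phi> i"
      using comb[OF i i] by metis
    obtain l where l: "l \<in> I" "j l = j l1 \<oplus> (1 / 2) \<odot> j k" "\<phi> l = \<phi> l1 + (1 / 2) * \<phi> k"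
      using comb[OF l1(1) k] by metis
    note c = j[OF i] j[OF k]
    have n: "(nrm (j l))\<^sup>2 = (nrm (j i))\<^sup>2 / 4 + Re (ip (j k) (j i)) / 2 + (nrm (j k))\<^sup>2 / 4"
      using c inner_sym[of "j i" "j k"] by (simp add: norm_sq l l1) (simp add: field_simps)
    have "Re (\<phi> l) = Re (\<phi> i) / 2 + Re (\<phi> k) / 2" by (simp add: l l1)
    with J_S[OF l(1)] n have "Re (\<phi> i) + Re (\<phi> k) -
      ((nrm (j i))\<^sup>2 / 4 + Re (ip (j k) (j i)) / 2 + (nrm (j k))\<^sup>2 / 4) \<le> S"
      by (simp add: J_def)
    then show ?thesis by (simp add: nrm_sub_sq c J_def)
  qed
  have "\<exists>v\<in>C. hlim H (\<lambda>n. j (s n)) v"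
  proof (rule complete)
    fix e :: real assume "e > 0"
    \<comment> \<open>Each of the two values of \<open>J\<close> misses \<open>S\<close> by less
      than \<open>1 / (N + 1)\<close> and enters \<open>par\<close> with the factor 2, whence the
      constant 4.\<close>
    then obtain N where N: "4 / (real N + 1) < e\<^sup>2"
      using reals_Archimedean2[of "4 / e\<^sup>2"] by (auto simp: field_simps) (smt (verit) zero_less_power)
    have "nrm (j (s m) \<ominus> j (s n)) < e" if "m \<ge> N" "n \<ge> N" for m n
    proof (rule power2_less_imp_less)
      have "1 / (real m + 1) \<le> 1 / (real N + 1)" "1 / (real n + 1) \<le> 1 / (real N + 1)"
        using that by (simp_all add: frac_le)
      moreover have "(nrm (j (s m) \<ominus> j (s n)))\<^sup>2 \<le> 4 * S - 2 * J (s m) - 2 * J (s n)"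
        by (rule par) (rule s)+
      ultimately show "(nrm (j (s m) \<ominus> j (s n)))\<^sup>2 < e\<^sup>2"
        using s(2)[of m] s(2)[of n] N by simp
    qed (use \<open>e > 0\<close> in simp)
    then show "\<exists>N. \<forall>m\<ge>N. \<forall>n\<ge>N. nrm (j (s m) \<ominus> j (s n)) < e" by blast
  qed (use s j in auto)
  then obtain v where v: "v \<in> C" "hlim H (\<lambda>n. j (s n)) v" by blast
  have "\<phi> i = ip (j i) v" if i: "i \<in> I" for i
  proof -
    \<comment> \<open>First variation: moving \<open>s n\<close> in the direction of
      \<open>i\<close> raises \<open>J\<close> by at most \<open>1 / (n + 1)\<close>, and the
      discriminant of this inequality in \<open>c\<close> bounds the deviation from
      \<open>\<phi> i\<close>.\<close>
    have le: "(cmod (\<phi> i - ip (j i) (j (s n))))\<^sup>2 \<le> (1 / (real n + 1)) * (nrm (j i))\<^sup>2" for n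
    proof (rule quadratic_nonneg_imp_discrim)
      fix c
      obtain l where l: "l \<in> I" "j l = j (s n) \<oplus> (- c) \<odot> j i" "\<phi> l = \<phi> (s n) + (- c) * \<phi> i"
        using comb[OF s(1) i] by metis
      have "J l = J (s n) - 2 * Re (c * \<phi> i) + 2 * Re (c * ip (j i) (j (s n))) - (cmod c)\<^sup>2 * (nrm (j i))\<^sup>2"
        using nrm_add_scale[OF j[OF s(1)[of n]] j[OF i], of "- c"] by (simp add: J_def l)
      then show "0 \<le> 1 / (real n + 1) + 2 * Re (c * (\<phi> i - ip (j i) (j (s n)))) + (cmod c)\<^sup>2 * (nrm (j i))\<^sup>2"
        using J_S[OF l(1)] s(2)[of n] by (simp add: algebra_simps)
    qed simp
    have lim: "(\<lambda>n. (1 / (real n + 1)) * (nrm (j i))\<^sup>2) \<longlonglongrightarrow> 0"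
      using LIMSEQ_inverse_real_of_nat
      by (intro tendsto_mult_left_zero) (simp add: inverse_eq_divide add.commute)
    have "(\<lambda>n. (cmod (\<phi> i - ip (j i) (j (s n))))\<^sup>2) \<longlonglongrightarrow> 0"
      by (rule Lim_null_comparison[OF _ lim]) (use le in simp)
    then have "(\<lambda>n. \<phi> i - ip (j i) (j (s n))) \<longlonglongrightarrow> 0"
      using tendsto_real_sqrt by (fastforce simp: tendsto_norm_zero_iff)
    moreover have "(\<lambda>n. cnj (ip (j (s n)) (j i))) \<longlonglongrightarrow> cnj (ip v (j i))"
      by (intro tendsto_cnj hlim_inner) (use v i s j in auto)
    then have "(\<lambda>n. \<phi> i - ip (j i) (j (s n))) \<longlonglongrightarrow> \<phi> i - ip (j i) v"
      using v i s j by (intro tendsto_diff tendsto_const) (simp flip: inner_sym)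
    ultimately show ?thesis using LIMSEQ_unique by fastforce
  qed
  with v s that show thesis by blast
qed

text \<open>\<open>p\<close> is the vector representing \<open>k \<mapsto> ip k x\<close> on
  \<open>K\<close>. The approximating sequence from \<open>Riesz\<close> consists of elements of
  \<open>K\<close>, so closedness puts \<open>p\<close> into \<open>K\<close>.\<close>

lemma projection:
  assumes "K \<subseteq> C" "K \<noteq> {}" "\<And>x y c. x \<in> K \<Longrightarrow> y \<in> K \<Longrightarrow> x \<oplus> c \<odot> y \<in> K"
    and closed: "\<And>X x. (\<And>n. X n \<in> K) \<Longrightarrow> x \<in> C \<Longrightarrow> hlim H X x \<Longrightarrow> x \<in> K"
    and x: "x \<in> C"
  obtains p where "p \<in> K" "\<And>k. k \<in> K \<Longrightarrow> ip k x = ip k p"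
proof -
  obtain v s where "v \<in> C" "\<And>i. i \<in> K \<Longrightarrow> ip i x = ip i v" "\<And>n. s n \<in> K" "hlim H (\<lambda>n. s n) v"
  proof (rule Riesz[of K "\<lambda>k. k" "\<lambda>k. ip k x" "nrm x"])
    show "\<And>i. i \<in> K \<Longrightarrow> cmod (ip i x) \<le> nrm x * nrm i"
      using Cauchy_Schwarz x assms(1) by (metis mult.commute subsetD)
    show "\<exists>l\<in>K. l = i \<oplus> c \<odot> k \<and> ip l x = ip i x + c * ip k x" if "i \<in> K" "k \<in> K" for i k c
      using that x assms(1,3) by (auto simp: subset_iff)
  qed (use assms in auto)
  then show thesis using that closed by blast
qed

section \<open>Bounded operators, adjoints and commutants\<close>

lemma bounded_opsD:
  assumes "T \<in> bounded_ops H"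
  shows "x \<in> C \<Longrightarrow> T x \<in> C" "x \<in> C \<Longrightarrow> y \<in> C \<Longrightarrow> T (x \<oplus> y) = T x \<oplus> T y"
    "x \<in> C \<Longrightarrow> T (c \<odot> x) = c \<odot> T x"
  using assms by (auto simp: bounded_ops_def)

lemma bounded_ops_bound:
  assumes "T \<in> bounded_ops H"
  obtains K where "K \<ge> 0" "\<And>x. x \<in> C \<Longrightarrow> nrm (T x) \<le> K * nrm x"
proof -
  obtain K where K: "\<And>x. x \<in> C \<Longrightarrow> nrm (T x) \<le> K * nrm x"
    using assms unfolding bounded_ops_def by blast
  have "nrm (T x) \<le> \<bar>K\<bar> * nrm x" if "x \<in> C" for x
    using K[OF that] mult_right_mono[OF abs_ge_self nrm_nonneg[OF that]] by (rule order_trans)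
  then show thesis using that[of "\<bar>K\<bar>"] by simp
qed

lemma bounded_opsI:
  assumes "T \<in> extensional C" "\<And>x. x \<in> C \<Longrightarrow> T x \<in> C"
    "\<And>x y. x \<in> C \<Longrightarrow> y \<in> C \<Longrightarrow> T (x \<oplus> y) = T x \<oplus> T y"
    "\<And>x c. x \<in> C \<Longrightarrow> T (c \<odot> x) = c \<odot> T x"
    "\<And>x. x \<in> C \<Longrightarrow> nrm (T x) \<le> K * nrm x"
  shows "T \<in> bounded_ops H"
  using assms by (auto simp: bounded_ops_def PiE_def intro!: exI[of _ K])

lemma op_eqI:
  assumes "S \<in> bounded_ops H" "T \<in> bounded_ops H"
    and "\<And>x y. x \<in> C \<Longrightarrow> y \<in> C \<Longrightarrow> ip x (S y) = ip x (T y)"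
  shows "S = T"
proof
  fix y show "S y = T y"
  proof (cases "y \<in> C")
    case True
    then show ?thesis using assms
      by (intro eqI) (auto simp: bounded_opsD inner_sym[of _ "S y"] inner_sym[of _ "T y"])
  next
    case False
    then show ?thesis using assms(1,2) by (auto simp: bounded_ops_def PiE_def extensional_def)
  qed
qed

text \<open>Riesz applied to \<open>x \<mapsto> ip (T x) y\<close> for each \<open>y\<close>.
  Linearity of the adjoint is forced by the inner products, and its bound comes from
  \<open>ip (T (S y)) y = (nrm (S y))^2\<close>.\<close>

lemma adjoint_exists:
  assumes T: "T \<in> bounded_ops H"
  shows "\<exists>S\<in>bounded_ops H. \<forall>x\<in>C. \<forall>y\<in>C. ip (T x) y = ip x (S y)"
proof -
  obtain K where K: "K \<ge> 0" "\<And>x. x \<in> C \<Longrightarrow> nrm (T x) \<le> K * nrm x"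
    using bounded_ops_bound[OF T] by blast
  note TD = bounded_opsD[OF T]
  have TCS: "cmod (ip (T x) y) \<le> (K * nrm y) * nrm x" if "x \<in> C" "y \<in> C" for x y
  proof -
    have "cmod (ip (T x) y) \<le> nrm (T x) * nrm y" using that TD by (simp add: Cauchy_Schwarz)
    also have "\<dots> \<le> (K * nrm x) * nrm y" using that K by (intro mult_right_mono) auto
    finally show ?thesis by (simp add: mult_ac)
  qed
  have "\<exists>v\<in>C. \<forall>x\<in>C. ip (T x) y = ip x v" if y: "y \<in> C" for y
  proof -
    obtain v s where "v \<in> C" "\<And>i. i \<in> C \<Longrightarrow> ip (T i) y = ip i v" "\<And>n. s n \<in> C" "hlim H (\<lambda>n. s n) v"
    proof (rule Riesz[of C "\<lambda>k. k" "\<lambda>k. ip (T k) y" "K * nrm y"])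
      show "\<exists>l\<in>C. l = i \<oplus> c \<odot> k \<and> ip (T l) y = ip (T i) y + c * ip (T k) y" if "i \<in> C" "k \<in> C" for i k c
        using that y by (auto simp: TD)
    qed (use TCS y carrier_nonempty in auto)
    then show ?thesis by blast
  qed
  then have "\<forall>y\<in>C. \<exists>v. v \<in> C \<and> (\<forall>x\<in>C. ip (T x) y = ip x v)" by blast
  from bchoice[OF this] obtain S0 where S0': "\<forall>y\<in>C. S0 y \<in> C \<and> (\<forall>x\<in>C. ip (T x) y = ip x (S0 y))"
    by blast
  then have S0: "y \<in> C \<Longrightarrow> S0 y \<in> C" "y \<in> C \<Longrightarrow> x \<in> C \<Longrightarrow> ip (T x) y = ip x (S0 y)" for x y
    by blast+
  have S0': "ip (S0 y) x = ip y (T x)" if "x \<in> C" "y \<in> C" for x y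
    using S0(2)[of y x] that S0(1)[of y] TD(1)[of x] inner_sym[of x "S0 y"] inner_sym[of "T x" y]
    by simp
  \<comment> \<open>Restricted to the carrier because \<open>bounded_ops\<close> contains only
    extensional functions.\<close>
  define S where "S = restrict S0 C"
  have "S \<in> bounded_ops H"
  proof (rule bounded_opsI[where K = K])
    fix x y assume x: "x \<in> C" and y: "y \<in> C"
    show "S (x \<oplus> y) = S x \<oplus> S y"
      using x y by (intro eqI) (auto simp: S_def S0 S0' TD)
  next
    fix x c assume x: "x \<in> C"
    show "S (c \<odot> x) = c \<odot> S x"
      using x by (intro eqI) (auto simp: S_def S0 S0' TD)
  next
    fix x assume x: "x \<in> C"
    have "(nrm (S0 x))\<^sup>2 = cmod (ip (T (S0 x)) x)"
      using x by (simp add: S0 inner_self norm_power)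
    also have "\<dots> \<le> (K * nrm x) * nrm (S0 x)" using x S0 by (intro TCS) auto
    finally have "nrm (S0 x) * nrm (S0 x) \<le> (K * nrm x) * nrm (S0 x)" by (simp add: power2_eq_square)
    then have "nrm (S0 x) \<le> K * nrm x"
      using x S0(1)[OF x] K(1) by (cases "nrm (S0 x) = 0") (auto simp: mult_le_cancel_right less_le)
    then show "nrm (S x) \<le> K * nrm x" using x by (simp add: S_def)
  qed (auto simp: S_def S0)
  moreover have "\<forall>x\<in>C. \<forall>y\<in>C. ip (T x) y = ip x (S y)" using S0 by (simp add: S_def)
  ultimately show ?thesis by blast
qed

lemma op_adj_eqI:
  assumes "S \<in> bounded_ops H" "\<And>x y. x \<in> C \<Longrightarrow> y \<in> C \<Longrightarrow> ip (T x) y = ip x (S y)"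
  shows "op_adj H T = S"
  unfolding op_adj_def
proof (rule the_equality)
  fix S' assume "S' \<in> bounded_ops H \<and> (\<forall>x\<in>C. \<forall>y\<in>C. ip (T x) y = ip x (S' y))"
  then show "S' = S" using assms by (intro op_eqI) auto
qed (use assms in auto)

lemma op_adj_bounded [simp, intro]: "T \<in> bounded_ops H \<Longrightarrow> op_adj H T \<in> bounded_ops H"
  and op_adj_inner: "T \<in> bounded_ops H \<Longrightarrow> x \<in> C \<Longrightarrow> y \<in> C \<Longrightarrow> ip x (op_adj H T y) = ip (T x) y"
  using adjoint_exists[of T] op_adj_eqI[of _ T] by (metis (no_types, lifting))+

lemma op_adj_inner': "T \<in> bounded_ops H \<Longrightarrow> x \<in> C \<Longrightarrow> y \<in> C \<Longrightarrow> ip (op_adj H T y) x = ip y (T x)"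
  using op_adj_inner[of T x y] bounded_opsD(1)[of T x] bounded_opsD(1)[of "op_adj H T" y]
  by (metis inner_sym op_adj_bounded)

lemma op_add_bounded:
  assumes "S \<in> bounded_ops H" "T \<in> bounded_ops H"
  shows "op_add H S T \<in> bounded_ops H"
proof -
  obtain K where K: "K \<ge> 0" "\<And>x. x \<in> C \<Longrightarrow> nrm (S x) \<le> K * nrm x"
    using bounded_ops_bound[OF assms(1)] by blast
  obtain L where L: "L \<ge> 0" "\<And>x. x \<in> C \<Longrightarrow> nrm (T x) \<le> L * nrm x"
    using bounded_ops_bound[OF assms(2)] by blast
  note D = bounded_opsD[OF assms(1)] bounded_opsD[OF assms(2)]
  show ?thesis
  proof (rule bounded_opsI[where K = "K + L"])
    fix x assume x: "x \<in> C"
    have "nrm (S x \<oplus> T x) \<le> nrm (S x) + nrm (T x)" using x D by (intro nrm_triangle) auto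
    also have "\<dots> \<le> (K + L) * nrm x" using K(2)[OF x] L(2)[OF x] by (simp add: algebra_simps)
    finally show "nrm (op_add H S T x) \<le> (K + L) * nrm x" using x by (simp add: op_add_def)
  qed (auto simp: op_add_def D intro!: eqI, simp_all add: algebra_simps)
qed

lemma op_scale_bounded:
  assumes "T \<in> bounded_ops H"
  shows "op_scale H c T \<in> bounded_ops H"
proof -
  obtain L where L: "L \<ge> 0" "\<And>x. x \<in> C \<Longrightarrow> nrm (T x) \<le> L * nrm x"
    using bounded_ops_bound[OF assms] by blast
  note D = bounded_opsD[OF assms]
  show ?thesis
  proof (rule bounded_opsI[where K = "cmod c * L"])
    fix x assume x: "x \<in> C"
    show "nrm (op_scale H c T x) \<le> cmod c * L * nrm x"
      using x L(2)[OF x] by (simp add: op_scale_def nrm_scale D mult.assoc mult_left_mono)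
  qed (auto simp: op_scale_def D intro!: eqI, simp_all add: algebra_simps)
qed

lemma op_mult_bounded:
  assumes "S \<in> bounded_ops H" "T \<in> bounded_ops H"
  shows "op_mult H S T \<in> bounded_ops H"
proof -
  obtain K where K: "K \<ge> 0" "\<And>x. x \<in> C \<Longrightarrow> nrm (S x) \<le> K * nrm x"
    using bounded_ops_bound[OF assms(1)] by blast
  obtain L where L: "L \<ge> 0" "\<And>x. x \<in> C \<Longrightarrow> nrm (T x) \<le> L * nrm x"
    using bounded_ops_bound[OF assms(2)] by blast
  note D = bounded_opsD[OF assms(1)] bounded_opsD[OF assms(2)]
  show ?thesis
  proof (rule bounded_opsI[where K = "K * L"])
    fix x assume x: "x \<in> C"
    have "nrm (S (T x)) \<le> K * nrm (T x)" using x D K by auto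
    also have "\<dots> \<le> K * (L * nrm x)" using L(2)[OF x] K(1) by (rule mult_left_mono)
    finally show "nrm (op_mult H S T x) \<le> K * L * nrm x" using x by (simp add: op_mult_def compose_def mult.assoc)
  qed (auto simp: op_mult_def compose_def D)
qed

lemma op_mult_apply [simp]: "x \<in> C \<Longrightarrow> op_mult H S T x = S (T x)"
  by (simp add: op_mult_def compose_def)

lemma op_add_apply [simp]: "x \<in> C \<Longrightarrow> op_add H S T x = S x \<oplus> T x"
  by (simp add: op_add_def)

lemma op_scale_apply [simp]: "x \<in> C \<Longrightarrow> op_scale H c T x = c \<odot> T x"
  by (simp add: op_scale_def)

lemma commutantD:
  assumes "T \<in> commutant H A"
  shows "T \<in> bounded_ops H" "s \<in> A \<Longrightarrow> x \<in> C \<Longrightarrow> T (s x) = s (T x)"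
proof -
  show "T \<in> bounded_ops H" using assms by (simp add: commutant_def)
  assume "s \<in> A" "x \<in> C"
  then have "op_mult H T s x = op_mult H s T x" using assms by (auto simp: commutant_def)
  with \<open>x \<in> C\<close> show "T (s x) = s (T x)" by simp
qed

lemma commutantI:
  assumes "T \<in> bounded_ops H" "\<And>s x. s \<in> A \<Longrightarrow> x \<in> C \<Longrightarrow> T (s x) = s (T x)"
  shows "T \<in> commutant H A"
  using assms by (auto simp: commutant_def op_mult_def compose_def fun_eq_iff)

lemma commutant_add:
  assumes "A \<subseteq> bounded_ops H" "S \<in> commutant H A" "T \<in> commutant H A"
  shows "op_add H S T \<in> commutant H A"
proof (rule commutantI)
  fix s x assume s: "s \<in> A" and x: "x \<in> C"
  note D = bounded_opsD[OF subsetD[OF assms(1) s]] bounded_opsD[OF commutantD(1)[OF assms(2)]]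
     bounded_opsD[OF commutantD(1)[OF assms(3)]]
  show "op_add H S T (s x) = s (op_add H S T x)"
    using s x by (simp add: D commutantD(2)[OF assms(2)] commutantD(2)[OF assms(3)])
qed (use assms in \<open>auto intro: op_add_bounded commutantD\<close>)

lemma commutant_scale:
  assumes "A \<subseteq> bounded_ops H" "T \<in> commutant H A"
  shows "op_scale H c T \<in> commutant H A"
proof (rule commutantI)
  fix s x assume s: "s \<in> A" and x: "x \<in> C"
  note D = bounded_opsD[OF subsetD[OF assms(1) s]] bounded_opsD[OF commutantD(1)[OF assms(2)]]
  show "op_scale H c T (s x) = s (op_scale H c T x)"
    using s x by (simp add: D commutantD(2)[OF assms(2)])
qed (use assms in \<open>auto intro: op_scale_bounded commutantD\<close>)

lemma commutant_mult:
  assumes "A \<subseteq> bounded_ops H" "S \<in> commutant H A" "T \<in> commutant H A"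
  shows "op_mult H S T \<in> commutant H A"
proof (rule commutantI)
  fix s x assume s: "s \<in> A" and x: "x \<in> C"
  note D = bounded_opsD[OF subsetD[OF assms(1) s]] bounded_opsD[OF commutantD(1)[OF assms(2)]]
     bounded_opsD[OF commutantD(1)[OF assms(3)]]
  show "op_mult H S T (s x) = s (op_mult H S T x)"
    using s x by (simp add: D commutantD(2)[OF assms(2)] commutantD(2)[OF assms(3)])
qed (use assms in \<open>auto intro: op_mult_bounded commutantD\<close>)

text \<open>Across the inner product, commutation of the adjoint of \<open>T\<close> with
  \<open>s\<close> becomes commutation of \<open>T\<close> with the adjoint of \<open>s\<close>,
  which again lies in \<open>A\<close>.\<close>

lemma commutant_adj:
  assumes A: "A \<subseteq> bounded_ops H" "\<And>s. s \<in> A \<Longrightarrow> op_adj H s \<in> A" and T: "T \<in> commutant H A"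
  shows "op_adj H T \<in> commutant H A"
proof (rule commutantI)
  fix s x assume s: "s \<in> A" and x: "x \<in> C"
  have sb: "s \<in> bounded_ops H" and Tb: "T \<in> bounded_ops H" using s A T commutantD by auto
  have sa: "op_adj H s \<in> A" using s A by blast
  note D = bounded_opsD[OF sb] bounded_opsD[OF Tb] bounded_opsD[OF op_adj_bounded[OF sb]]
     bounded_opsD[OF op_adj_bounded[OF Tb]]
  show "op_adj H T (s x) = s (op_adj H T x)"
  proof (rule eqI)
    fix z assume z: "z \<in> C"
    have "ip (op_adj H T (s x)) z = ip (s x) (T z)" using z x D Tb by (simp add: op_adj_inner')
    also have "\<dots> = ip x (op_adj H s (T z))" using z x D sb by (simp add: op_adj_inner)
    also have "\<dots> = ip x (T (op_adj H s z))" using commutantD(2)[OF T sa z] by simp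
    also have "\<dots> = ip (s (op_adj H T x)) z" 
      using op_adj_inner[OF sb, of "op_adj H T x" z] op_adj_inner'[OF Tb, of "op_adj H s z" x] z x D
      by simp
    finally show "ip (op_adj H T (s x)) z = ip (s (op_adj H T x)) z" .
  qed (use x D in auto)
qed (use T commutantD in auto)

lemma subset_double_commutant: "A \<subseteq> bounded_ops H \<Longrightarrow> A \<subseteq> commutant H (commutant H A)"
  by (auto intro!: commutantI dest: commutantD(2))

lemma commutant_subset: "commutant H A \<subseteq> bounded_ops H"
  by (auto simp: commutant_def)

end

section \<open>Square-summable sequences\<close>

text \<open>The Hilbert sum of countably many copies of \<open>H\<close>. A square-summable sequence
  becomes a single vector and a series of vector functionals becomes one vector functional, to which
  the Radon-Nikodym argument applies.\<close>

definition ell2 :: "'h hspace \<Rightarrow> (nat \<Rightarrow> 'h) hspace" where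
  "ell2 H = \<lparr>
     hcarrier = {x. (\<forall>n. x n \<in> hcarrier H) \<and> summable (\<lambda>n. (hnorm H (x n))\<^sup>2)},
     hadd = (\<lambda>x y n. hadd H (x n) (y n)),
     hscale = (\<lambda>c x n. hscale H c (x n)),
     hinner = (\<lambda>x y. \<Sum>n. hinner H (x n) (y n))\<rparr>"

lemma ell2_simps:
  "x \<in> hcarrier (ell2 H) \<longleftrightarrow> (\<forall>n. x n \<in> hcarrier H) \<and> summable (\<lambda>n. (hnorm H (x n))\<^sup>2)"
  "hadd (ell2 H) x y = (\<lambda>n. hadd H (x n) (y n))"
  "hscale (ell2 H) c x = (\<lambda>n. hscale H c (x n))"
  "hsub (ell2 H) x y = (\<lambda>n. hsub H (x n) (y n))"
  "hinner (ell2 H) x y = (\<Sum>n. hinner H (x n) (y n))"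
  by (simp_all add: ell2_def hsub_def)

context hilbert
begin

lemma nrm_add_sq_le: "x \<in> C \<Longrightarrow> y \<in> C \<Longrightarrow> (nrm (x \<oplus> y))\<^sup>2 \<le> 2 * (nrm x)\<^sup>2 + 2 * (nrm y)\<^sup>2"
  using nrm_add_sq[of x y] nrm_sub_sq[of x y] zero_le_power2[of "nrm (x \<ominus> y)"] by linarith

lemma cmod_inner_le:
  assumes "x \<in> C" "y \<in> C"
  shows "cmod (ip x y) \<le> (nrm x)\<^sup>2 + (nrm y)\<^sup>2"
proof -
  have "0 \<le> nrm x * nrm y" using assms by simp
  then show ?thesis
    using Cauchy_Schwarz[OF assms] sum_squares_bound[of "nrm x" "nrm y"] by linarith
qed

lemma ell2_inner_abs_summable:
  assumes "x \<in> hcarrier (ell2 H)" "y \<in> hcarrier (ell2 H)"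
  shows "summable (\<lambda>n. cmod (ip (x n) (y n)))"
  by (rule summable_comparison_test[of _ "\<lambda>n. (nrm (x n))\<^sup>2 + (nrm (y n))\<^sup>2"])
     (use assms in \<open>auto simp: ell2_simps cmod_inner_le summable_add\<close>)

lemmas ell2_inner_summable = summable_norm_cancel[OF ell2_inner_abs_summable]

lemma ell2_add_closed:
  assumes "x \<in> hcarrier (ell2 H)" "y \<in> hcarrier (ell2 H)"
  shows "hadd (ell2 H) x y \<in> hcarrier (ell2 H)"
proof -
  have "summable (\<lambda>n. (nrm (x n \<oplus> y n))\<^sup>2)"
    by (rule summable_comparison_test[of _ "\<lambda>n. 2 * (nrm (x n))\<^sup>2 + 2 * (nrm (y n))\<^sup>2"])
       (use assms in \<open>auto simp: ell2_simps nrm_add_sq_le intro!: summable_add summable_mult\<close>)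
  then show ?thesis using assms by (simp add: ell2_simps)
qed

lemma ell2_scale_closed:
  assumes "x \<in> hcarrier (ell2 H)"
  shows "hscale (ell2 H) c x \<in> hcarrier (ell2 H)"
  using assms by (auto simp: ell2_simps nrm_scale power_mult_distrib intro!: summable_mult)

lemma ell2_norm_sq:
  assumes "x \<in> hcarrier (ell2 H)"
  shows "hinner (ell2 H) x x = of_real (\<Sum>n. (nrm (x n))\<^sup>2)"
    "(hnorm (ell2 H) x)\<^sup>2 = (\<Sum>n. (nrm (x n))\<^sup>2)"
    "(\<lambda>n. (nrm (x n))\<^sup>2) sums (hnorm (ell2 H) x)\<^sup>2"
proof -
  have s: "summable (\<lambda>n. (nrm (x n))\<^sup>2)" using assms by (simp add: ell2_simps)
  show 1: "hinner (ell2 H) x x = of_real (\<Sum>n. (nrm (x n))\<^sup>2)"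
    using assms by (simp add: ell2_simps inner_self suminf_of_real[OF s, symmetric] flip: of_real_power)
  then show 2: "(hnorm (ell2 H) x)\<^sup>2 = (\<Sum>n. (nrm (x n))\<^sup>2)"
    by (simp add: hnorm_def[of "ell2 H"] suminf_nonneg[OF s])
  show "(\<lambda>n. (nrm (x n))\<^sup>2) sums (hnorm (ell2 H) x)\<^sup>2"
    unfolding 2 using s by (rule summable_sums)
qed

text \<open>The limit is taken coordinatewise. Finite partial sums of squares pass to the limit, and
  a bound uniform in their length carries over to the whole series.\<close>

lemma ell2_complete:
  assumes X: "\<And>m. X m \<in> hcarrier (ell2 H)"
    and cauchy: "\<And>e. e > 0 \<Longrightarrow> \<exists>N. \<forall>m\<ge>N. \<forall>n\<ge>N. hnorm (ell2 H) (hsub (ell2 H) (X m) (X n)) < e"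
  shows "\<exists>x\<in>hcarrier (ell2 H). hlim (ell2 H) X x"
proof -
  have XC [simp]: "X m n \<in> C" for m n using X by (simp add: ell2_simps)
  have sub: "hsub (ell2 H) x y \<in> hcarrier (ell2 H)"
    if "x \<in> hcarrier (ell2 H)" "y \<in> hcarrier (ell2 H)" for x y
    using that unfolding hsub_def by (intro ell2_add_closed ell2_scale_closed)
  have nn: "hnorm (ell2 H) x \<ge> 0" if "x \<in> hcarrier (ell2 H)" for x
    using that ell2_norm_sq(1)[OF that] suminf_nonneg[of "\<lambda>n. (nrm (x n))\<^sup>2"]
    by (simp add: hnorm_def ell2_simps(1))
  have fin: "(\<Sum>i<M. (nrm (x i))\<^sup>2) \<le> (hnorm (ell2 H) x)\<^sup>2" if "x \<in> hcarrier (ell2 H)" for x M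
    using that unfolding ell2_norm_sq(2)[OF that] by (intro sum_le_suminf) (auto simp: ell2_simps)
  have coord: "nrm (X m i \<ominus> X n i) \<le> hnorm (ell2 H) (hsub (ell2 H) (X m) (X n))" for m n i
  proof (rule power2_le_imp_le)
    have "(nrm (X m i \<ominus> X n i))\<^sup>2 \<le> (\<Sum>k<Suc i. (nrm (hsub (ell2 H) (X m) (X n) k))\<^sup>2)"
      by (simp add: ell2_simps sum_nonneg)
    also have "\<dots> \<le> (hnorm (ell2 H) (hsub (ell2 H) (X m) (X n)))\<^sup>2" by (intro fin sub X)
    finally show "(nrm (X m i \<ominus> X n i))\<^sup>2 \<le> (hnorm (ell2 H) (hsub (ell2 H) (X m) (X n)))\<^sup>2" .
  qed (intro nn sub X)
  have "\<exists>x\<in>C. hlim H (\<lambda>m. X m i) x" for i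
  proof (rule complete)
    fix e :: real assume "e > 0"
    from cauchy[OF this] show "\<exists>N. \<forall>m\<ge>N. \<forall>n\<ge>N. nrm (X m i \<ominus> X n i) < e"
      using coord[of _ i] by (meson le_less_trans)
  qed simp
  then obtain x where x [simp]: "\<And>i. x i \<in> C" and lim: "\<And>i. hlim H (\<lambda>m. X m i) (x i)" by metis
  have tail: "\<exists>N. \<forall>m\<ge>N. hsub (ell2 H) (X m) x \<in> hcarrier (ell2 H) \<and> hnorm (ell2 H) (hsub (ell2 H) (X m) x) \<le> e"
    if "e > 0" for e
  proof -
    obtain N where N: "\<forall>m\<ge>N. \<forall>n\<ge>N. hnorm (ell2 H) (hsub (ell2 H) (X m) (X n)) < e"
      using cauchy[OF \<open>e > 0\<close>] by blast
    have "hsub (ell2 H) (X m) x \<in> hcarrier (ell2 H) \<and> hnorm (ell2 H) (hsub (ell2 H) (X m) x) \<le> e" if "m \<ge> N" for m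
    proof -
      have part: "(\<Sum>i<M. (nrm (X m i \<ominus> x i))\<^sup>2) \<le> e\<^sup>2" for M
      proof (rule LIMSEQ_le_const2)
        have "hlim H (\<lambda>n. X m i \<ominus> X n i) (X m i \<ominus> x i)" for i
        proof (rule hlim_contraction[where K = 1, OF lim[of i]])
          fix n
          have "X m i \<ominus> X n i \<ominus> (X m i \<ominus> x i) = x i \<ominus> X n i" by (intro eqI) auto
          then show "nrm (X m i \<ominus> X n i \<ominus> (X m i \<ominus> x i)) \<le> 1 * nrm (X n i \<ominus> x i)"
            by (simp add: nrm_sub_commute)
        qed auto
        then show "(\<lambda>n. \<Sum>i<M. (nrm (X m i \<ominus> X n i))\<^sup>2) \<longlonglongrightarrow> (\<Sum>i<M. (nrm (X m i \<ominus> x i))\<^sup>2)"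
          by (intro tendsto_sum tendsto_power hlim_nrm) auto
        have "(\<Sum>i<M. (nrm (X m i \<ominus> X n i))\<^sup>2) \<le> e\<^sup>2" if "n \<ge> N" for n
        proof -
          have "(\<Sum>i<M. (nrm (X m i \<ominus> X n i))\<^sup>2) \<le> (hnorm (ell2 H) (hsub (ell2 H) (X m) (X n)))\<^sup>2"
            using fin[OF sub[OF X[of m] X[of n]], of M] by (simp add: ell2_simps)
          also have "\<dots> \<le> e\<^sup>2"
            using N \<open>m \<ge> N\<close> that by (intro power_mono nn sub X) (auto simp: less_imp_le)
          finally show ?thesis .
        qed
        then show "\<exists>N. \<forall>n\<ge>N. (\<Sum>i<M. (nrm (X m i \<ominus> X n i))\<^sup>2) \<le> e\<^sup>2" by blast
      qed
      have summ: "summable (\<lambda>i. (nrm (X m i \<ominus> x i))\<^sup>2)"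
        by (rule summableI_nonneg_bounded[OF _ part]) simp
      then have mem: "hsub (ell2 H) (X m) x \<in> hcarrier (ell2 H)" by (simp add: ell2_simps)
      have "(hnorm (ell2 H) (hsub (ell2 H) (X m) x))\<^sup>2 \<le> e\<^sup>2"
        using suminf_le_const[OF summ part] by (simp add: ell2_norm_sq(2)[OF mem]) (simp add: ell2_simps)
      with mem show ?thesis using \<open>e > 0\<close> by (auto intro: power2_le_imp_le)
    qed
    then show ?thesis by blast
  qed
  have "x \<in> hcarrier (ell2 H)"
  proof -
    obtain N where "hsub (ell2 H) (X N) x \<in> hcarrier (ell2 H)" using tail[of 1] by auto
    \<comment> \<open>The limit is square-summable as the difference of \<open>X N\<close> and
      \<open>X N - x\<close>, both of which are.\<close>
    then have "hsub (ell2 H) (X N) (hsub (ell2 H) (X N) x) \<in> hcarrier (ell2 H)" using X sub by blast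
    moreover have "hsub (ell2 H) (X N) (hsub (ell2 H) (X N) x) = x"
      unfolding ell2_simps by (rule ext, rule eqI) auto
    ultimately show ?thesis by simp
  qed
  moreover have "hlim (ell2 H) X x"
    unfolding hlim_def
  proof (rule LIMSEQ_I)
    fix e :: real assume "e > 0"
    then obtain N where "\<forall>m\<ge>N. hsub (ell2 H) (X m) x \<in> hcarrier (ell2 H) \<and>
        hnorm (ell2 H) (hsub (ell2 H) (X m) x) \<le> e / 2"
      using tail[of "e/2"] by auto
    with nn \<open>e > 0\<close> show "\<exists>N. \<forall>m\<ge>N. norm (hnorm (ell2 H) (hsub (ell2 H) (X m) x) - 0) < e"
      by (intro exI[of _ N]) fastforce
  qed
  ultimately show ?thesis by blast
qed

lemma hilbert_ell2: "hilbert (ell2 H)"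
proof
  have "(\<lambda>n. \<zero>) \<in> hcarrier (ell2 H)" by (simp add: ell2_simps)
  then show "hcarrier (ell2 H) \<noteq> {}" by blast
next
  fix x y z assume xyz: "x \<in> hcarrier (ell2 H)" "y \<in> hcarrier (ell2 H)" "z \<in> hcarrier (ell2 H)"
  then show "hinner (ell2 H) (hadd (ell2 H) x y) z = hinner (ell2 H) x z + hinner (ell2 H) y z"
    by (simp add: ell2_simps suminf_add ell2_inner_summable)
next
  fix x z c assume xz: "x \<in> hcarrier (ell2 H)" "z \<in> hcarrier (ell2 H)"
  then show "hinner (ell2 H) (hscale (ell2 H) c x) z = c * hinner (ell2 H) x z"
    using suminf_mult[OF ell2_inner_summable[OF xz], of c] by (simp add: ell2_simps)
next
  fix x y assume xy: "x \<in> hcarrier (ell2 H)" "y \<in> hcarrier (ell2 H)"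
  have "(\<Sum>n. ip (y n) (x n)) = (\<Sum>n. cnj (ip (x n) (y n)))"
    using xy by (intro suminf_cong) (simp add: ell2_simps flip: inner_sym)
  also have "\<dots> = cnj (\<Sum>n. ip (x n) (y n))"
    using bounded_linear.suminf[OF bounded_linear_cnj ell2_inner_summable[OF xy]] by simp
  finally show "hinner (ell2 H) y x = cnj (hinner (ell2 H) x y)" by (simp add: ell2_simps)
next
  fix x assume x: "x \<in> hcarrier (ell2 H)"
  then show "0 \<le> Re (hinner (ell2 H) x x)"
    by (simp add: ell2_norm_sq) (auto simp: ell2_simps intro: suminf_nonneg)
next
  fix x y assume xy: "x \<in> hcarrier (ell2 H)" "y \<in> hcarrier (ell2 H)"
    and 0: "Re (hinner (ell2 H) (hsub (ell2 H) x y) (hsub (ell2 H) x y)) = 0"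
  have mem: "hsub (ell2 H) x y \<in> hcarrier (ell2 H)"
    using xy unfolding hsub_def by (intro ell2_add_closed ell2_scale_closed)
  have "(\<Sum>n. (nrm (x n \<ominus> y n))\<^sup>2) = 0" using 0 by (simp add: ell2_norm_sq[OF mem]) (simp add: ell2_simps)
  moreover have "summable (\<lambda>n. (nrm (x n \<ominus> y n))\<^sup>2)" using mem by (simp add: ell2_simps)
  ultimately have "\<forall>n. (nrm (x n \<ominus> y n))\<^sup>2 = 0" by (simp add: suminf_eq_zero_iff)
  then show "x = y" using xy by (auto simp: ell2_simps intro!: ext eqI_nrm)
qed (use ell2_add_closed ell2_scale_closed ell2_complete in auto)

end

section \<open>Representations and vector functionals\<close>

text \<open>Boundedness of \<open>\<pi> a\<close> is not an axiom: it follows from the norm bound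
  for the positive functional \<open>\<omega> x\<close>, see \<open>nrm_pi_le\<close>. Values off
  the carrier are left open, so that \<open>amplify\<close> fits as well.\<close>

locale star_rep = hilbert H for H :: "'h hspace" +
  fixes \<pi> :: "'a::cstar_algebra \<Rightarrow> 'h \<Rightarrow> 'h"
  assumes pi_closed [simp, intro]: "x \<in> C \<Longrightarrow> \<pi> a x \<in> C"
    and pi_add_vec: "x \<in> C \<Longrightarrow> y \<in> C \<Longrightarrow> \<pi> a (x \<oplus> y) = \<pi> a x \<oplus> \<pi> a y"
    and pi_scale_vec: "x \<in> C \<Longrightarrow> \<pi> a (c \<odot> x) = c \<odot> \<pi> a x"
    and pi_add: "x \<in> C \<Longrightarrow> \<pi> (a + b) x = \<pi> a x \<oplus> \<pi> b x"
    and pi_scaleC: "x \<in> C \<Longrightarrow> \<pi> (c *\<^sub>C a) x = c \<odot> \<pi> a x"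
    and pi_mult: "x \<in> C \<Longrightarrow> \<pi> (a * b) x = \<pi> a (\<pi> b x)"
    and pi_one [simp]: "x \<in> C \<Longrightarrow> \<pi> 1 x = x"
    and pi_star: "x \<in> C \<Longrightarrow> y \<in> C \<Longrightarrow> ip (\<pi> a x) y = ip x (\<pi> (star a) y)"
begin

lemma pi_star': "x \<in> C \<Longrightarrow> y \<in> C \<Longrightarrow> ip x (\<pi> a y) = ip (\<pi> (star a) x) y"
  using pi_star[of x y "star a"] by (simp add: star_star)

definition \<omega> :: "'h \<Rightarrow> 'a \<Rightarrow> complex" where
  "\<omega> x a = ip (\<pi> a x) x"

lemma omega_star_mult: "x \<in> C \<Longrightarrow> \<omega> x (star b * b) = of_real ((nrm (\<pi> b x))\<^sup>2)"
  by (simp add: \<omega>_def pi_mult pi_star star_star inner_self)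

lemma sq_omega [simp]: "x \<in> C \<Longrightarrow> sq (\<omega> x) b = (nrm (\<pi> b x))\<^sup>2"
  by (simp add: sq_def omega_star_mult)

lemma plf_omega [simp, intro]: "x \<in> C \<Longrightarrow> plf (\<omega> x)"
  by (auto simp: plf_def omega_star_mult complex_nonneg_Reals_iff) (simp_all add: \<omega>_def pi_add pi_scaleC)

lemma nrm_pi_le:
  assumes "x \<in> C"
  shows "nrm (\<pi> a x) \<le> norm a * nrm x"
proof (rule power2_le_imp_le)
  show "(nrm (\<pi> a x))\<^sup>2 \<le> (norm a * nrm x)\<^sup>2"
    using sq_le_norm[OF plf_omega[OF assms], of a] assms by (simp add: power_mult_distrib)
qed (use assms in simp)

lemma pi_zero: "x \<in> C \<Longrightarrow> \<pi> 0 x = \<zero>"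
  by (rule eqI) (use pi_scaleC[of x 0 0] in \<open>simp_all, metis inner_scale_left mult_zero_left pi_closed\<close>)

lemma nrm_pi_zero_vec [simp]: "nrm (\<pi> a \<zero>) = 0"
  using nrm_pi_le[of "\<zero>" a] by (intro antisym) simp_all

lemma pi_sub_vec: "x \<in> C \<Longrightarrow> y \<in> C \<Longrightarrow> \<pi> a (x \<ominus> y) = \<pi> a x \<ominus> \<pi> a y"
  by (simp add: hsub_def pi_add_vec pi_scale_vec)

text \<open>A functional dominated by the vector functional of \<open>u\<close> has the form \<open>b \<mapsto> \<langle>\<pi> b u, T u\<rangle>\<close> with
  \<open>0 \<le> T \<le> 1\<close> in the commutant; \<open>v\<close> plays the role of \<open>T u\<close>, and the last claim is \<open>T\<^sup>2 \<le> T\<close>.\<close>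

lemma Radon_Nikodym:
  assumes \<nu>: "plf \<nu>" and u: "u \<in> C" and le: "\<And>b. sq \<nu> b \<le> (nrm (\<pi> b u))\<^sup>2"
  obtains v where "v \<in> C" "\<And>b. \<nu> b = ip (\<pi> b u) v" "\<And>b. (nrm (\<pi> b v))\<^sup>2 \<le> sq \<nu> b"
proof -
  \<comment> \<open>With all of \<open>A\<close> as index set and
    \<open>b \<mapsto> \<pi> b u\<close> as the map into the space, no functional on the vectors
    \<open>\<pi> b u\<close> has to be shown well defined.\<close>
  obtain v s where v: "v \<in> C" "\<And>b. \<nu> b = ip (\<pi> b u) v" "hlim H (\<lambda>n. \<pi> (s n) u) v"
  proof (rule Riesz[of UNIV "\<lambda>b. \<pi> b u" \<nu> "sqrt (sq \<nu> 1)"])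
    show "\<exists>l\<in>UNIV. \<pi> l u = \<pi> i u \<oplus> c \<odot> \<pi> k u \<and> \<nu> l = \<nu> i + c * \<nu> k" for i k c
      using u \<nu> by (intro bexI[of _ "i + c *\<^sub>C k"]) (auto simp: pi_add pi_scaleC plf_simps)
    show "cmod (\<nu> i) \<le> sqrt (sq \<nu> 1) * nrm (\<pi> i u)" for i
    proof (rule power2_le_imp_le)
      have "(cmod (\<nu> i))\<^sup>2 \<le> sq \<nu> 1 * sq \<nu> i" by (rule plf_Cauchy_Schwarz_one[OF \<nu>])
      also have "\<dots> \<le> sq \<nu> 1 * (nrm (\<pi> i u))\<^sup>2" using \<nu> by (intro mult_left_mono le sq_nonneg)
      finally show "(cmod (\<nu> i))\<^sup>2 \<le> (sqrt (sq \<nu> 1) * nrm (\<pi> i u))\<^sup>2"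
        using \<nu> by (simp add: power_mult_distrib sq_nonneg)
    qed (use u \<nu> in \<open>simp add: sq_nonneg\<close>)
  qed (use u in auto)
  have "(nrm (\<pi> b v))\<^sup>2 \<le> sq \<nu> b" for b
  proof -
    let ?y = "\<pi> b v"
    have y: "?y \<in> C" using v by simp
    have lim: "hlim H (\<lambda>n. \<pi> (b * s n) u) ?y"
    proof (rule hlim_contraction[OF v(3)])
      fix n
      have "\<pi> (b * s n) u \<ominus> ?y = \<pi> b (\<pi> (s n) u \<ominus> v)" using u v by (simp add: pi_mult pi_sub_vec)
      then show "nrm (\<pi> (b * s n) u \<ominus> ?y) \<le> norm b * nrm (\<pi> (s n) u \<ominus> v)"
        using u v by (simp add: nrm_pi_le)
    qed (use u v in auto)
    \<comment> \<open>\<open>\<pi> b v\<close> is the limit of \<open>\<pi> (b * s n) u\<close>.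
      Cauchy-Schwarz for \<open>\<nu>\<close>, followed by domination by the functional of
      \<open>u\<close>, bounds its inner products with these approximants.\<close>
    have "(nrm ?y)\<^sup>2 \<le> sqrt (sq \<nu> b) * nrm ?y"
    proof (rule LIMSEQ_le)
      show "(\<lambda>n. cmod (ip (\<pi> (b * s n) u) ?y)) \<longlonglongrightarrow> (nrm ?y)\<^sup>2"
        using tendsto_norm[OF hlim_inner[OF _ y lim y]] u y by (simp add: inner_self norm_power)
      show "(\<lambda>n. sqrt (sq \<nu> b) * nrm (\<pi> (b * s n) u)) \<longlonglongrightarrow> sqrt (sq \<nu> b) * nrm ?y"
        by (intro tendsto_intros hlim_nrm lim) (use u y in auto)
      have "cmod (ip (\<pi> (b * s n) u) ?y) \<le> sqrt (sq \<nu> b) * nrm (\<pi> (b * s n) u)" for n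
      proof (rule power2_le_imp_le)
        have "ip (\<pi> (b * s n) u) ?y = \<nu> (star b * (b * s n))"
          using u v by (simp add: pi_star' pi_mult)
        then have "(cmod (ip (\<pi> (b * s n) u) ?y))\<^sup>2 \<le> sq \<nu> b * sq \<nu> (b * s n)"
          using plf_Cauchy_Schwarz[OF \<nu>, of b "b * s n"] by simp
        also have "\<dots> \<le> sq \<nu> b * (nrm (\<pi> (b * s n) u))\<^sup>2" using \<nu> by (intro mult_left_mono le sq_nonneg)
        finally show "(cmod (ip (\<pi> (b * s n) u) ?y))\<^sup>2 \<le> (sqrt (sq \<nu> b) * nrm (\<pi> (b * s n) u))\<^sup>2"
          using \<nu> by (simp add: power_mult_distrib sq_nonneg)
      qed (use u \<nu> in \<open>simp add: sq_nonneg\<close>)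
      then show "\<exists>N. \<forall>n\<ge>N. cmod (ip (\<pi> (b * s n) u) ?y) \<le> sqrt (sq \<nu> b) * nrm (\<pi> (b * s n) u)" by blast
    qed
    then have "nrm ?y * nrm ?y \<le> sqrt (sq \<nu> b) * nrm ?y" by (simp add: power2_eq_square)
    then have "nrm ?y \<le> sqrt (sq \<nu> b)"
      using y \<nu> by (cases "nrm ?y = 0") (auto simp: mult_le_cancel_right less_le sq_nonneg)
    then have "(nrm ?y)\<^sup>2 \<le> (sqrt (sq \<nu> b))\<^sup>2" using y by (intro power_mono) auto
    then show ?thesis using \<nu> by (simp add: sq_nonneg)
  qed
  with v that show thesis by blast
qed

text \<open>Iterating \<open>Radon_Nikodym\<close> amounts to \<open>T\<^sub>0 = T\<close>, \<open>T\<^sub>k\<^sub>+\<^sub>1 = T\<^sub>k - T\<^sub>k\<^sup>2\<close>, which gives \<open>T = \<Sum>k. T\<^sub>k\<^sup>2\<close>.\<close>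

lemma dominated_eq_sum_omega:
  assumes \<nu>: "plf \<nu>" and u: "u \<in> C" and le: "\<And>b. sq \<nu> b \<le> (nrm (\<pi> b u))\<^sup>2"
  obtains v where "\<And>k. v k \<in> C" "\<And>b. (\<lambda>k. (nrm (\<pi> b (v k)))\<^sup>2) sums sq \<nu> b"
proof -
  define R where "R \<nu> v \<longleftrightarrow> v \<in> C \<and> (\<forall>b. \<nu> b = ip (\<pi> b u) v) \<and> (\<forall>b. (nrm (\<pi> b v))\<^sup>2 \<le> sq \<nu> b)" for \<nu> v
  define V where "V \<nu> = (SOME v. R \<nu> v)" for \<nu>
  have V: "R \<nu> (V \<nu>)" if "plf \<nu>" "\<And>b. sq \<nu> b \<le> (nrm (\<pi> b u))\<^sup>2" for \<nu>
    unfolding V_def by (rule someI_ex, rule Radon_Nikodym[OF that(1) u that(2)]) (auto simp: R_def)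
  \<comment> \<open>In terms of the operators above,
    \<open>N k b = ip (\<pi> b u) (T\<^sub>k u)\<close>; subtracting the vector functional of
    \<open>T\<^sub>k u\<close> replaces \<open>T\<^sub>k\<close> by
    \<open>T\<^sub>k - T\<^sub>k\<^sup>2\<close>.\<close>
  define N where "N = rec_nat \<nu> (\<lambda>_ \<nu> b. \<nu> b - \<omega> (V \<nu>) b)"
  have N: "N 0 = \<nu>" "N (Suc k) = (\<lambda>b. N k b - \<omega> (V (N k)) b)" for k
    by (simp_all add: N_def)
  have inv: "plf (N k) \<and> (\<forall>b. sq (N k) b \<le> (nrm (\<pi> b u))\<^sup>2)" for k
  proof (induction k)
    case (Suc k)
    then have R: "R (N k) (V (N k))" by (auto intro: V)
    then have c: "V (N k) \<in> C" by (simp add: R_def)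
    have "(nrm (\<pi> b (V (N k))))\<^sup>2 \<le> sq (N k) b" for b using R by (simp add: R_def)
    then have "plf (N (Suc k))"
      unfolding N using Suc c by (intro plf_minus_functional) auto
    moreover have "sq (N (Suc k)) b \<le> (nrm (\<pi> b u))\<^sup>2" for b
      using Suc c sq_nonneg[OF plf_omega[OF c], of b] by (auto simp: N sq_diff intro: order_trans[rotated])
    ultimately show ?case by blast
  qed (use \<nu> le N in auto)
  define v where "v k = V (N k)" for k
  have "R (N k) (v k)" for k using inv[of k] by (auto simp: v_def intro: V)
  then have vC: "v k \<in> C" and vN: "N k b = ip (\<pi> b u) (v k)" for k b by (auto simp: R_def)
  have part: "(\<Sum>i<k. (nrm (\<pi> b (v i)))\<^sup>2) = sq \<nu> b - sq (N k) b" for b k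
    by (induction k) (use vC in \<open>auto simp: N sq_diff v_def\<close>)
  have bd: "(\<Sum>i<k. (nrm (\<pi> b (v i)))\<^sup>2) \<le> sq \<nu> b" for b k
    unfolding part using sq_nonneg[OF conjunct1[OF inv[of k]], of b] by simp
  \<comment> \<open>The partial sums at \<open>b = 1\<close> stay below \<open>sq \<nu> 1\<close>,
    so \<open>v k\<close> tends to 0 in norm; the remainders \<open>sq (N k) b\<close> are inner
    products with \<open>v k\<close> and vanish with it.\<close>
  have "summable (\<lambda>k. (nrm (\<pi> 1 (v k)))\<^sup>2)"
    by (rule summableI_nonneg_bounded[OF _ bd]) simp
  then have "(\<lambda>k. (nrm (v k))\<^sup>2) \<longlonglongrightarrow> 0" using vC by (auto dest: summable_LIMSEQ_zero)
  then have v0: "(\<lambda>k. nrm (v k)) \<longlonglongrightarrow> 0"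
    using tendsto_real_sqrt[of "\<lambda>k. (nrm (v k))\<^sup>2" 0] vC by simp
  have "(\<lambda>k. (nrm (\<pi> b (v k)))\<^sup>2) sums sq \<nu> b" for b
  proof -
    have "(\<lambda>k. sq (N k) b) \<longlonglongrightarrow> 0"
    proof (rule Lim_null_comparison)
      have "norm (sq (N k) b) \<le> nrm (\<pi> (star b * b) u) * nrm (v k)" for k
        using abs_Re_le_cmod[of "N k (star b * b)"] Cauchy_Schwarz[of "\<pi> (star b * b) u" "v k"] u vC
        by (simp add: sq_def vN)
      then show "\<forall>\<^sub>F k in sequentially. norm (sq (N k) b) \<le> nrm (\<pi> (star b * b) u) * nrm (v k)" by simp
      show "(\<lambda>k. nrm (\<pi> (star b * b) u) * nrm (v k)) \<longlonglongrightarrow> 0"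
        by (rule tendsto_mult_right_zero[OF v0])
    qed
    from tendsto_diff[OF tendsto_const[of "sq \<nu> b"] this] show ?thesis
      by (simp add: sums_def part)
  qed
  with vC that show thesis by blast
qed

end

section \<open>Amplification to square-summable sequences and normal functionals\<close>

definition amplify :: "('a \<Rightarrow> 'h \<Rightarrow> 'h) \<Rightarrow> 'a \<Rightarrow> (nat \<Rightarrow> 'h) \<Rightarrow> nat \<Rightarrow> 'h" where
  "amplify \<pi> a x = (\<lambda>n. \<pi> a (x n))"

lemma (in star_rep) amplify_closed:
  assumes "x \<in> hcarrier (ell2 H)"
  shows "amplify \<pi> a x \<in> hcarrier (ell2 H)"
proof -
  have le: "(nrm (\<pi> a (x n)))\<^sup>2 \<le> (norm a)\<^sup>2 * (nrm (x n))\<^sup>2" for n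
    using nrm_pi_le[of "x n" a] assms by (simp add: ell2_simps power_mono flip: power_mult_distrib)
  have "summable (\<lambda>n. (nrm (\<pi> a (x n)))\<^sup>2)"
    by (rule summable_comparison_test'[of "\<lambda>n. (norm a)\<^sup>2 * (nrm (x n))\<^sup>2" 0])
       (use assms le in \<open>auto simp: ell2_simps intro: summable_mult\<close>)
  then show ?thesis using assms by (simp add: ell2_simps amplify_def)
qed

lemma (in star_rep) star_rep_ell2: "star_rep (ell2 H) (amplify \<pi>)"
proof -
  interpret E: hilbert "ell2 H" by (rule hilbert_ell2)
  show ?thesis
  proof
    fix x y a assume xy: "x \<in> hcarrier (ell2 H)" "y \<in> hcarrier (ell2 H)"
    then show "hinner (ell2 H) (amplify \<pi> a x) y = hinner (ell2 H) x (amplify \<pi> (star a) y)"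
      by (simp add: ell2_simps amplify_def pi_star)
  qed (auto simp: amplify_closed,
       auto simp: amplify_def ell2_simps pi_add_vec pi_scale_vec pi_add pi_scaleC pi_mult)
qed

text \<open>A nonnegative double series may be rearranged into a single one along the pairing
  bijection; the passage goes through unordered sums.\<close>

lemma sums_prod_decode:
  fixes f :: "nat \<Rightarrow> nat \<Rightarrow> real"
  assumes f: "\<And>i. f i sums g i" and g: "g sums S" and nonneg: "\<And>i n. 0 \<le> f i n"
  shows "(\<lambda>k. case prod_decode k of (i, n) \<Rightarrow> f i n) sums S"
proof -
  have f': "(f i has_sum g i) UNIV" for i
    using sums_nonneg_imp_has_sum[OF f nonneg] .
  have "0 \<le> g i" for i using f nonneg sums_le[OF _ sums_zero f[of i]] by simp
  then have g': "(g has_sum S) UNIV" by (rule sums_nonneg_imp_has_sum[OF g])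
  have "((\<lambda>(i, n). f i n) has_sum S) (Sigma UNIV (\<lambda>_. UNIV))"
    using f' g' nonneg
    by (intro has_sum_SigmaI[where g = g] summable_on_SigmaI[where g = g]) (auto simp: has_sum_imp_summable)
  then have "((\<lambda>k. (\<lambda>(i, n). f i n) (prod_decode k)) has_sum S) UNIV"
    by (subst has_sum_reindex_bij_betw[OF bij_prod_decode]) simp
  then show ?thesis by (rule has_sum_imp_sums)
qed

context star_rep
begin

text \<open>Stated on elements \<open>star b * b\<close> only, which determine \<open>\<nu>\<close>.
  The case \<open>b = 1\<close> contains the square-summability of \<open>w\<close>.\<close>

definition normal :: "('a \<Rightarrow> complex) \<Rightarrow> bool" where
  "normal \<nu> \<longleftrightarrow> plf \<nu> \<and> (\<exists>w. (\<forall>n. w n \<in> C) \<and> (\<forall>b. (\<lambda>n. (nrm (\<pi> b (w n)))\<^sup>2) sums sq \<nu> b))"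

lemma normal_plf: "normal \<nu> \<Longrightarrow> plf \<nu>"
  by (simp add: normal_def)

lemma normal_sum:
  assumes \<nu>: "\<And>i. normal (\<nu> i)" and S: "\<And>b. (\<lambda>i. sq (\<nu> i) b) sums S b"
  obtains w where "\<And>n. w n \<in> C" "\<And>b. (\<lambda>n. (nrm (\<pi> b (w n)))\<^sup>2) sums S b"
proof -
  have "\<forall>i. \<exists>w. (\<forall>n. w n \<in> C) \<and> (\<forall>b. (\<lambda>n. (nrm (\<pi> b (w n)))\<^sup>2) sums sq (\<nu> i) b)"
    using \<nu> by (auto simp: normal_def)
  then obtain W where W: "\<And>i n. W i n \<in> C" "\<And>i b. (\<lambda>n. (nrm (\<pi> b (W i n)))\<^sup>2) sums sq (\<nu> i) b"
    by metis
  have "(\<lambda>k. (nrm (\<pi> b (case prod_decode k of (i, n) \<Rightarrow> W i n)))\<^sup>2) sums S b" for b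
    using sums_prod_decode[OF W(2) S] by (simp add: case_prod_beta')
  then show thesis using that[of "\<lambda>k. case prod_decode k of (i, n) \<Rightarrow> W i n"] W(1)
    by (simp add: case_prod_beta')
qed

text \<open>In the Hilbert sum, \<open>w\<close> is one vector whose functional dominates
  \<open>\<nu>\<close>. Hence \<open>\<nu>\<close> is a countable sum of vector functionals there,
  each of which is a countable sum of vector functionals on \<open>H\<close>.\<close>

lemma normal_if_dominated:
  assumes \<nu>: "plf \<nu>" and w: "\<And>n. w n \<in> C" "summable (\<lambda>n. (nrm (w n))\<^sup>2)"
    and le: "\<And>b. sq \<nu> b \<le> (\<Sum>n. (nrm (\<pi> b (w n)))\<^sup>2)"
  shows "normal \<nu>"
proof -
  interpret E: star_rep "ell2 H" "amplify \<pi>" by (rule star_rep_ell2)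
  have wC: "w \<in> E.C" using w by (simp add: ell2_simps)
  have nE: "(\<lambda>n. (nrm (\<pi> b (y n)))\<^sup>2) sums (E.nrm (amplify \<pi> b y))\<^sup>2" if "y \<in> E.C" for b y
    using ell2_norm_sq(3)[OF E.pi_closed[OF that, of b]] by (simp add: amplify_def)
  have "sq \<nu> b \<le> (E.nrm (amplify \<pi> b w))\<^sup>2" for b
    using le[of b] sums_unique[OF nE[OF wC]] by simp
  from E.dominated_eq_sum_omega[OF \<nu> wC this] obtain v
    where v: "\<And>k. v k \<in> E.C" "\<And>b. (\<lambda>k. (E.nrm (amplify \<pi> b (v k)))\<^sup>2) sums sq \<nu> b"
    by blast
  have "normal (E.\<omega> (v k))" for k
    using v(1)[of k] nE[OF v(1)[of k]] by (auto simp: normal_def ell2_simps)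
  moreover have "(\<lambda>k. sq (E.\<omega> (v k)) b) sums sq \<nu> b" for b using v by simp
  ultimately obtain u where "\<And>n. u n \<in> C" "\<And>b. (\<lambda>n. (nrm (\<pi> b (u n)))\<^sup>2) sums sq \<nu> b"
    by (rule normal_sum) blast
  then show ?thesis using \<nu> by (auto simp: normal_def)
qed

text \<open>Summability at \<open>1\<close> is enough: \<open>sq_le_norm\<close> spreads it to every
  \<open>b\<close>. The sum of the \<open>\<rho> i\<close> is then a series of vector functionals
  with \<open>\<nu>\<close> below it.\<close>

lemma normal_if_dominated_normal:
  assumes \<nu>: "plf \<nu>" and \<rho>: "\<And>i. normal (\<rho> i)" and "summable (\<lambda>i. sq (\<rho> i) 1)"
    and le: "\<And>b. sq \<nu> b \<le> (\<Sum>i::nat. sq (\<rho> i) b)"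
  shows "normal \<nu>"
proof -
  have "summable (\<lambda>i. sq (\<rho> i) b)" for b
    by (rule summable_comparison_test[of _ "\<lambda>i. (norm b)\<^sup>2 * sq (\<rho> i) 1"])
       (use assms normal_plf in \<open>auto simp: sq_nonneg sq_le_norm intro!: summable_mult\<close>)
  then have "(\<lambda>i. sq (\<rho> i) b) sums (\<Sum>i. sq (\<rho> i) b)" for b by (rule summable_sums)
  then obtain w where w: "\<And>n. w n \<in> C" "\<And>b. (\<lambda>n. (nrm (\<pi> b (w n)))\<^sup>2) sums (\<Sum>i. sq (\<rho> i) b)"
    by (rule normal_sum[OF \<rho>]) blast
  show ?thesis
  proof (rule normal_if_dominated[OF \<nu> w(1)])
    show "summable (\<lambda>n. (nrm (w n))\<^sup>2)" using sums_summable[OF w(2)[of 1]] w(1) by simp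
    show "sq \<nu> b \<le> (\<Sum>n. (nrm (\<pi> b (w n)))\<^sup>2)" for b using le sums_unique[OF w(2)] by simp
  qed
qed

text \<open>Conjugation by \<open>a\<close> moves the vectors \<open>w n\<close> to
  \<open>\<pi> a (w n)\<close>.\<close>

lemma normal_conj:
  assumes "normal \<nu>"
  shows "normal (\<lambda>b. \<nu> (star a * b * a))"
proof -
  obtain w where w: "\<And>n. w n \<in> C" "\<And>b. (\<lambda>n. (nrm (\<pi> b (w n)))\<^sup>2) sums sq \<nu> b"
    using assms by (auto simp: normal_def)
  have "\<forall>n. \<pi> a (w n) \<in> C" using w by simp
  moreover have "\<forall>b. (\<lambda>n. (nrm (\<pi> b (\<pi> a (w n))))\<^sup>2) sums sq (\<lambda>b. \<nu> (star a * b * a)) b"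
    using w(2)[of "_ * a"] w(1) by (simp add: sq_conj pi_mult)
  ultimately show ?thesis using plf_conj[OF normal_plf[OF assms], of a] by (auto simp: normal_def)
qed

lemma normal_zero [simp]: "normal (\<lambda>a. 0)"
  by (rule normal_if_dominated[of _ "\<lambda>_. \<zero>"]) (auto simp: sq_zero intro!: suminf_nonneg)

end

section \<open>The maximal part of a vector functional in a class of functionals\<close>

text \<open>Cauchy-Schwarz against the weights \<open>1 / 2 ^ Suc k\<close>, whose finite sums are
  below 1; the induction splits off the first term by
  \<open>(x + y)^2 \<le> 2 x^2 + 2 y^2\<close>.\<close>

lemma sum_sq_le_weighted:
  fixes t :: "nat \<Rightarrow> real"
  shows "(\<Sum>k<m. t k)\<^sup>2 \<le> (\<Sum>k<m. 2 ^ Suc k * (t k)\<^sup>2)"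
proof (induction m arbitrary: t)
  case (Suc m)
  let ?S = "\<Sum>k<m. t (Suc k)"
  have "0 \<le> (t 0 - ?S)\<^sup>2" by simp
  then have "(t 0 + ?S)\<^sup>2 \<le> 2 * (t 0)\<^sup>2 + 2 * ?S\<^sup>2"
    by (simp add: power2_sum power2_diff)
  also have "2 * ?S\<^sup>2 \<le> 2 * (\<Sum>k<m. 2 ^ Suc k * (t (Suc k))\<^sup>2)"
    using Suc.IH[of "\<lambda>k. t (Suc k)"] by simp
  finally show ?case
    by (simp add: sum.lessThan_Suc_shift sum_distrib_left mult.assoc del: sum.lessThan_Suc)
qed simp

text \<open>The properties of normality behind the projection argument, phrased for functionals on
  \<open>A\<close> alone: normality refers to the space of \<open>lam\<close>, whereas the
  projection takes place in the space of another functional.\<close>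

locale normal_class =
  fixes W :: "('a::cstar_algebra \<Rightarrow> complex) \<Rightarrow> bool"
  assumes W_plf: "W \<nu> \<Longrightarrow> plf \<nu>"
    and W_zero: "W (\<lambda>a. 0)"
    and W_conj: "W \<nu> \<Longrightarrow> W (\<lambda>b. \<nu> (star a * b * a))"
    and W_dominated: "plf \<nu> \<Longrightarrow> (\<And>i. W (\<rho> i)) \<Longrightarrow> summable (\<lambda>i. sq (\<rho> i) 1) \<Longrightarrow>
      (\<And>b. sq \<nu> b \<le> (\<Sum>i::nat. sq (\<rho> i) b)) \<Longrightarrow> W \<nu>"
begin

lemma W_dominated_finite:
  assumes "plf \<nu>" "\<And>i. W (\<rho> i)" "\<And>b. sq \<nu> b \<le> (\<Sum>i<n::nat. sq (\<rho> i) b)"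
  shows "W \<nu>"
proof (rule W_dominated[OF assms(1)])
  let ?r = "\<lambda>i. if i < n then \<rho> i else (\<lambda>a. 0)"
  have s: "(\<lambda>i. sq (?r i) b) sums (\<Sum>i<n. sq (\<rho> i) b)" for b
    using sums_finite[of "{..<n}" "\<lambda>i. sq (?r i) b"] by (simp add: sq_zero)
  show "W (?r i)" for i using assms W_zero by simp
  show "summable (\<lambda>i. sq (?r i) 1)" using s by (rule sums_summable)
  show "sq \<nu> b \<le> (\<Sum>i. sq (?r i) b)" for b
    using assms(3)[of b] sums_unique[OF s[of b]] by simp
qed

lemma W_mono: "plf \<nu> \<Longrightarrow> W \<rho> \<Longrightarrow> (\<And>b. sq \<nu> b \<le> sq \<rho> b) \<Longrightarrow> W \<nu>"
  using W_dominated_finite[of \<nu> "\<lambda>_. \<rho>" "Suc 0"] by simp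

lemma W_add: "W \<rho> \<Longrightarrow> W \<sigma> \<Longrightarrow> W (\<lambda>a. \<rho> a + \<sigma> a)"
  by (rule W_dominated_finite[of _ "\<lambda>i. if i = 0 then \<rho> else \<sigma>" 2])
     (auto simp: W_plf plf_plus sq_plus numeral_2_eq_2)

lemma W_times:
  assumes "W \<rho>" "0 \<le> r"
  shows "W (\<lambda>a. complex_of_real r * \<rho> a)"
proof -
  obtain n where "r \<le> real n" using real_arch_simple by blast
  then have "sq (\<lambda>a. complex_of_real r * \<rho> a) b \<le> (\<Sum>i<n. sq \<rho> b)" for b
    using sq_nonneg[OF W_plf[OF assms(1)]] by (simp add: sq_times mult_right_mono)
  then show ?thesis
    by (rule W_dominated_finite[rotated 2]) (use assms in \<open>auto simp: W_plf plf_times\<close>)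
qed

end

locale star_rep_class = star_rep H \<pi> + normal_class W
  for H :: "'h hspace" and \<pi> :: "'a::cstar_algebra \<Rightarrow> 'h \<Rightarrow> 'h" and W :: "('a \<Rightarrow> complex) \<Rightarrow> bool"
begin

lemma inner_pi_star_mult: "x \<in> C \<Longrightarrow> y \<in> C \<Longrightarrow> ip (\<pi> (star b * b) x) y = ip (\<pi> b x) (\<pi> b y)"
  by (simp add: pi_mult pi_star star_star)

definition K :: "'h set" where
  "K = {x \<in> C. W (\<omega> x)}"

text \<open>The inequality \<open>nrm_add_sq_le\<close>, used after applying \<open>\<pi> b\<close>,
  puts the functional of the combination below
  \<open>2 \<omega> x + 2 |c|^2 \<omega> y\<close>.\<close>

lemma K_comb:
  assumes "x \<in> K" "y \<in> K"
  shows "x \<oplus> c \<odot> y \<in> K"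
proof -
  have xy: "x \<in> C" "y \<in> C" "W (\<omega> x)" "W (\<omega> y)" using assms by (auto simp: K_def)
  let ?\<rho> = "\<lambda>a. complex_of_real 2 * \<omega> x a + complex_of_real (2 * (cmod c)\<^sup>2) * \<omega> y a"
  have "W ?\<rho>" by (intro W_add W_times xy) auto
  moreover have "sq (\<omega> (x \<oplus> c \<odot> y)) b \<le> sq ?\<rho> b" for b
    unfolding sq_plus sq_times
    using nrm_add_sq_le[of "\<pi> b x" "c \<odot> \<pi> b y"] xy
    by (simp add: pi_add_vec pi_scale_vec nrm_scale power_mult_distrib mult.assoc)
  ultimately have "W (\<omega> (x \<oplus> c \<odot> y))"
    using W_mono[of "\<omega> (x \<oplus> c \<odot> y)" ?\<rho>] xy by simp
  then show ?thesis using xy by (simp add: K_def)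
qed

lemma K_sub: "x \<in> K \<Longrightarrow> y \<in> K \<Longrightarrow> x \<ominus> y \<in> K"
  using K_comb[of x y "-1"] by (simp add: hsub_def)

lemma K_pi:
  assumes "x \<in> K"
  shows "\<pi> a x \<in> K"
proof -
  have x: "x \<in> C" "W (\<omega> x)" using assms by (auto simp: K_def)
  have "\<omega> (\<pi> a x) = (\<lambda>b. \<omega> x (star a * b * a))"
    using x by (simp add: fun_eq_iff \<omega>_def pi_mult pi_star star_star)
  then show ?thesis using x W_conj[of "\<omega> x" a] by (simp add: K_def)
qed

lemma zero_in_K: "\<zero> \<in> K"
proof -
  have "\<omega> \<zero> = (\<lambda>a. 0)" by (rule plf_eqI) (auto simp: sq_zero)
  then show ?thesis using W_zero by (simp add: K_def)
qed

text \<open>A rapidly converging choice of terms writes \<open>x\<close> as a telescoping series of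
  vectors \<open>y k\<close> in \<open>K\<close> with geometric decay. The weighted inequality
  bounds \<open>\<omega> x\<close> by the sum of \<open>2 ^ Suc k\<close> times
  \<open>\<omega> (y k)\<close>; this is where closure of \<open>W\<close> under countable
  domination enters.\<close>

lemma K_closed:
  assumes X: "\<And>n. X n \<in> K" and x: "x \<in> C" and lim: "hlim H X x"
  shows "x \<in> K"
proof -
  have XC: "X n \<in> C" for n using X by (auto simp: K_def)
  \<comment> \<open>The extra factor 1/2 makes two consecutive errors add up to at most
    \<open>(1/2) ^ k\<close>.\<close>
  have "\<exists>n. nrm (X n \<ominus> x) \<le> (1/2) ^ k / 2" for k :: nat
  proof -
    have "\<forall>\<^sub>F n in sequentially. nrm (X n \<ominus> x) < (1/2) ^ k / 2"
      using lim unfolding hlim_def by (rule order_tendstoD) simp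
    then show ?thesis using eventually_happens'[OF sequentially_bot] less_imp_le by blast
  qed
  then obtain r where r: "\<And>k::nat. nrm (X (r k) \<ominus> x) \<le> (1/2) ^ k / 2" by metis
  define y where "y k = (case k of 0 \<Rightarrow> X (r 0) | Suc j \<Rightarrow> X (r (Suc j)) \<ominus> X (r j))" for k
  have yK: "y k \<in> K" for k using X by (auto simp: y_def K_sub split: nat.split)
  then have yC: "y k \<in> C" "W (\<omega> (y k))" for k by (auto simp: K_def)
  define \<rho> where "\<rho> k = (\<lambda>a. complex_of_real (2 ^ Suc k) * \<omega> (y k) a)" for k
  have W: "W (\<rho> k)" for k unfolding \<rho>_def by (rule W_times) (use yC in auto)
  have sq\<rho>: "sq (\<rho> k) b = 2 ^ Suc k * (nrm (\<pi> b (y k)))\<^sup>2" for k b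
    unfolding \<rho>_def sq_times using yC by simp
  have ny: "nrm (y (Suc k)) \<le> (1/2) ^ k" for k
  proof -
    have "nrm (y (Suc k)) \<le> nrm (X (r (Suc k)) \<ominus> x) + nrm (x \<ominus> X (r k))"
      using XC x by (simp add: y_def nrm_sub_triangle)
    also have "\<dots> \<le> (1/2) ^ Suc k / 2 + (1/2) ^ k / 2"
      using r[of "Suc k"] r[of k] XC x by (simp add: nrm_sub_commute)
    also have "\<dots> \<le> (1/2) ^ k" by simp
    finally show ?thesis .
  qed
  have summ1: "summable (\<lambda>k. sq (\<rho> k) 1)"
  proof -
    \<comment> \<open>The term \<open>k = 0\<close> is split off because only the increments decay;
      their squares, at most \<open>1 / 4 ^ k\<close>, beat the weights
      \<open>2 ^ (k + 2)\<close>.\<close>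
    have "summable (\<lambda>k. sq (\<rho> (Suc k)) 1)"
    proof (rule summable_comparison_test)
      have "norm (sq (\<rho> (Suc k)) 1) \<le> 4 * (1/2) ^ k" for k
      proof -
        have "(nrm (y (Suc k)))\<^sup>2 \<le> ((1/2) ^ k)\<^sup>2" using ny yC by (intro power_mono) auto
        then have "2 ^ Suc (Suc k) * (nrm (y (Suc k)))\<^sup>2 \<le> 2 ^ Suc (Suc k) * ((1/2) ^ k)\<^sup>2" by simp
        also have "\<dots> = 4 * (1/2) ^ k" by (simp add: power2_eq_square power_divide)
        finally show ?thesis using yC by (simp add: sq\<rho>)
      qed
      then show "\<exists>N. \<forall>k\<ge>N. norm (sq (\<rho> (Suc k)) 1) \<le> 4 * (1/2) ^ k" by blast
      show "summable (\<lambda>k. 4 * (1 / 2 :: real) ^ k)" by (intro summable_mult summable_geometric) simp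
    qed
    then show ?thesis using summable_Suc_iff[of "\<lambda>k. sq (\<rho> k) 1"] by blast
  qed
  have summ: "summable (\<lambda>k. sq (\<rho> k) b)" for b
    by (rule summable_comparison_test[of _ "\<lambda>k. (norm b)\<^sup>2 * sq (\<rho> k) 1"])
       (use W_plf[OF W] sq_le_norm summ1 in \<open>auto simp: sq_nonneg intro!: summable_mult\<close>)
  have "sq (\<omega> x) b \<le> (\<Sum>k. sq (\<rho> k) b)" for b
  proof (rule LIMSEQ_le_const2)
    have "hlim H (\<lambda>m. X (r m)) x"
      unfolding hlim_def
    proof (rule Lim_null_comparison)
      show "\<forall>\<^sub>F m in sequentially. norm (nrm (X (r m) \<ominus> x)) \<le> (1/2) ^ m / 2" using r XC x by simp
      show "(\<lambda>m. (1 / 2 :: real) ^ m / 2) \<longlonglongrightarrow> 0" by (intro tendsto_divide_zero LIMSEQ_realpow_zero) auto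
    qed
    then have "hlim H (\<lambda>m. \<pi> b (X (r m))) (\<pi> b x)"
      by (rule hlim_contraction[where K = "norm b"])
         (use XC x nrm_pi_le in \<open>auto simp flip: pi_sub_vec\<close>)
    then show "(\<lambda>m. (nrm (\<pi> b (X (r m))))\<^sup>2) \<longlonglongrightarrow> sq (\<omega> x) b"
      using XC x by (simp add: tendsto_power hlim_nrm)
    have tri: "nrm (\<pi> b (X (r m))) \<le> (\<Sum>k<Suc m. nrm (\<pi> b (y k)))" for m
    proof (induction m)
      case (Suc m)
      have "X (r (Suc m)) = X (r m) \<oplus> y (Suc m)" using XC by (intro eqI) (auto simp: y_def)
      then have "nrm (\<pi> b (X (r (Suc m)))) \<le> nrm (\<pi> b (X (r m))) + nrm (\<pi> b (y (Suc m)))"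
        using XC yC by (simp add: pi_add_vec nrm_triangle)
      with Suc show ?case by simp
    qed (simp add: y_def)
    have "(nrm (\<pi> b (X (r m))))\<^sup>2 \<le> (\<Sum>k. sq (\<rho> k) b)" for m
    proof -
      have "(nrm (\<pi> b (X (r m))))\<^sup>2 \<le> (\<Sum>k<Suc m. nrm (\<pi> b (y k)))\<^sup>2"
        using tri[of m] XC by (intro power_mono) auto
      also have "\<dots> \<le> (\<Sum>k<Suc m. sq (\<rho> k) b)" unfolding sq\<rho> by (rule sum_sq_le_weighted)
      also have "\<dots> \<le> (\<Sum>k. sq (\<rho> k) b)"
        by (rule sum_le_suminf[OF summ]) (use W_plf[OF W] in \<open>auto simp: sq_nonneg\<close>)
      finally show ?thesis .
    qed
    then show "\<exists>N. \<forall>m\<ge>N. (nrm (\<pi> b (X (r m))))\<^sup>2 \<le> (\<Sum>k. sq (\<rho> k) b)" by blast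
  qed
  then have "W (\<omega> x)" 
    using W_dominated[of "\<omega> x" \<rho>] W summ1 x by simp
  with x show ?thesis by (simp add: K_def)
qed

lemma projection_K:
  assumes "x \<in> C"
  obtains p where "p \<in> K" "\<And>k. k \<in> K \<Longrightarrow> ip k x = ip k p"
proof (rule projection[of K x])
  show "K \<subseteq> C" by (auto simp: K_def)
  show "K \<noteq> {}" using zero_in_K by blast
  show "y \<in> K" if "\<And>n. X n \<in> K" "y \<in> C" "hlim H X y" for X y
    using K_closed that by blast
qed (use K_comb assms that in auto)

text \<open>Since \<open>K\<close> is invariant, \<open>\<pi> (star b * b) p\<close> lies in
  \<open>K\<close> and cannot distinguish \<open>p\<close> from \<open>x\<close>; hence
  \<open>(nrm (\<pi> b p))^2 = ip (\<pi> b p) (\<pi> b x)\<close>.\<close>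

lemma omega_projection_le:
  assumes x: "x \<in> C" and p: "p \<in> K" "\<And>k. k \<in> K \<Longrightarrow> ip k x = ip k p"
  shows "sq (\<omega> p) b \<le> sq (\<omega> x) b"
proof -
  have pC: "p \<in> C" using p by (simp add: K_def)
  have "ip (\<pi> b p) (\<pi> b p) = ip (\<pi> (star b * b) p) p" using pC by (simp add: pi_mult pi_star star_star)
  also have "\<dots> = ip (\<pi> (star b * b) p) x" using p(2)[OF K_pi[OF p(1)]] by simp
  also have "\<dots> = ip (\<pi> b p) (\<pi> b x)" using pC x by (simp add: pi_mult pi_star star_star)
  finally have "(nrm (\<pi> b p))\<^sup>2 = cmod (ip (\<pi> b p) (\<pi> b x))" using pC by (simp add: inner_self norm_power) (metis norm_of_real norm_power abs_norm_cancel abs_of_nonneg nrm_nonneg pi_closed)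
  also have "\<dots> \<le> nrm (\<pi> b p) * nrm (\<pi> b x)" using pC x by (simp add: Cauchy_Schwarz)
  finally have "nrm (\<pi> b p) * nrm (\<pi> b p) \<le> nrm (\<pi> b p) * nrm (\<pi> b x)" by (simp add: power2_eq_square)
  then have "nrm (\<pi> b p) \<le> nrm (\<pi> b x)"
    using pC x by (cases "nrm (\<pi> b p) = 0") (auto simp: mult_le_cancel_left less_le)
  then show ?thesis using pC x by (simp add: power_mono)
qed

text \<open>The Radon-Nikodym vector of \<open>\<rho>\<close> lies in \<open>K\<close>, so it only sees the projection \<open>p\<close> of \<open>x\<close>.\<close>

lemma le_omega_projection:
  assumes x: "x \<in> C" and p: "p \<in> K" "\<And>k. k \<in> K \<Longrightarrow> ip k x = ip k p"
    and \<rho>: "W \<rho>" "\<And>b. sq \<rho> b \<le> sq (\<omega> x) b"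
  shows "sq \<rho> b \<le> sq (\<omega> p) b"
proof -
  have pC: "p \<in> C" using p by (simp add: K_def)
  have \<rho>p: "plf \<rho>" by (rule W_plf[OF \<rho>(1)])
  obtain v where v: "v \<in> C" "\<And>b. \<rho> b = ip (\<pi> b x) v" "\<And>b. (nrm (\<pi> b v))\<^sup>2 \<le> sq \<rho> b"
    using Radon_Nikodym[OF \<rho>p x] \<rho>(2) x by auto
  \<comment> \<open>\<open>W\<close> passes from \<open>\<rho>\<close> to \<open>\<omega> v\<close>
    because the Radon-Nikodym vector satisfies \<open>\<omega> v \<le> \<rho>\<close>.\<close>
  have "W (\<omega> v)" using W_mono[of "\<omega> v" \<rho>] v \<rho> by simp
  then have vK: "v \<in> K" using v by (simp add: K_def)
  define s where "s = sqrt (sq \<rho> b)"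
  have s: "s\<^sup>2 = sq \<rho> b" "0 \<le> s" using \<rho>p by (simp_all add: s_def sq_nonneg)
  have "ip (\<pi> (star b * b) x) v = cnj (ip (\<pi> (star b * b) v) x)"
    using x v inner_sym[of "\<pi> b v" "\<pi> b x"] by (simp add: inner_pi_star_mult)
  also have "\<dots> = cnj (ip (\<pi> (star b * b) v) p)" using p(2)[OF K_pi[OF vK]] by simp
  also have "\<dots> = ip (\<pi> b p) (\<pi> b v)"
    using pC v inner_sym[of "\<pi> b v" "\<pi> b p"] by (simp add: inner_pi_star_mult)
  finally have "of_real (s\<^sup>2) = ip (\<pi> b p) (\<pi> b v)"
    using v(2)[of "star b * b"] plf_sq[OF \<rho>p, of b] s by simp
  then have "s\<^sup>2 = cmod (ip (\<pi> b p) (\<pi> b v))" using s(2) by (metis abs_of_nonneg norm_of_real zero_le_power2)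
  also have "\<dots> \<le> nrm (\<pi> b p) * nrm (\<pi> b v)" using pC v by (simp add: Cauchy_Schwarz)
  also have "\<dots> \<le> nrm (\<pi> b p) * s"
  proof (rule mult_left_mono)
    show "nrm (\<pi> b v) \<le> s" by (rule power2_le_imp_le) (use v(3)[of b] s in simp_all)
  qed (use pC in simp)
  finally have "s * s \<le> nrm (\<pi> b p) * s" by (simp add: power2_eq_square)
  then have "s \<le> nrm (\<pi> b p)"
    using s(2) pC by (cases "s = 0") (auto simp: mult_le_cancel_right less_le)
  then have "s\<^sup>2 \<le> (nrm (\<pi> b p))\<^sup>2" using s by (intro power_mono) auto
  then show ?thesis using pC by (simp add: s)
qed

lemma maximal_part:
  assumes "x \<in> C"
  obtains \<nu> where "W \<nu>" "\<And>b. sq \<nu> b \<le> sq (\<omega> x) b"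
    "\<And>\<rho> b. W \<rho> \<Longrightarrow> (\<And>b. sq \<rho> b \<le> sq (\<omega> x) b) \<Longrightarrow> sq \<rho> b \<le> sq \<nu> b"
proof -
  obtain p where p: "p \<in> K" "\<And>k. k \<in> K \<Longrightarrow> ip k x = ip k p" using projection_K[OF assms] by blast
  show thesis
  proof (rule that[of "\<omega> p"])
    show "W (\<omega> p)" using p by (simp add: K_def)
  qed (use omega_projection_le[OF assms p] le_omega_projection[OF assms p] in auto)
qed

text \<open>The Radon-Nikodym vectors \<open>v\<close> and \<open>v'\<close> of the two summands add
  up to \<open>x\<close> by cyclicity. Each is orthogonal to \<open>K\<close>: the functional of its
  projection to \<open>K\<close> lies in \<open>W\<close> and below a singular summand. Hence
  \<open>x\<close> is orthogonal to \<open>K\<close>, its projection vanishes, and so does every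
  \<open>\<rho>\<close> of \<open>W\<close> below \<open>\<omega> x\<close>.\<close>

lemma singular_add:
  assumes x: "x \<in> C" and cyclic: "\<And>y. y \<in> C \<Longrightarrow> (\<And>b. ip (\<pi> b x) y = 0) \<Longrightarrow> y = \<zero>"
    and \<sigma>: "plf \<sigma>" "plf \<sigma>'" and eq: "\<And>b. \<omega> x b = \<sigma> b + \<sigma>' b"
    and sing: "\<And>\<rho>. W \<rho> \<Longrightarrow> (\<And>b. sq \<rho> b \<le> sq \<sigma> b) \<Longrightarrow> \<rho> = (\<lambda>a. 0)"
      "\<And>\<rho>. W \<rho> \<Longrightarrow> (\<And>b. sq \<rho> b \<le> sq \<sigma>' b) \<Longrightarrow> \<rho> = (\<lambda>a. 0)"
    and \<rho>: "W \<rho>" "\<And>b. sq \<rho> b \<le> sq (\<omega> x) b"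
  shows "\<rho> = (\<lambda>a. 0)"
proof -
  have eqx: "(nrm (\<pi> b x))\<^sup>2 = sq \<sigma> b + sq \<sigma>' b" for b
    using arg_cong[where f = Re, OF eq[of "star b * b"]] sq_omega[OF x, of b] by (simp add: sq_def)
  have part: "\<exists>v\<in>C. \<exists>q\<in>K. (\<forall>b. s b = ip (\<pi> b x) v) \<and> (\<forall>k\<in>K. ip k v = 0)"
    if s: "plf s" "\<And>b. sq s b \<le> (nrm (\<pi> b x))\<^sup>2"
      and sing: "\<And>\<rho>. W \<rho> \<Longrightarrow> (\<And>b. sq \<rho> b \<le> sq s b) \<Longrightarrow> \<rho> = (\<lambda>a. 0)" for s
  proof -
    obtain v where v: "v \<in> C" "\<And>b. s b = ip (\<pi> b x) v" "\<And>b. (nrm (\<pi> b v))\<^sup>2 \<le> sq s b"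
      using Radon_Nikodym[OF s(1) x s(2)] by blast
    obtain q where q: "q \<in> K" "\<And>k. k \<in> K \<Longrightarrow> ip k v = ip k q" using projection_K[OF v(1)] by blast
    have qC: "q \<in> C" "W (\<omega> q)" using q by (auto simp: K_def)
    have "sq (\<omega> q) b \<le> sq s b" for b
      using order_trans[OF omega_projection_le[OF v(1) q, of b]] v(3)[of b] sq_omega[OF v(1), of b] by metis
    with qC(2) have "\<omega> q = (\<lambda>a. 0)" by (rule sing)
    then have "sq (\<omega> q) 1 = 0" by (simp add: sq_zero)
    then have "nrm q = 0" using qC by simp
    then have "ip k q = 0" if "k \<in> K" for k
      using that qC Cauchy_Schwarz[of k q] by (auto simp: K_def)
    then show ?thesis using v q by (intro bexI[of _ v] bexI[of _ q]) auto
  qed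
  obtain v where v: "v \<in> C" "\<And>b. \<sigma> b = ip (\<pi> b x) v" "\<And>k. k \<in> K \<Longrightarrow> ip k v = 0"
    using part[OF \<sigma>(1)] sing(1) eqx sq_nonneg[OF \<sigma>(2)] by auto
  obtain v' where v': "v' \<in> C" "\<And>b. \<sigma>' b = ip (\<pi> b x) v'" "\<And>k. k \<in> K \<Longrightarrow> ip k v' = 0"
    using part[OF \<sigma>(2)] sing(2) eqx sq_nonneg[OF \<sigma>(1)] by auto
  have "x \<ominus> v \<ominus> v' = \<zero>"
    using x v v' eq by (intro cyclic) (auto simp: \<omega>_def)
  obtain p where p: "p \<in> K" "\<And>k. k \<in> K \<Longrightarrow> ip k x = ip k p" using projection_K[OF x] by blast
  have pC: "p \<in> C" using p by (simp add: K_def)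
  have "ip p (x \<ominus> v \<ominus> v') = 0" using \<open>x \<ominus> v \<ominus> v' = \<zero>\<close> pC by simp
  then have "ip p p = 0" using p v v' x pC by simp
  then have "nrm p = 0" using norm_sq[OF pC] by simp
  then have "nrm (\<pi> b p) = 0" for b using nrm_pi_le[OF pC, of b] nrm_nonneg[OF pi_closed[OF pC], of b] by simp
  then have "sq \<rho> b \<le> 0" for b using le_omega_projection[OF x p \<rho>, of b] pC by simp
  then show ?thesis
    using sq_nonneg[OF W_plf[OF \<rho>(1)]] by (intro plf_eqI W_plf[OF \<rho>(1)]) (auto simp: sq_zero intro: antisym)
qed

end

lemma (in star_rep) normal_class_normal: "normal_class normal"
  by unfold_locales (auto intro: normal_plf normal_conj normal_if_dominated_normal)

section \<open>The GNS representation\<close>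

locale gns =
  fixes lam :: "'a::cstar_algebra \<Rightarrow> complex"
  assumes lam: "plf lam"
begin

abbreviation "sn \<equiv> gns_seminorm lam"
abbreviation "cl \<equiv> gns_class lam"
abbreviation "gc \<equiv> gns_cauchy lam"

lemma sn_eq: "sn a = sqrt (sq lam a)"
  by (simp add: gns_seminorm_def sq_def)

lemma sn_nonneg [simp]: "0 \<le> sn a"
  by (simp add: sn_eq sq_nonneg lam)

lemma sn_sq: "(sn a)\<^sup>2 = sq lam a"
  by (simp add: sn_eq sq_nonneg lam)

lemma sn_zero [simp]: "sn 0 = 0"
  by (simp add: sn_eq sq_def plf_zero lam)

lemma lam_le_sn: "cmod (lam (star b * a)) \<le> sn b * sn a"
  by (rule power2_le_imp_le) (use plf_Cauchy_Schwarz[OF lam, of b a] in \<open>simp_all add: power_mult_distrib sn_sq\<close>)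

lemma sn_scaleC: "sn (c *\<^sub>C a) = cmod c * sn a"
proof -
  have "sq lam (c *\<^sub>C a) = (cmod c)\<^sup>2 * sq lam a"
    using sq_add_scaleC[OF lam, of 0 c a] lam by (simp add: sq_def plf_zero)
  then show ?thesis by (simp add: sn_eq real_sqrt_mult)
qed

lemma sn_minus [simp]: "sn (- a) = sn a"
  using sn_scaleC[of "-1" a] by (simp add: scaleC_minus_one)

lemma sn_commute: "sn (a - b) = sn (b - a)"
  using sn_minus[of "a - b"] by simp

lemma sn_triangle: "sn (a + b) \<le> sn a + sn b"
proof (rule power2_le_imp_le)
  have "sq lam (a + b) = sq lam a + 2 * Re (lam (star a * b)) + sq lam b"
    using sq_add_scaleC[OF lam, of a 1 b] by simp
  moreover have "Re (lam (star a * b)) \<le> sn a * sn b"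
    using lam_le_sn[of a b] complex_Re_le_cmod order_trans by blast
  ultimately show "(sn (a + b))\<^sup>2 \<le> (sn a + sn b)\<^sup>2" by (simp add: sn_sq power2_sum)
qed simp

lemma sn_triangle_sub: "sn (a - c) \<le> sn (a - b) + sn (b - c)"
  using sn_triangle[of "a - b" "b - c"] by simp

lemma sn_mult_le: "sn (a * b) \<le> norm a * sn b"
  by (rule power2_le_imp_le) (simp_all add: power_mult_distrib sn_sq sq_mult_le lam)

lemma gcD: "x \<in> gc \<Longrightarrow> 0 < e \<Longrightarrow> \<exists>N. \<forall>m\<ge>N. \<forall>n\<ge>N. sn (x m - x n) < e"
  by (simp add: gns_cauchy_def)

lemma gcI: "(\<And>e. 0 < e \<Longrightarrow> \<exists>N. \<forall>m\<ge>N. \<forall>n\<ge>N. sn (x m - x n) < e) \<Longrightarrow> x \<in> gc"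
  by (simp add: gns_cauchy_def)

lemma const_in_gc [simp]: "(\<lambda>n. a) \<in> gc"
  by (rule gcI) simp

lemma gc_add [simp]:
  assumes "x \<in> gc" "y \<in> gc"
  shows "(\<lambda>n. x n + y n) \<in> gc"
proof (rule gcI)
  fix e :: real assume "0 < e"
  then have "0 < e / 2" by simp
  obtain N where N: "\<forall>m\<ge>N. \<forall>n\<ge>N. sn (x m - x n) < e / 2" using gcD[OF assms(1) \<open>0 < e / 2\<close>] by blast
  obtain M where M: "\<forall>m\<ge>M. \<forall>n\<ge>M. sn (y m - y n) < e / 2" using gcD[OF assms(2) \<open>0 < e / 2\<close>] by blast
  have "sn (x m + y m - (x n + y n)) < e" if "m \<ge> max N M" "n \<ge> max N M" for m n
  proof -
    have "sn (x m + y m - (x n + y n)) \<le> sn (x m - x n) + sn (y m - y n)"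
      using sn_triangle[of "x m - x n" "y m - y n"] by (simp add: algebra_simps)
    also have "\<dots> < e / 2 + e / 2" using N M that by (intro add_strict_mono) auto
    finally show ?thesis by simp
  qed
  then show "\<exists>N. \<forall>m\<ge>N. \<forall>n\<ge>N. sn (x m + y m - (x n + y n)) < e" by blast
qed

lemma gc_bounded_map:
  assumes "x \<in> gc" "\<And>m n. sn (y m - y n) \<le> K * sn (x m - x n)"
  shows "y \<in> gc"
proof (rule gcI)
  fix e :: real assume "0 < e"
  have K: "\<bar>K\<bar> + 1 > 0" by simp
  obtain N where N: "\<forall>m\<ge>N. \<forall>n\<ge>N. sn (x m - x n) < e / (\<bar>K\<bar> + 1)"
    using gcD[OF assms(1), of "e / (\<bar>K\<bar> + 1)"] \<open>0 < e\<close> K by auto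
  have "sn (y m - y n) < e" if "m \<ge> N" "n \<ge> N" for m n
  proof -
    have "sn (y m - y n) \<le> K * sn (x m - x n)" by (rule assms)
    also have "\<dots> \<le> (\<bar>K\<bar> + 1) * sn (x m - x n)" by (intro mult_right_mono) auto
    also have "\<dots> < (\<bar>K\<bar> + 1) * (e / (\<bar>K\<bar> + 1))" using N that K by (intro mult_strict_left_mono) auto
    also have "\<dots> = e" using K by simp
    finally show ?thesis .
  qed
  then show "\<exists>N. \<forall>m\<ge>N. \<forall>n\<ge>N. sn (y m - y n) < e" by blast
qed

lemma gc_scaleC [simp]: "x \<in> gc \<Longrightarrow> (\<lambda>n. c *\<^sub>C x n) \<in> gc"
  by (rule gc_bounded_map[where K = "cmod c"]) (auto simp: sn_scaleC simp flip: scaleC_diff_right)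

lemma gc_mult [simp]: "x \<in> gc \<Longrightarrow> (\<lambda>n. a * x n) \<in> gc"
  by (rule gc_bounded_map[where K = "norm a"]) (auto simp: sn_mult_le simp flip: right_diff_distrib)

lemma gc_diff [simp]: "x \<in> gc \<Longrightarrow> y \<in> gc \<Longrightarrow> (\<lambda>n. x n - y n) \<in> gc"
  using gc_add[of x "\<lambda>n. (-1) *\<^sub>C y n"] gc_scaleC[of y "-1"] by (simp add: scaleC_minus_one)

lemma gc_bound:
  assumes "x \<in> gc"
  obtains B where "B > 0" "\<And>n. sn (x n) \<le> B"
proof -
  obtain N where N: "\<forall>m\<ge>N. \<forall>n\<ge>N. sn (x m - x n) < 1" using gcD[OF assms, of 1] by auto
  define B where "B = 1 + sn (x N) + (\<Sum>n<N. sn (x n))"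
  have s: "0 \<le> (\<Sum>n<N. sn (x n))" by (intro sum_nonneg) simp
  have "sn (x n) \<le> B" for n
  proof (cases "n < N")
    case True
    then have "sn (x n) \<le> (\<Sum>n<N. sn (x n))" by (intro member_le_sum) auto
    then show ?thesis unfolding B_def using sn_nonneg[of "x N"] by linarith
  next
    case False
    then have "sn (x n - x N) < 1" using N by simp
    then show ?thesis using sn_triangle[of "x n - x N" "x N"] s by (simp add: B_def)
  qed
  moreover have "B > 0" unfolding B_def using s sn_nonneg[of "x N"] by linarith
  ultimately show thesis using that by blast
qed

lemma lam_diff_le:
  "cmod (lam (star b * a) - lam (star b' * a')) \<le> sn b * sn (a - a') + sn (b - b') * sn a'"
proof -
  have "star b * a - star b' * a' = star b * (a - a') + star (b - b') * a'"
    by (simp add: star_diff algebra_simps)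
  then have "lam (star b * a) - lam (star b' * a') = lam (star b * (a - a')) + lam (star (b - b') * a')"
    using lam by (simp flip: plf_diff plf_add)
  also have "cmod \<dots> \<le> cmod (lam (star b * (a - a'))) + cmod (lam (star (b - b') * a'))"
    by (rule norm_triangle_ineq)
  finally show ?thesis using lam_le_sn[of b "a - a'"] lam_le_sn[of "b - b'" a'] by linarith
qed

lemma convergent_inner:
  assumes "x \<in> gc" "y \<in> gc"
  shows "convergent (\<lambda>n. lam (star (y n) * x n))"
proof -
  obtain A where A: "A > 0" "\<And>n. sn (x n) \<le> A" using gc_bound[OF assms(1)] by blast
  obtain B where B: "B > 0" "\<And>n. sn (y n) \<le> B" using gc_bound[OF assms(2)] by blast
  have "Cauchy (\<lambda>n. lam (star (y n) * x n))"
  proof (rule CauchyI)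
    fix e :: real assume "0 < e"
    obtain N where N: "\<forall>m\<ge>N. \<forall>n\<ge>N. sn (x m - x n) < e / (2 * B)"
      using gcD[OF assms(1), of "e / (2 * B)"] \<open>0 < e\<close> B by auto
    obtain M where M: "\<forall>m\<ge>M. \<forall>n\<ge>M. sn (y m - y n) < e / (2 * A)"
      using gcD[OF assms(2), of "e / (2 * A)"] \<open>0 < e\<close> A by auto
    have "norm (lam (star (y m) * x m) - lam (star (y n) * x n)) < e" if "m \<ge> max N M" "n \<ge> max N M" for m n
    proof -
      have "norm (lam (star (y m) * x m) - lam (star (y n) * x n)) \<le>
          sn (y m) * sn (x m - x n) + sn (y m - y n) * sn (x n)" by (rule lam_diff_le)
      also have "\<dots> \<le> B * sn (x m - x n) + sn (y m - y n) * A"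
        using A B by (intro add_mono mult_mono) (auto simp: less_imp_le)
      also have "\<dots> < B * (e / (2 * B)) + (e / (2 * A)) * A"
        using N M that A B by (intro add_strict_mono mult_strict_left_mono mult_strict_right_mono) auto
      also have "\<dots> = e" using A B by simp
      finally show ?thesis .
    qed
    then show "\<exists>M. \<forall>m\<ge>M. \<forall>n\<ge>M. norm (lam (star (y m) * x m) - lam (star (y n) * x n)) < e" by blast
  qed
  then show ?thesis by (simp add: Cauchy_convergent_iff)
qed

lemma gns_rel_iff: "(x, y) \<in> gns_rel lam \<longleftrightarrow> x \<in> gc \<and> y \<in> gc \<and> (\<lambda>n. sn (x n - y n)) \<longlonglongrightarrow> 0"
  by (simp add: gns_rel_def)

lemma equiv_gns_rel: "equiv gc (gns_rel lam)"
proof (rule equivI)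
  show "gns_rel lam \<subseteq> gc \<times> gc" by (auto simp: gns_rel_iff)
  show "refl_on gc (gns_rel lam)" by (auto simp: refl_on_def gns_rel_iff)
  show "sym (gns_rel lam)" by (auto simp: sym_def gns_rel_iff sn_commute)
  show "trans (gns_rel lam)"
  proof (rule transI)
    fix x y z assume xy: "(x, y) \<in> gns_rel lam" and yz: "(y, z) \<in> gns_rel lam"
    have "(\<lambda>n. sn (x n - y n) + sn (y n - z n)) \<longlonglongrightarrow> 0 + 0"
      by (rule tendsto_add) (use xy yz in \<open>auto simp: gns_rel_iff\<close>)
    then have lim: "(\<lambda>n. sn (x n - y n) + sn (y n - z n)) \<longlonglongrightarrow> 0" by simp
    have "(\<lambda>n. sn (x n - z n)) \<longlonglongrightarrow> 0"
      by (rule Lim_null_comparison[OF _ lim]) (simp add: sn_triangle_sub)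
    then show "(x, z) \<in> gns_rel lam" using xy yz by (auto simp: gns_rel_iff)
  qed
qed

lemma carrier_L2: "hcarrier (L2 lam) = gc // gns_rel lam"
  by (simp add: L2_def)

lemma cl_in_carrier [simp, intro]: "x \<in> gc \<Longrightarrow> cl x \<in> hcarrier (L2 lam)"
  by (simp add: carrier_L2 gns_class_def quotientI)

lemma carrier_cases:
  assumes "X \<in> hcarrier (L2 lam)"
  obtains x where "x \<in> gc" "X = cl x"
  using assms by (auto simp: carrier_L2 gns_class_def elim: quotientE)

lemma cl_eq_iff: "x \<in> gc \<Longrightarrow> y \<in> gc \<Longrightarrow> cl x = cl y \<longleftrightarrow> (\<lambda>n. sn (x n - y n)) \<longlonglongrightarrow> 0"
  by (simp add: gns_class_def eq_equiv_class_iff[OF equiv_gns_rel] gns_rel_iff)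

lemma rep_rel: "x \<in> gc \<Longrightarrow> (x, gns_rep (cl x)) \<in> gns_rel lam"
  using someI[of "\<lambda>y. y \<in> cl x" x] equiv_class_self[OF equiv_gns_rel]
  by (auto simp: gns_rep_def gns_class_def)

lemma rep_in_gc: "x \<in> gc \<Longrightarrow> gns_rep (cl x) \<in> gc"
  and rep_lim: "x \<in> gc \<Longrightarrow> (\<lambda>n. sn (x n - gns_rep (cl x) n)) \<longlonglongrightarrow> 0"
  using rep_rel by (auto simp: gns_rel_iff)

lemma hadd_cl [simp]:
  assumes "x \<in> gc" "y \<in> gc"
  shows "hadd (L2 lam) (cl x) (cl y) = cl (\<lambda>n. x n + y n)"
proof -
  let ?x = "gns_rep (cl x)" and ?y = "gns_rep (cl y)"
  have lim: "(\<lambda>n. sn (x n - ?x n) + sn (y n - ?y n)) \<longlonglongrightarrow> 0"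
    by (intro tendsto_add_zero rep_lim assms)
  have le: "sn (x n + y n - (?x n + ?y n)) \<le> sn (x n - ?x n) + sn (y n - ?y n)" for n
    using sn_triangle[of "x n - ?x n" "y n - ?y n"] by (simp add: algebra_simps)
  have "(\<lambda>n. sn (x n + y n - (?x n + ?y n))) \<longlonglongrightarrow> 0"
    by (rule Lim_null_comparison[OF _ lim]) (simp add: le)
  then have "cl (\<lambda>n. x n + y n) = cl (\<lambda>n. ?x n + ?y n)"
    using assms by (simp add: cl_eq_iff rep_in_gc)
  then show ?thesis by (simp add: L2_def)
qed

text \<open>The operations of \<open>L2\<close> go through the arbitrary representative
  \<open>gns_rep\<close>; a seminorm bound against the distance to that representative makes the
  choice irrelevant. Scaling and left multiplication are the two uses.\<close>

lemma cl_bounded_map: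
  assumes "x \<in> gc" "y \<in> gc" "y' \<in> gc" "\<And>n. sn (y n - y' n) \<le> K * sn (x n - gns_rep (cl x) n)"
  shows "cl y' = cl y"
proof -
  have "(\<lambda>n. K * sn (x n - gns_rep (cl x) n)) \<longlonglongrightarrow> 0"
    by (rule tendsto_mult_right_zero[OF rep_lim[OF assms(1)]])
  then have "(\<lambda>n. sn (y n - y' n)) \<longlonglongrightarrow> 0"
    by (rule Lim_null_comparison[rotated]) (use assms(4) in simp)
  then show ?thesis using assms cl_eq_iff[of y y'] by simp
qed

lemma hscale_cl [simp]:
  assumes "x \<in> gc"
  shows "hscale (L2 lam) c (cl x) = cl (\<lambda>n. c *\<^sub>C x n)"
  using cl_bounded_map[OF assms, of "\<lambda>n. c *\<^sub>C x n" "\<lambda>n. c *\<^sub>C gns_rep (cl x) n" "cmod c"] assms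
  by (simp add: L2_def rep_in_gc sn_scaleC flip: scaleC_diff_right)

lemma hsub_cl [simp]: "x \<in> gc \<Longrightarrow> y \<in> gc \<Longrightarrow> hsub (L2 lam) (cl x) (cl y) = cl (\<lambda>n. x n - y n)"
  by (simp add: hsub_def) (simp add: scaleC_minus_one)

lemma gns_pi_cl [simp]:
  assumes "x \<in> gc"
  shows "gns_pi lam a (cl x) = cl (\<lambda>n. a * x n)"
  using cl_bounded_map[OF assms, of "\<lambda>n. a * x n" "\<lambda>n. a * gns_rep (cl x) n" "norm a"] assms
  by (simp add: gns_pi_def rep_in_gc sn_mult_le flip: right_diff_distrib)

lemma inner_lim:
  assumes x: "x \<in> gc" and y: "y \<in> gc"
  shows "(\<lambda>n. lam (star (y n) * x n)) \<longlonglongrightarrow> hinner (L2 lam) (cl x) (cl y)"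
proof -
  let ?x = "gns_rep (cl x)" and ?y = "gns_rep (cl y)"
  obtain A where A: "A > 0" "\<And>n. sn (?x n) \<le> A" using gc_bound[OF rep_in_gc[OF x]] by blast
  obtain B where B: "B > 0" "\<And>n. sn (y n) \<le> B" using gc_bound[OF y] by blast
  have "(\<lambda>n. lam (star (?y n) * ?x n)) \<longlonglongrightarrow> hinner (L2 lam) (cl x) (cl y)"
    using convergent_inner[OF rep_in_gc[OF x] rep_in_gc[OF y]] by (simp add: L2_def convergent_LIMSEQ_iff)
  moreover have "(\<lambda>n. lam (star (y n) * x n) - lam (star (?y n) * ?x n)) \<longlonglongrightarrow> 0"
  proof (rule Lim_null_comparison)
    have "norm (lam (star (y n) * x n) - lam (star (?y n) * ?x n)) \<le>
        B * sn (x n - ?x n) + sn (y n - ?y n) * A" for n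
      using A B by (intro order_trans[OF lam_diff_le] add_mono mult_mono) (auto simp: less_imp_le)
    then show "\<forall>\<^sub>F n in sequentially. norm (lam (star (y n) * x n) - lam (star (?y n) * ?x n)) \<le>
        B * sn (x n - ?x n) + sn (y n - ?y n) * A" by simp
    show "(\<lambda>n. B * sn (x n - ?x n) + sn (y n - ?y n) * A) \<longlonglongrightarrow> 0"
      by (intro tendsto_add_zero tendsto_mult_right_zero tendsto_mult_left_zero rep_lim x y)
  qed
  ultimately show ?thesis using tendsto_add by fastforce
qed

lemma inner_cl_eqI:
  assumes "x \<in> gc" "y \<in> gc" "(\<lambda>n. lam (star (y n) * x n)) \<longlonglongrightarrow> L"
  shows "hinner (L2 lam) (cl x) (cl y) = L"
  using LIMSEQ_unique[OF inner_lim[OF assms(1,2)] assms(3)] .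

lemma norm_lim:
  assumes x: "x \<in> gc"
  shows "(\<lambda>n. sn (x n)) \<longlonglongrightarrow> hnorm (L2 lam) (cl x)"
  using tendsto_real_sqrt[OF tendsto_Re[OF inner_lim[OF x x]]]
  by (simp add: hnorm_def sn_eq sq_def)

text \<open>Taken directly from limits of seminorms, since completeness needs it before
  \<open>L2 lam\<close> is known to be a \<open>hilbert\<close> space.\<close>

lemma hnorm_sub_triangle:
  assumes "x \<in> gc" "y \<in> gc" "z \<in> gc"
  shows "hnorm (L2 lam) (cl (\<lambda>n. x n - z n)) \<le>
    hnorm (L2 lam) (cl (\<lambda>n. x n - y n)) + hnorm (L2 lam) (cl (\<lambda>n. y n - z n))"
proof (rule LIMSEQ_le)
  show "(\<lambda>n. sn (x n - z n)) \<longlonglongrightarrow> hnorm (L2 lam) (cl (\<lambda>n. x n - z n))"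
    "(\<lambda>n. sn (x n - y n) + sn (y n - z n)) \<longlonglongrightarrow>
      hnorm (L2 lam) (cl (\<lambda>n. x n - y n)) + hnorm (L2 lam) (cl (\<lambda>n. y n - z n))"
    by (intro tendsto_add norm_lim gc_diff assms)+
qed (auto simp: sn_triangle_sub)

lemma hnorm_const: "hnorm (L2 lam) (cl (\<lambda>n. a)) = sn a"
  using LIMSEQ_unique[OF norm_lim[of "\<lambda>n. a"] tendsto_const] by simp

lemma dist_const_le:
  assumes "x \<in> gc" "\<And>n. n \<ge> N \<Longrightarrow> sn (x n - a) \<le> e"
  shows "hnorm (L2 lam) (cl (\<lambda>n. x n - a)) \<le> e"
  by (rule LIMSEQ_le_const2[OF norm_lim]) (use assms in auto)

lemma hnorm_sub_commute:
  assumes "x \<in> gc" "y \<in> gc"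
  shows "hnorm (L2 lam) (cl (\<lambda>n. x n - y n)) = hnorm (L2 lam) (cl (\<lambda>n. y n - x n))"
  using LIMSEQ_unique[OF norm_lim[OF gc_diff[OF assms]]] norm_lim[OF gc_diff[OF assms(2,1)]]
  by (simp add: sn_commute)

text \<open>Each \<open>X m\<close> is approximated within \<open>1 / (m + 1)\<close> by the class
  of a constant sequence with value \<open>a m\<close>. The sequence \<open>a\<close> is then itself
  Cauchy in the seminorm, and its class is the limit.\<close>

lemma L2_complete:
  assumes X: "\<And>m. X m \<in> hcarrier (L2 lam)"
    and cauchy: "\<And>e. e > 0 \<Longrightarrow> \<exists>N. \<forall>m\<ge>N. \<forall>n\<ge>N. hnorm (L2 lam) (hsub (L2 lam) (X m) (X n)) < e"
  shows "\<exists>x\<in>hcarrier (L2 lam). hlim (L2 lam) X x"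
proof -
  have "\<exists>x. x \<in> gc \<and> X m = cl x" for m using X carrier_cases by metis
  then obtain x where x: "\<And>m. x m \<in> gc" "\<And>m. X m = cl (x m)" by metis
  let ?d = "\<lambda>x y. hnorm (L2 lam) (cl (\<lambda>n. x n - y n))"
  have "\<exists>a. ?d (x m) (\<lambda>n. a) \<le> inverse (real (Suc m))" for m
  proof -
    obtain N where N: "\<forall>k\<ge>N. \<forall>n\<ge>N. sn (x m k - x m n) < inverse (real (Suc m))"
      using gcD[OF x(1), of "inverse (real (Suc m))" m] by auto
    show ?thesis by (rule exI[of _ "x m N"], rule dist_const_le[OF x(1), of N]) (use N in \<open>auto simp: less_imp_le\<close>)
  qed
  then obtain a where a: "\<And>m. ?d (x m) (\<lambda>n. a m) \<le> inverse (real (Suc m))" by metis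
  have inv: "\<exists>N. \<forall>m\<ge>N. inverse (real (Suc m)) < e" if "e > 0" for e
    using LIMSEQ_D[OF LIMSEQ_inverse_real_of_nat that] by auto
  have agc: "a \<in> gc"
  proof (rule gcI)
    fix e :: real assume "0 < e"
    obtain N where N: "\<forall>m\<ge>N. inverse (real (Suc m)) < e / 3" using inv[of "e / 3"] \<open>0 < e\<close> by auto
    obtain M where M: "\<forall>m\<ge>M. \<forall>n\<ge>M. hnorm (L2 lam) (hsub (L2 lam) (X m) (X n)) < e / 3"
      using cauchy[of "e / 3"] \<open>0 < e\<close> by auto
    have "sn (a m - a n) < e" if "m \<ge> max N M" "n \<ge> max N M" for m n
    proof -
      have "sn (a m - a n) = ?d (\<lambda>k. a m) (\<lambda>k. a n)" by (simp add: hnorm_const)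
      also have "\<dots> \<le> ?d (\<lambda>k. a m) (x m) + ?d (x m) (\<lambda>k. a n)"
        by (rule hnorm_sub_triangle) (simp_all add: x)
      also have "?d (x m) (\<lambda>k. a n) \<le> ?d (x m) (x n) + ?d (x n) (\<lambda>k. a n)"
        by (rule hnorm_sub_triangle) (simp_all add: x)
      also have "?d (\<lambda>k. a m) (x m) = ?d (x m) (\<lambda>k. a m)" by (rule hnorm_sub_commute) (simp_all add: x)
      finally have "sn (a m - a n) \<le> ?d (x m) (\<lambda>k. a m) + (?d (x m) (x n) + ?d (x n) (\<lambda>k. a n))" by simp
      moreover have "?d (x m) (x n) < e / 3" using M that x by simp
      moreover have "inverse (real (Suc m)) < e / 3" "inverse (real (Suc n)) < e / 3" using N that by auto
      ultimately show ?thesis using a[of m] a[of n] by linarith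
    qed
    then show "\<exists>N. \<forall>m\<ge>N. \<forall>n\<ge>N. sn (a m - a n) < e" by blast
  qed
  have "hlim (L2 lam) X (cl a)"
    unfolding hlim_def
  proof (rule LIMSEQ_I)
    fix e :: real assume "0 < e"
    obtain N where N: "\<forall>m\<ge>N. inverse (real (Suc m)) < e / 3" using inv[of "e / 3"] \<open>0 < e\<close> by auto
    obtain M where M: "\<forall>m\<ge>M. \<forall>n\<ge>M. sn (a m - a n) < e / 3" using gcD[OF agc, of "e / 3"] \<open>0 < e\<close> by auto
    have "norm (hnorm (L2 lam) (hsub (L2 lam) (X m) (cl a)) - 0) < e" if "m \<ge> max N M" for m
    proof -
      have "?d (\<lambda>n. a m) a = ?d a (\<lambda>n. a m)" by (rule hnorm_sub_commute) (simp_all add: agc)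
      also have "\<dots> \<le> e / 3"
        by (rule dist_const_le[OF agc, of M]) (use M that in \<open>auto simp: less_imp_le\<close>)
      finally have "?d (\<lambda>n. a m) a \<le> e / 3" .
      moreover have "?d (x m) a \<le> ?d (x m) (\<lambda>n. a m) + ?d (\<lambda>n. a m) a"
        by (rule hnorm_sub_triangle) (simp_all add: x agc)
      moreover have "inverse (real (Suc m)) < e / 3" using N that by auto
      ultimately have "?d (x m) a < e" using a[of m] \<open>0 < e\<close> by linarith
      moreover have "0 \<le> ?d (x m) a"
        by (rule LIMSEQ_le_const[OF norm_lim]) (auto simp: x agc)
      ultimately show ?thesis using x agc by simp
    qed
    then show "\<exists>N. \<forall>m\<ge>N. norm (hnorm (L2 lam) (hsub (L2 lam) (X m) (cl a)) - 0) < e" by blast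
  qed
  then show ?thesis using agc by blast
qed

lemma hilbert_L2: "hilbert (L2 lam)"
proof
  show "hcarrier (L2 lam) \<noteq> {}" using cl_in_carrier[OF const_in_gc[of 0]] by blast
next
  fix X Y assume "X \<in> hcarrier (L2 lam)" "Y \<in> hcarrier (L2 lam)"
  then show "hadd (L2 lam) X Y \<in> hcarrier (L2 lam)" by (auto elim!: carrier_cases)
next
  fix X c assume "X \<in> hcarrier (L2 lam)"
  then show "hscale (L2 lam) c X \<in> hcarrier (L2 lam)" by (auto elim!: carrier_cases)
next
  fix X Y Z assume "X \<in> hcarrier (L2 lam)" "Y \<in> hcarrier (L2 lam)" "Z \<in> hcarrier (L2 lam)"
  then obtain x y z where xyz: "x \<in> gc" "y \<in> gc" "z \<in> gc" "X = cl x" "Y = cl y" "Z = cl z"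
    by (metis carrier_cases)
  have "(\<lambda>n. lam (star (z n) * (x n + y n))) \<longlonglongrightarrow> hinner (L2 lam) X Z + hinner (L2 lam) Y Z"
    using tendsto_add[OF inner_lim[OF xyz(1,3)] inner_lim[OF xyz(2,3)]] xyz lam
    by (simp add: distrib_left plf_add)
  then show "hinner (L2 lam) (hadd (L2 lam) X Y) Z = hinner (L2 lam) X Z + hinner (L2 lam) Y Z"
    using xyz by (simp add: inner_cl_eqI)
next
  fix X Z c assume "X \<in> hcarrier (L2 lam)" "Z \<in> hcarrier (L2 lam)"
  then obtain x z where xz: "x \<in> gc" "z \<in> gc" "X = cl x" "Z = cl z"
    by (metis carrier_cases)
  have "(\<lambda>n. lam (star (z n) * (c *\<^sub>C x n))) \<longlonglongrightarrow> c * hinner (L2 lam) X Z"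
    using tendsto_mult_left[OF inner_lim[OF xz(1,2)], of c] xz lam
    by (simp add: mult_scaleC_right plf_scaleC)
  then show "hinner (L2 lam) (hscale (L2 lam) c X) Z = c * hinner (L2 lam) X Z"
    using xz by (simp add: inner_cl_eqI)
next
  fix X Y assume "X \<in> hcarrier (L2 lam)" "Y \<in> hcarrier (L2 lam)"
  then obtain x y where xy: "x \<in> gc" "y \<in> gc" "X = cl x" "Y = cl y"
    by (metis carrier_cases)
  have "(\<lambda>n. lam (star (x n) * y n)) \<longlonglongrightarrow> cnj (hinner (L2 lam) X Y)"
    using tendsto_cnj[OF inner_lim[OF xy(1,2)]] unfolding xy(3,4)
    by (simp only: plf_hermitian[OF lam, symmetric])
  then show "hinner (L2 lam) Y X = cnj (hinner (L2 lam) X Y)"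
    using xy by (simp add: inner_cl_eqI)
next
  fix X assume "X \<in> hcarrier (L2 lam)"
  then obtain x where x: "x \<in> gc" "X = cl x" by (metis carrier_cases)
  show "0 \<le> Re (hinner (L2 lam) X X)"
    using tendsto_Re[OF inner_lim[OF x(1) x(1)]] x sq_nonneg[OF lam]
    by (intro LIMSEQ_le_const[of "\<lambda>n. Re (lam (star (x n) * x n))"]) (auto simp flip: sq_def)
next
  fix X Y assume "X \<in> hcarrier (L2 lam)" "Y \<in> hcarrier (L2 lam)"
    and 0: "Re (hinner (L2 lam) (hsub (L2 lam) X Y) (hsub (L2 lam) X Y)) = 0"
  then obtain x y where xy: "x \<in> gc" "y \<in> gc" "X = cl x" "Y = cl y"
    by (metis carrier_cases)
  then show "X = Y" using norm_lim[OF gc_diff[OF xy(1,2)]] 0 by (simp add: cl_eq_iff hnorm_def)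
qed (rule L2_complete)

lemma star_rep_L2: "star_rep (L2 lam) (gns_pi lam)"
proof -
  interpret hilbert "L2 lam" by (rule hilbert_L2)
  show ?thesis
  proof
    fix X Y a assume "X \<in> hcarrier (L2 lam)" "Y \<in> hcarrier (L2 lam)"
    then obtain x y where xy: "x \<in> gc" "y \<in> gc" "X = cl x" "Y = cl y" by (metis carrier_cases)
    have "(\<lambda>n. lam (star (y n) * (a * x n))) \<longlonglongrightarrow> hinner (L2 lam) X (gns_pi lam (star a) Y)"
      using inner_lim[of x "\<lambda>n. star a * y n"] xy by (simp add: star_mult star_star mult.assoc)
    then show "hinner (L2 lam) (gns_pi lam a X) Y = hinner (L2 lam) X (gns_pi lam (star a) Y)"
      using xy by (simp add: inner_cl_eqI)
  qed (auto elim!: carrier_cases simp: distrib_left distrib_right mult_scaleC_left mult_scaleC_right mult.assoc)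
qed

definition \<xi> where "\<xi> = cl (\<lambda>n. 1)"

lemma xi_closed [simp]: "\<xi> \<in> hcarrier (L2 lam)"
  by (simp add: \<xi>_def)

lemma gns_pi_xi: "gns_pi lam a \<xi> = cl (\<lambda>n. a)"
  by (simp add: \<xi>_def)

lemma inner_gns_pi_xi: "hinner (L2 lam) (gns_pi lam a \<xi>) \<xi> = lam a"
  unfolding gns_pi_xi unfolding \<xi>_def by (rule inner_cl_eqI) auto

text \<open>Classes of constant sequences are the vectors \<open>gns_pi lam b \<xi>\<close>, and
  they come within any \<open>e\<close> of \<open>Y\<close>. Orthogonality gives
  \<open>(nrm Y)^2 = Re (ip (Y - z) Y) \<le> e nrm Y\<close> for such an approximant
  \<open>z\<close>.\<close>

lemma xi_cyclic:
  assumes Y: "Y \<in> hcarrier (L2 lam)" and 0: "\<And>b. hinner (L2 lam) (gns_pi lam b \<xi>) Y = 0"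
  shows "Y = hzero (L2 lam)"
proof -
  interpret hilbert "L2 lam" by (rule hilbert_L2)
  obtain y where y: "y \<in> gc" "Y = cl y" using Y by (metis carrier_cases)
  have le: "hnorm (L2 lam) Y \<le> e" if e: "e > 0" for e
  proof -
    obtain N where N: "\<forall>m\<ge>N. \<forall>n\<ge>N. sn (y m - y n) < e" using gcD[OF y(1) e] by blast
    have *: "hnorm (L2 lam) (hsub (L2 lam) Y (cl (\<lambda>n. y N))) \<le> e"
      using dist_const_le[OF y(1), of N "y N" e] N y by (simp add: less_imp_le)
    have "(hnorm (L2 lam) Y)\<^sup>2 = Re (hinner (L2 lam) (hsub (L2 lam) Y (cl (\<lambda>n. y N))) Y)"
      using Y 0[of "y N"] by (simp add: norm_sq gns_pi_xi)
    also have "\<dots> \<le> cmod (ip (hsub (L2 lam) Y (cl (\<lambda>n. y N))) Y)" by (rule complex_Re_le_cmod)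
    also have "\<dots> \<le> nrm (hsub (L2 lam) Y (cl (\<lambda>n. y N))) * nrm Y"
      by (rule Cauchy_Schwarz) (use Y in auto)
    also have "\<dots> \<le> e * hnorm (L2 lam) Y" using * Y by (intro mult_right_mono) auto
    finally show ?thesis
      using Y that by (cases "hnorm (L2 lam) Y = 0") (auto simp: power2_eq_square mult_le_cancel_right less_le)
  qed
  have "hnorm (L2 lam) Y \<le> 0" by (rule field_le_epsilon) (use le in simp)
  then have "nrm Y = 0" using nrm_nonneg[OF Y] by simp
  then have "nrm (hsub (L2 lam) Y (hzero (L2 lam))) = 0"
    using Y nrm_sub_sq[of Y "hzero (L2 lam)"] by simp
  then show ?thesis using Y by (intro eqI_nrm) auto
qed

end

section \<open>A Hahn-Banach theorem on spaces of real functions\<close>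

text \<open>Vectors are real functions with pointwise operations, so a space is just a set of
  functions. Only one inequality of positive homogeneity is demanded, which is the one checked for
  infima; equality is \<open>sublinear_scale\<close>.\<close>

definition sublinear_on :: "('x \<Rightarrow> real) set \<Rightarrow> (('x \<Rightarrow> real) \<Rightarrow> real) \<Rightarrow> bool" where
  "sublinear_on V q \<longleftrightarrow>
     (\<forall>f\<in>V. \<forall>g\<in>V. q (\<lambda>x. f x + g x) \<le> q f + q g) \<and> (\<forall>f\<in>V. \<forall>t\<ge>0. q (\<lambda>x. t * f x) \<le> t * q f)"

lemma sublinear_add_le:
  "sublinear_on V q \<Longrightarrow> f \<in> V \<Longrightarrow> g \<in> V \<Longrightarrow> q (\<lambda>x. f x + g x) \<le> q f + q g"
  by (simp add: sublinear_on_def)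

lemma sublinear_scale_le:
  "sublinear_on V q \<Longrightarrow> f \<in> V \<Longrightarrow> 0 \<le> t \<Longrightarrow> q (\<lambda>x. t * f x) \<le> t * q f"
  by (simp add: sublinear_on_def)

locale function_space =
  fixes V :: "('x \<Rightarrow> real) set"
  assumes V_nonempty: "V \<noteq> {}"
    and V_add [simp]: "f \<in> V \<Longrightarrow> g \<in> V \<Longrightarrow> (\<lambda>x. f x + g x) \<in> V"
    and V_scale [simp]: "f \<in> V \<Longrightarrow> (\<lambda>x. t * f x) \<in> V"
begin

lemma V_zero [simp]: "(\<lambda>x. 0) \<in> V"
  using V_nonempty V_scale[of _ 0] by auto

lemma V_minus [simp]: "f \<in> V \<Longrightarrow> (\<lambda>x. - f x) \<in> V"
  using V_scale[of f "-1"] by simp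

lemma sublinear_zero:
  assumes "sublinear_on V q"
  shows "q (\<lambda>x. 0) = 0"
proof (rule antisym)
  have "q (\<lambda>x. 0 * 0) \<le> 0 * q (\<lambda>x. 0)" by (rule sublinear_scale_le[OF assms V_zero]) simp
  then show "q (\<lambda>x. 0) \<le> 0" by simp
  have "q (\<lambda>x. 0 + 0) \<le> q (\<lambda>x. 0) + q (\<lambda>x. 0)" by (rule sublinear_add_le[OF assms V_zero V_zero])
  then show "0 \<le> q (\<lambda>x. 0)" by simp
qed

lemma sublinear_minus:
  assumes "sublinear_on V q" "f \<in> V"
  shows "- q (\<lambda>x. - f x) \<le> q f"
proof -
  have "q (\<lambda>x. f x + - f x) \<le> q f + q (\<lambda>x. - f x)"
    by (rule sublinear_add_le[OF assms V_minus[OF assms(2)]])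
  then show ?thesis using sublinear_zero[OF assms(1)] by simp
qed

lemma sublinear_scale:
  assumes q: "sublinear_on V q" and f: "f \<in> V" and t: "0 \<le> t"
  shows "q (\<lambda>x. t * f x) = t * q f"
proof (cases "t = 0")
  case True
  then show ?thesis using sublinear_zero[OF q] by simp
next
  case False
  have "q (\<lambda>x. (1 / t) * (t * f x)) \<le> (1 / t) * q (\<lambda>x. t * f x)"
    by (rule sublinear_scale_le[OF q V_scale[OF f]]) (use t in simp)
  then have "t * q f \<le> q (\<lambda>x. t * f x)"
    using False t by (simp add: field_simps)
  moreover have "q (\<lambda>x. t * f x) \<le> t * q f" by (rule sublinear_scale_le[OF q f t])
  ultimately show ?thesis by simp
qed

text \<open>Zorn's lemma downwards: a chain has its pointwise infimum as lower bound, which is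
  finite because every \<open>q\<close> below \<open>p\<close> satisfies
  \<open>- p (- f) \<le> q f\<close>.\<close>

lemma minimal_sublinear:
  assumes p: "sublinear_on V p"
  obtains q where "sublinear_on V q" "\<And>f. f \<in> V \<Longrightarrow> q f \<le> p f"
    "\<And>r. sublinear_on V r \<Longrightarrow> (\<And>f. f \<in> V \<Longrightarrow> r f \<le> q f) \<Longrightarrow> \<forall>f\<in>V. r f = q f"
proof -
  \<comment> \<open>Values off \<open>V\<close> are fixed to 0, so that comparing everywhere amounts
    to comparing on \<open>V\<close>; \<open>P\<close> is the reversed order, which makes a maximal
    element a minimal functional.\<close>
  define S where "S = {q. sublinear_on V q \<and> (\<forall>f\<in>V. q f \<le> p f) \<and> (\<forall>f. f \<notin> V \<longrightarrow> q f = 0)}"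
  define P :: "(('x \<Rightarrow> real) \<Rightarrow> real) \<Rightarrow> (('x \<Rightarrow> real) \<Rightarrow> real) \<Rightarrow> bool" where "P q r \<longleftrightarrow> (\<forall>f. r f \<le> q f)" for q r
  have restr: "sublinear_on V (\<lambda>f. if f \<in> V then q f else 0) \<longleftrightarrow> sublinear_on V q" for q
    by (simp add: sublinear_on_def)
  have "\<exists>m\<in>S. \<forall>a\<in>S. P m a \<longrightarrow> a = m"
  proof (rule predicate_Zorn)
    show "partial_order_on S (relation_of P S)"
      by (rule partial_order_on_relation_ofI) (auto simp: P_def fun_eq_iff intro: order_trans antisym)
    fix c assume c: "c \<in> Chains (relation_of P S)"
    then have cS: "c \<subseteq> S" and ch: "\<And>q r. q \<in> c \<Longrightarrow> r \<in> c \<Longrightarrow> P q r \<or> P r q"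
      by (auto simp: Chains_def relation_of_def)
    show "\<exists>u\<in>S. \<forall>a\<in>c. P a u"
    proof (cases "c = {}")
      case True
      have "(\<lambda>f. if f \<in> V then p f else 0) \<in> S" using p restr by (simp add: S_def)
      then show ?thesis using True by blast
    next
      case False
      define u where "u f = (if f \<in> V then INF q\<in>c. q f else 0)" for f
      have bdd: "bdd_below ((\<lambda>q. q f) ` c)" if "f \<in> V" for f
      proof (rule bdd_belowI2)
        fix q assume "q \<in> c"
        then have "q \<in> S" using cS by blast
        then show "- p (\<lambda>x. - f x) \<le> q f"
          using sublinear_minus[of q f] that by (auto simp: S_def intro: order_trans[rotated])
      qed
      have lower: "u f \<le> q f" if "q \<in> c" for q f
      proof (cases "f \<in> V")
        case True
        then show ?thesis using that bdd by (auto simp: u_def intro: cINF_lower)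
      next
        case False
        then show ?thesis using that cS by (auto simp: u_def S_def)
      qed
      have greatest: "B \<le> u f" if "f \<in> V" "\<And>q. q \<in> c \<Longrightarrow> B \<le> q f" for B f
        unfolding u_def using that False by (auto intro: cINF_greatest)
      have "sublinear_on V u"
        unfolding sublinear_on_def
      proof (intro conjI ballI allI impI)
        fix f g assume f: "f \<in> V" and g: "g \<in> V"
        \<comment> \<open>The smaller one of \<open>q\<close> and \<open>r\<close> serves for both
          arguments; this is where the chain condition enters.\<close>
        have *: "u (\<lambda>x. f x + g x) \<le> q f + r g" if qr: "q \<in> c" "r \<in> c" for q r
        proof -
          obtain s where s: "s \<in> c" "s f \<le> q f" "s g \<le> r g"
            using ch[OF qr] qr by (auto simp: P_def)
          have "u (\<lambda>x. f x + g x) \<le> s (\<lambda>x. f x + g x)" by (rule lower[OF s(1)])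
          also have "\<dots> \<le> s f + s g" using s(1) cS f g by (auto simp: S_def sublinear_on_def)
          finally show ?thesis using s by linarith
        qed
        have "u (\<lambda>x. f x + g x) - r g \<le> u f" if "r \<in> c" for r
          using *[OF _ that] by (intro greatest[OF f]) (simp add: algebra_simps)
        then have "u (\<lambda>x. f x + g x) - u f \<le> u g"
          by (intro greatest[OF g]) (simp add: algebra_simps)
        then show "u (\<lambda>x. f x + g x) \<le> u f + u g" by simp
      next
        fix f and t :: real assume f: "f \<in> V" and t: "0 \<le> t"
        show "u (\<lambda>x. t * f x) \<le> t * u f"
        proof (cases "t = 0")
          case True
          obtain q where "q \<in> c" using False by blast
          then show ?thesis using lower[of q "\<lambda>x. 0"] cS sublinear_zero[of q] True by (auto simp: S_def)
        next
          case nz: False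
          have "(1 / t) * u (\<lambda>x. t * f x) \<le> u f"
          proof (rule greatest[OF f])
            fix q assume q: "q \<in> c"
            have "u (\<lambda>x. t * f x) \<le> q (\<lambda>x. t * f x)" by (rule lower[OF q])
            also have "\<dots> \<le> t * q f" using q cS f t by (auto simp: S_def sublinear_on_def)
            finally show "(1 / t) * u (\<lambda>x. t * f x) \<le> q f" using nz t by (simp add: field_simps)
          qed
          then show ?thesis using nz t by (simp add: field_simps)
        qed
      qed
      moreover have "\<forall>f\<in>V. u f \<le> p f"
      proof
        fix f assume "f \<in> V"
        obtain q where "q \<in> c" using False by blast
        then show "u f \<le> p f" using lower[of q f] cS \<open>f \<in> V\<close> by (force simp: S_def)
      qed
      ultimately have "u \<in> S" by (simp add: S_def u_def)
      then show ?thesis using lower by (auto simp: P_def)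
    qed
  qed
  then obtain m where m: "m \<in> S" "\<And>a. a \<in> S \<Longrightarrow> P m a \<Longrightarrow> a = m" by blast
  show thesis
  proof (rule that[of m])
    fix r assume r: "sublinear_on V r" "\<And>f. f \<in> V \<Longrightarrow> r f \<le> m f"
    let ?r = "\<lambda>f. if f \<in> V then r f else 0"
    have "?r \<in> S" using r m(1) restr[of r] by (auto simp: S_def intro: order_trans)
    moreover have "P m ?r" using r m(1) by (auto simp: P_def S_def)
    ultimately have eq: "?r = m" using m(2) by blast
    show "\<forall>f\<in>V. r f = m f"
    proof
      fix f assume "f \<in> V"
      then show "r f = m f" using fun_cong[OF eq, of f] by simp
    qed
  qed (use m in \<open>auto simp: S_def\<close>)
qed

text \<open>The infimum \<open>r f\<close> of \<open>q (f + t x) - t q x\<close> over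
  \<open>t \<ge> 0\<close> is sublinear and below \<open>q\<close>, hence equal to \<open>q\<close>
  by minimality; its bound at \<open>t = 1\<close> gives
  \<open>q y + q x \<le> q (y + x)\<close>.\<close>

lemma minimal_sublinear_additive:
  assumes q: "sublinear_on V q"
    and min: "\<And>r. sublinear_on V r \<Longrightarrow> (\<And>f. f \<in> V \<Longrightarrow> r f \<le> q f) \<Longrightarrow> \<forall>f\<in>V. r f = q f"
    and x: "x \<in> V" and y: "y \<in> V"
  shows "q (\<lambda>a. y a + x a) = q y + q x"
proof -
  define h where "h f t = q (\<lambda>a. f a + t * x a) - t * q x" for f t
  define r where "r f = (INF t\<in>{0..}. h f t)" for f
  have add: "q (\<lambda>a. f a + g a) \<le> q f + q g" if "f \<in> V" "g \<in> V" for f g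
    by (rule sublinear_add_le[OF q that])
  have lb: "- q (\<lambda>a. - f a) \<le> h f t" if "f \<in> V" "t \<ge> 0" for f t
  proof -
    have "q (\<lambda>a. (f a + t * x a) + - f a) \<le> q (\<lambda>a. f a + t * x a) + q (\<lambda>a. - f a)"
      by (intro add) (use that x in auto)
    then show ?thesis using sublinear_scale[OF q x that(2)] by (simp add: h_def)
  qed
  have lower: "r f \<le> h f t" if "f \<in> V" "t \<ge> 0" for f t
    unfolding r_def using that lb[OF that(1)] by (intro cINF_lower bdd_belowI2) auto
  have greatest: "B \<le> r f" if "\<And>t. t \<ge> 0 \<Longrightarrow> B \<le> h f t" for f B
    unfolding r_def using that by (intro cINF_greatest) auto
  have "sublinear_on V r"
    unfolding sublinear_on_def
  proof (intro conjI ballI allI impI)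
    fix f g assume f: "f \<in> V" and g: "g \<in> V"
    have *: "r (\<lambda>a. f a + g a) \<le> h f s + h g t" if "s \<ge> 0" "t \<ge> 0" for s t
    proof -
      have "r (\<lambda>a. f a + g a) \<le> h (\<lambda>a. f a + g a) (s + t)" using f g that by (intro lower) auto
      also have "\<dots> = q (\<lambda>a. (f a + s * x a) + (g a + t * x a)) - (s + t) * q x"
        by (simp add: h_def algebra_simps)
      also have "\<dots> \<le> q (\<lambda>a. f a + s * x a) + q (\<lambda>a. g a + t * x a) - (s + t) * q x"
        using add[of "\<lambda>a. f a + s * x a" "\<lambda>a. g a + t * x a"] f g x by simp
      finally show ?thesis by (simp add: h_def algebra_simps)
    qed
    have "r (\<lambda>a. f a + g a) - h g t \<le> r f" if "t \<ge> 0" for t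
      using *[OF _ that] by (intro greatest) (simp add: algebra_simps)
    then have "r (\<lambda>a. f a + g a) - r f \<le> r g"
      by (intro greatest) (simp add: algebra_simps)
    then show "r (\<lambda>a. f a + g a) \<le> r f + r g" by simp
  next
    fix f and t :: real assume f: "f \<in> V" and t: "0 \<le> t"
    show "r (\<lambda>a. t * f a) \<le> t * r f"
    proof (cases "t = 0")
      case True
      then show ?thesis using lower[of "\<lambda>a. 0" 0] sublinear_zero[OF q] by (simp add: h_def)
    next
      case False
      then have t: "t > 0" using t by simp
      have "(1 / t) * r (\<lambda>a. t * f a) \<le> r f"
      proof (rule greatest)
        fix s :: real assume s: "s \<ge> 0"
        have "r (\<lambda>a. t * f a) \<le> h (\<lambda>a. t * f a) (t * s)" using f s t by (intro lower) auto
        also have "\<dots> = q (\<lambda>a. t * (f a + s * x a)) - t * s * q x" by (simp add: h_def algebra_simps)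
        also have "\<dots> = t * h f s"
          using sublinear_scale[OF q, of "\<lambda>a. f a + s * x a" t] f x t by (simp add: h_def algebra_simps)
        finally show "(1 / t) * r (\<lambda>a. t * f a) \<le> h f s" using t by (simp add: field_simps)
      qed
      then show ?thesis using t by (simp add: field_simps)
    qed
  qed
  moreover have "r f \<le> q f" if "f \<in> V" for f
    using lower[OF that, of 0] by (simp add: h_def)
  ultimately have "r y = q y" using min y by blast
  moreover have "r y \<le> q (\<lambda>a. y a + x a) - q x" using lower[OF y, of 1] by (simp add: h_def)
  ultimately show ?thesis using add[OF y x] by simp
qed

theorem Hahn_Banach_sublinear:
  assumes "sublinear_on V p"
  obtains F where "\<And>f g. f \<in> V \<Longrightarrow> g \<in> V \<Longrightarrow> F (\<lambda>x. f x + g x) = F f + F g"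
    "\<And>f t. f \<in> V \<Longrightarrow> F (\<lambda>x. t * f x) = t * F f" "\<And>f. f \<in> V \<Longrightarrow> F f \<le> p f"
proof -
  obtain q where q: "sublinear_on V q" "\<And>f. f \<in> V \<Longrightarrow> q f \<le> p f"
    "\<And>r. sublinear_on V r \<Longrightarrow> (\<And>f. f \<in> V \<Longrightarrow> r f \<le> q f) \<Longrightarrow> \<forall>f\<in>V. r f = q f"
    using minimal_sublinear[OF assms] by blast
  have add: "q (\<lambda>x. f x + g x) = q f + q g" if "f \<in> V" "g \<in> V" for f g
    by (rule minimal_sublinear_additive[OF q(1,3)]) (use that in auto)
  have minus: "q (\<lambda>x. - f x) = - q f" if "f \<in> V" for f
    using add[OF that V_minus[OF that]] sublinear_zero[OF q(1)] by simp
  have "q (\<lambda>x. t * f x) = t * q f" if "f \<in> V" for f t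
  proof (cases "t \<ge> 0")
    case True
    then show ?thesis using sublinear_scale[OF q(1) that] by blast
  next
    case False
    then have "q (\<lambda>x. (- t) * f x) = (- t) * q f" by (intro sublinear_scale[OF q(1) that]) simp
    then show ?thesis using minus[of "\<lambda>x. t * f x"] that by simp
  qed
  with add q(2) that show thesis by blast
qed

end

section \<open>Extension to the double commutant\<close>

context gns
begin

text \<open>It is enough to test the operator on the vectors \<open>gns_pi lam b \<xi>\<close>,
  where its form takes the values \<open>lam (star b * a * b)\<close>.\<close>

lemma selfadjoint_nonneg:
  assumes \<theta>: "plf \<theta>" "null_ideal lam \<subseteq> null_ideal \<theta>" and a: "star a = a"
    and pos: "\<And>x. x \<in> hcarrier (L2 lam) \<Longrightarrow> 0 \<le> Re (hinner (L2 lam) (gns_pi lam a x) x)"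
  shows "0 \<le> Re (\<theta> a)"
proof (rule plf_nonneg_of_null_ideal[OF lam \<theta> a])
  interpret R: star_rep "L2 lam" "gns_pi lam" by (rule star_rep_L2)
  fix b
  have "R.ip (gns_pi lam a (gns_pi lam b \<xi>)) (gns_pi lam b \<xi>) = lam (star b * a * b)"
    by (simp add: R.pi_mult[symmetric] R.pi_star' mult.assoc flip: inner_gns_pi_xi)
  then show "0 \<le> Re (lam (star b * a * b))" using pos[of "gns_pi lam b \<xi>"] by simp
qed

lemma gns_pi_bounded: "gns_pi lam a \<in> bounded_ops (L2 lam)"
proof -
  interpret R: star_rep "L2 lam" "gns_pi lam" by (rule star_rep_L2)
  show ?thesis
    by (rule R.bounded_opsI[where K = "norm a"])
       (auto simp: R.pi_add_vec R.pi_scale_vec R.nrm_pi_le, simp add: gns_pi_def)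
qed

text \<open>An operator enters through the real and imaginary parts of its quadratic form, so
  Hahn-Banach works with real functions of the vector. The sublinear \<open>p\<close> is the infimum
  of \<open>\<theta>\<close> over self-adjoint elements whose form lies above the given function;
  multiples of \<open>1\<close> provide such elements and \<open>selfadjoint_nonneg\<close> keeps
  the infimum finite. A linear \<open>F \<le> p\<close> is automatically positive and agrees with
  \<open>\<theta>\<close> on \<open>A\<close>.\<close>

lemma extension_exists:
  assumes \<theta>: "plf \<theta>" "null_ideal lam \<subseteq> null_ideal \<theta>"
  shows "\<exists>f. extends_to_Linf lam \<theta> f"
proof -
  interpret R: star_rep "L2 lam" "gns_pi lam" by (rule star_rep_L2)
  let ?g = "\<lambda>a x. Re (R.ip (gns_pi lam a x) x)"
  define V where "V = {g. \<exists>K. \<forall>x\<in>R.C. \<bar>g x\<bar> \<le> K * (R.nrm x)\<^sup>2}"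
  interpret function_space V
  proof
    show "V \<noteq> {}" by (auto simp: V_def intro!: exI[of _ "\<lambda>x. 0"] exI[of _ 0])
    fix f g assume "f \<in> V" "g \<in> V"
    then obtain K L where "\<forall>x\<in>R.C. \<bar>f x\<bar> \<le> K * (R.nrm x)\<^sup>2" "\<forall>x\<in>R.C. \<bar>g x\<bar> \<le> L * (R.nrm x)\<^sup>2"
      by (auto simp: V_def)
    then have "\<forall>x\<in>R.C. \<bar>f x + g x\<bar> \<le> (K + L) * (R.nrm x)\<^sup>2" by (fastforce simp: distrib_right)
    then show "(\<lambda>x. f x + g x) \<in> V" by (auto simp: V_def)
  next
    fix f t assume "f \<in> V"
    then obtain K where "\<forall>x\<in>R.C. \<bar>f x\<bar> \<le> K * (R.nrm x)\<^sup>2" by (auto simp: V_def)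
    then have "\<forall>x\<in>R.C. \<bar>t * f x\<bar> \<le> (\<bar>t\<bar> * K) * (R.nrm x)\<^sup>2"
      by (auto simp: abs_mult mult.assoc intro: mult_left_mono)
    then show "(\<lambda>x. t * f x) \<in> V" by (auto simp: V_def)
  qed
  define A where "A g = {a. star a = a \<and> (\<forall>x\<in>R.C. g x \<le> ?g a x)}" for g
  define p where "p g = (INF a\<in>A g. Re (\<theta> a))" for g
  have g_scaleR: "?g (t *\<^sub>R a) x = t * ?g a x" and g_add: "?g (a + b) x = ?g a x + ?g b x" if "x \<in> R.C" for t a b x
    using that by (simp_all add: R.pi_scaleC R.pi_add flip: scaleC_of_real)
  have g_one: "?g (K *\<^sub>R 1) x = K * (R.nrm x)\<^sup>2" if "x \<in> R.C" for K x
    using that by (simp add: g_scaleR R.norm_sq)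
  have ne: "A g \<noteq> {}" if g: "g \<in> V" for g
  proof -
    obtain K where "\<forall>x\<in>R.C. \<bar>g x\<bar> \<le> K * (R.nrm x)\<^sup>2" using g by (auto simp: V_def)
    then have "K *\<^sub>R 1 \<in> A g" by (auto simp: A_def star_scaleR g_one)
    then show ?thesis by blast
  qed
  have bdd: "bdd_below ((\<lambda>a. Re (\<theta> a)) ` A g)" if g: "g \<in> V" for g
  proof -
    obtain K where K: "\<forall>x\<in>R.C. \<bar>g x\<bar> \<le> K * (R.nrm x)\<^sup>2" using g by (auto simp: V_def)
    \<comment> \<open>The form of \<open>a + K\<close> is nonnegative because that of
      \<open>a\<close> lies above \<open>g\<close>, which is at least
      \<open>- K (nrm x)^2\<close>.\<close>
    have "- K * Re (\<theta> 1) \<le> Re (\<theta> a)" if "a \<in> A g" for a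
    proof -
      have "0 \<le> Re (\<theta> (a + K *\<^sub>R 1))"
      proof (rule selfadjoint_nonneg[OF \<theta>])
        show "star (a + K *\<^sub>R 1) = a + K *\<^sub>R 1" using that by (simp add: A_def star_add star_scaleR)
        fix x assume x: "x \<in> R.C"
        then have "g x \<le> ?g a x" "\<bar>g x\<bar> \<le> K * (R.nrm x)\<^sup>2" using that K by (auto simp: A_def)
        then show "0 \<le> ?g (a + K *\<^sub>R 1) x" using x by (simp only: g_add g_one)
      qed
      then show ?thesis using \<theta> by (simp add: plf_simps)
    qed
    then show ?thesis by (rule bdd_belowI2)
  qed
  have p_le: "p g \<le> Re (\<theta> a)" if "g \<in> V" "a \<in> A g" for g a
    unfolding p_def using bdd[OF that(1)] that(2) by (intro cINF_lower)
  have p_ge: "B \<le> p g" if "g \<in> V" "\<And>a. a \<in> A g \<Longrightarrow> B \<le> Re (\<theta> a)" for B g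
    unfolding p_def using ne[OF that(1)] that(2) by (intro cINF_greatest)
  have "sublinear_on V p"
    unfolding sublinear_on_def
  proof (intro conjI ballI allI impI)
    fix f g assume f: "f \<in> V" and g: "g \<in> V"
    have *: "p (\<lambda>x. f x + g x) \<le> Re (\<theta> a) + Re (\<theta> b)" if "a \<in> A f" "b \<in> A g" for a b
    proof -
      have "a + b \<in> A (\<lambda>x. f x + g x)" using that by (auto simp: A_def star_add R.pi_add intro: add_mono)
      from p_le[OF V_add[OF f g] this] show ?thesis using \<theta> by (simp add: plf_simps)
    qed
    have "p (\<lambda>x. f x + g x) - Re (\<theta> b) \<le> p f" if "b \<in> A g" for b
      using *[OF _ that] by (intro p_ge[OF f]) (simp add: algebra_simps)
    then have "p (\<lambda>x. f x + g x) - p f \<le> p g" by (intro p_ge[OF g]) (simp add: algebra_simps)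
    then show "p (\<lambda>x. f x + g x) \<le> p f + p g" by simp
  next
    fix f and t :: real assume f: "f \<in> V" and t: "0 \<le> t"
    have *: "p (\<lambda>x. t * f x) \<le> t * Re (\<theta> a)" if "a \<in> A f" for a
    proof -
      have "t *\<^sub>R a \<in> A (\<lambda>x. t * f x)"
        using that t by (auto simp: A_def star_scaleR g_scaleR intro: mult_left_mono)
      from p_le[OF V_scale[OF f] this] show ?thesis using \<theta> by (simp add: plf_simps)
    qed
    show "p (\<lambda>x. t * f x) \<le> t * p f"
    proof (cases "t = 0")
      case True
      then show ?thesis using * ne[OF f] by auto
    next
      case False
      have "(1 / t) * p (\<lambda>x. t * f x) \<le> p f"
        using * False t by (intro p_ge[OF f]) (simp add: field_simps)
      then show ?thesis using False t by (simp add: field_simps)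
    qed
  qed
  then obtain F where F_add: "\<And>f g. f \<in> V \<Longrightarrow> g \<in> V \<Longrightarrow> F (\<lambda>x. f x + g x) = F f + F g"
    and F_scale: "\<And>f t. f \<in> V \<Longrightarrow> F (\<lambda>x. t * f x) = t * F f" and F_le: "\<And>f. f \<in> V \<Longrightarrow> F f \<le> p f"
    using Hahn_Banach_sublinear by blast
  have F_upper: "F g \<le> Re (\<theta> a)" if "g \<in> V" "star a = a" "\<And>x. x \<in> R.C \<Longrightarrow> g x \<le> ?g a x" for g a
    using F_le[OF that(1)] p_le[OF that(1), of a] that by (auto simp: A_def)
  have F_minus: "F (\<lambda>x. - f x) = - F f" if "f \<in> V" for f
    using F_scale[OF that, of "-1"] by simp
  \<comment> \<open>For \<open>g \<ge> 0\<close> the element 0 lies above \<open>- g\<close>, so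
    \<open>F (- g) \<le> \<theta> 0 = 0\<close>.\<close>
  have F_nonneg: "0 \<le> F g" if "g \<in> V" "\<And>x. x \<in> R.C \<Longrightarrow> 0 \<le> g x" for g
    using F_upper[of "\<lambda>x. - g x" 0] that \<theta> F_minus[OF that(1)] by (simp add: plf_simps R.pi_zero)
  have F_eq: "F g = Re (\<theta> a)" if g: "g \<in> V" and a: "star a = a" "\<And>x. x \<in> R.C \<Longrightarrow> g x = ?g a x" for g a
  proof (rule antisym)
    show "F g \<le> Re (\<theta> a)" by (rule F_upper) (use g a in auto)
    have "F (\<lambda>x. - g x) \<le> Re (\<theta> (- a))"
      using g a g_scaleR[of _ "-1" a] by (intro F_upper) (auto simp: star_minus)
    then show "Re (\<theta> a) \<le> F g" using F_minus[OF g] \<theta> by (simp add: plf_simps)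
  qed
  \<comment> \<open>Set to 0 off the carrier, so that identities between forms hold as equalities of
    functions.\<close>
  define QR where "QR T x = (if x \<in> R.C then Re (R.ip (T x) x) else 0)" for T x
  define QI where "QI T x = (if x \<in> R.C then Im (R.ip (T x) x) else 0)" for T x
  have Q_V: "QR T \<in> V" "QI T \<in> V" if T: "T \<in> bounded_ops (L2 lam)" for T
  proof -
    obtain K where K: "K \<ge> 0" "\<And>x. x \<in> R.C \<Longrightarrow> R.nrm (T x) \<le> K * R.nrm x"
      using R.bounded_ops_bound[OF T] by blast
    have "cmod (R.ip (T x) x) \<le> K * (R.nrm x)\<^sup>2" if x: "x \<in> R.C" for x
    proof -
      have "cmod (R.ip (T x) x) \<le> R.nrm (T x) * R.nrm x"
        using x R.bounded_opsD[OF T] by (intro R.Cauchy_Schwarz) auto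
      also have "\<dots> \<le> (K * R.nrm x) * R.nrm x" using K x by (intro mult_right_mono) auto
      finally show ?thesis by (simp add: power2_eq_square mult.assoc)
    qed
    then have "\<forall>x\<in>R.C. \<bar>QR T x\<bar> \<le> K * (R.nrm x)\<^sup>2" "\<forall>x\<in>R.C. \<bar>QI T x\<bar> \<le> K * (R.nrm x)\<^sup>2"
      using abs_Re_le_cmod abs_Im_le_cmod order_trans by (auto simp: QR_def QI_def) blast+
    then show "QR T \<in> V" "QI T \<in> V" by (auto simp: V_def)
  qed
  define f where "f T = Complex (F (QR T)) (F (QI T))" for T
  have Linf_bounded: "T \<in> bounded_ops (L2 lam)" if "T \<in> Linf lam" for T
    using that by (auto simp: Linf_def commutant_def)
  have "op_plf (L2 lam) (Linf lam) f"
    unfolding op_plf_def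
  proof (intro conjI ballI allI)
    fix S T assume "S \<in> Linf lam" "T \<in> Linf lam"
    then have ST: "S \<in> bounded_ops (L2 lam)" "T \<in> bounded_ops (L2 lam)" by (auto intro: Linf_bounded)
    have "QR (op_add (L2 lam) S T) = (\<lambda>x. QR S x + QR T x)" "QI (op_add (L2 lam) S T) = (\<lambda>x. QI S x + QI T x)"
      using R.bounded_opsD[OF ST(1)] R.bounded_opsD[OF ST(2)] by (auto simp: QR_def QI_def fun_eq_iff)
    then show "f (op_add (L2 lam) S T) = f S + f T"
      using Q_V[OF ST(1)] Q_V[OF ST(2)] by (simp add: f_def F_add complex_eq_iff)
  next
    fix c T assume "T \<in> Linf lam"
    then have T: "T \<in> bounded_ops (L2 lam)" by (rule Linf_bounded)
    have "QR (op_scale (L2 lam) c T) = (\<lambda>x. Re c * QR T x + (- Im c) * QI T x)"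
      "QI (op_scale (L2 lam) c T) = (\<lambda>x. Re c * QI T x + Im c * QR T x)"
      using R.bounded_opsD[OF T] by (auto simp: QR_def QI_def fun_eq_iff)
    then show "f (op_scale (L2 lam) c T) = c * f T"
      using Q_V[OF T] F_add[of "\<lambda>x. Re c * QR T x" "\<lambda>x. (- Im c) * QI T x"]
        F_add[of "\<lambda>x. Re c * QI T x" "\<lambda>x. Im c * QR T x"]
        F_scale[of "QI T" "- Im c"]
      by (simp add: f_def F_scale complex_eq_iff del: mult_minus_left)
  next
    fix T assume "T \<in> Linf lam"
    then have T: "T \<in> bounded_ops (L2 lam)" by (rule Linf_bounded)
    let ?S = "op_mult (L2 lam) (op_adj (L2 lam) T) T"
    have S: "?S \<in> bounded_ops (L2 lam)" using T by (intro R.op_mult_bounded) auto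
    have "R.ip (?S x) x = of_real ((R.nrm (T x))\<^sup>2)" if "x \<in> R.C" for x
      using that R.bounded_opsD[OF T] by (simp add: R.op_adj_inner'[OF T] R.inner_self)
    then have "QI ?S = (\<lambda>x. 0)" "\<And>x. x \<in> R.C \<Longrightarrow> 0 \<le> QR ?S x"
      by (auto simp: QR_def QI_def fun_eq_iff simp del: of_real_power R.op_mult_apply)
    then show "f ?S \<in> \<real>\<^sub>\<ge>\<^sub>0"
      using F_nonneg[OF Q_V(1)[OF S]] F_scale[OF V_zero, of 0] by (simp add: f_def complex_nonneg_Reals_iff)
  qed
  moreover have "f (gns_pi lam a) = \<theta> a" for a
  proof -
    \<comment> \<open>Real and imaginary parts of \<open>a\<close>; their forms are the real and
      imaginary part of the form of \<open>gns_pi lam a\<close>.\<close>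
    define h where "h = (1/2) *\<^sub>R (a + star a)"
    define k where "k = (1/2) *\<^sub>R ((- \<i>) *\<^sub>C a + \<i> *\<^sub>C star a)"
    have s: "star h = h" "star k = k"
      by (simp_all add: h_def k_def star_scaleR star_add star_star star_scaleC add.commute)
    have cn: "R.ip (gns_pi lam (star a) x) x = cnj (R.ip (gns_pi lam a x) x)" if "x \<in> R.C" for x
      using that R.pi_star'[of x x a] R.inner_sym[of "gns_pi lam a x" x] by simp
    have "F (QR (gns_pi lam a)) = Re (\<theta> h)"
      by (rule F_eq[OF Q_V(1)[OF gns_pi_bounded] s(1)])
         (simp add: QR_def h_def g_scaleR R.pi_add cn)
    moreover have "F (QI (gns_pi lam a)) = Re (\<theta> k)"
      by (rule F_eq[OF Q_V(2)[OF gns_pi_bounded] s(2)])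
         (simp add: QI_def k_def g_scaleR R.pi_add R.pi_scaleC cn)
    moreover have "Re (\<theta> h) = Re (\<theta> a)" "Re (\<theta> k) = Im (\<theta> a)"
      using \<theta>(1) by (simp_all add: h_def k_def plf_simps plf_star)
    ultimately show ?thesis by (simp add: f_def complex_eq_iff)
  qed
  ultimately show ?thesis by (auto simp: extends_to_Linf_def)
qed

end

section \<open>Weak* continuous and weak* singular functionals\<close>

context gns
begin

sublocale L: star_rep "L2 lam" "gns_pi lam"
  by (rule star_rep_L2)

sublocale N: normal_class L.normal
  by (rule L.normal_class_normal)

lemma gns_pi_range: "range (gns_pi lam) \<subseteq> bounded_ops (L2 lam)"
  using gns_pi_bounded by blast

lemma gns_pi_Linf: "gns_pi lam a \<in> Linf lam"
  using L.subset_double_commutant[OF gns_pi_range] by (auto simp: Linf_def)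

lemma Linf_bounded: "T \<in> Linf lam \<Longrightarrow> T \<in> bounded_ops (L2 lam)"
  by (simp add: Linf_def commutant_def)

lemma op_adj_gns_pi: "op_adj (L2 lam) (gns_pi lam a) = gns_pi lam (star a)"
  by (rule L.op_adj_eqI) (simp_all add: gns_pi_bounded L.pi_star)

lemma gns_pi_outside: "x \<notin> L.C \<Longrightarrow> gns_pi lam a x = undefined"
  by (simp add: gns_pi_def)

lemma op_mult_gns_pi: "op_mult (L2 lam) (gns_pi lam a) (gns_pi lam b) = gns_pi lam (a * b)"
  by (auto simp: fun_eq_iff op_mult_def compose_def restrict_def L.pi_mult gns_pi_outside)

lemma op_add_gns_pi: "op_add (L2 lam) (gns_pi lam a) (gns_pi lam b) = gns_pi lam (a + b)"
  by (auto simp: fun_eq_iff op_add_def restrict_def L.pi_add gns_pi_outside)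

lemma op_scale_gns_pi: "op_scale (L2 lam) c (gns_pi lam a) = gns_pi lam (c *\<^sub>C a)"
  by (auto simp: fun_eq_iff op_scale_def restrict_def L.pi_scaleC gns_pi_outside)

lemma plf_of_op_plf:
  assumes "op_plf (L2 lam) (Linf lam) f"
  shows "plf (\<lambda>a. f (gns_pi lam a))"
  using assms gns_pi_Linf
  by (auto simp: plf_def op_plf_def op_adj_gns_pi op_mult_gns_pi
      simp flip: op_add_gns_pi op_scale_gns_pi) (metis op_adj_gns_pi op_mult_gns_pi)

lemma commutant_adj_closed: "s \<in> commutant (L2 lam) (range (gns_pi lam)) \<Longrightarrow>
    op_adj (L2 lam) s \<in> commutant (L2 lam) (range (gns_pi lam))"
  by (rule L.commutant_adj[OF gns_pi_range]) (auto simp: op_adj_gns_pi)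

lemma Linf_adj: "T \<in> Linf lam \<Longrightarrow> op_adj (L2 lam) T \<in> Linf lam"
  unfolding Linf_def by (rule L.commutant_adj[OF L.commutant_subset commutant_adj_closed])

lemmas Linf_add = L.commutant_add[OF L.commutant_subset, of _ "range (gns_pi lam)", folded Linf_def]
lemmas Linf_scale = L.commutant_scale[OF L.commutant_subset, of _ "range (gns_pi lam)", folded Linf_def]
lemmas Linf_mult = L.commutant_mult[OF L.commutant_subset, of _ "range (gns_pi lam)", folded Linf_def]

text \<open>Cauchy-Schwarz on \<open>Linf\<close>: positivity at \<open>T + c 1\<close> with value 0
  at the identity leaves no quadratic term in \<open>c\<close>, so the linear term must vanish. Thus
  a nonzero positive functional on \<open>Linf\<close> stays nonzero on the image of
  \<open>A\<close>.\<close>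

lemma op_plf_eq_zero:
  assumes g: "op_plf (L2 lam) (Linf lam) g" and one: "g (gns_pi lam 1) = 0" and T: "T \<in> Linf lam"
  shows "g T = 0"
proof -
  let ?H = "L2 lam" and ?I = "gns_pi lam 1" and ?A = "op_adj (L2 lam) T"
  have TA: "?A \<in> Linf lam" by (rule Linf_adj[OF T])
  have I: "?I \<in> Linf lam" by (rule gns_pi_Linf)
  note D = L.bounded_opsD[OF Linf_bounded[OF T]] L.bounded_opsD[OF Linf_bounded[OF TA]]
  let ?r = "Re (g (op_mult ?H ?A T))"
  have pos: "g (op_mult ?H ?A T) + c * g ?A + cnj c * g T \<in> \<real>\<^sub>\<ge>\<^sub>0" for c
  proof -
    let ?S = "op_add ?H T (op_scale ?H c ?I)"
    \<comment> \<open>The expanded product of the adjoint of \<open>?S\<close> with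
      \<open>?S\<close>; the two operators are compared through inner products.\<close>
    let ?R = "op_add ?H (op_add ?H (op_mult ?H ?A T) (op_scale ?H c ?A))
      (op_add ?H (op_scale ?H (cnj c) T) (op_scale ?H (c * cnj c) ?I))"
    have S: "?S \<in> Linf lam" by (intro Linf_add Linf_scale T I)
    have R: "?R \<in> Linf lam" by (intro Linf_add Linf_scale Linf_mult T TA I)
    have "op_mult ?H (op_adj ?H ?S) ?S = ?R"
    proof (rule L.op_eqI)
      show "op_mult ?H (op_adj ?H ?S) ?S \<in> bounded_ops ?H"
        by (intro L.op_mult_bounded L.op_adj_bounded Linf_bounded S)
      show "?R \<in> bounded_ops ?H" by (rule Linf_bounded[OF R])
      fix x y assume xy: "x \<in> L.C" "y \<in> L.C"
      have "L.ip x (op_mult ?H (op_adj ?H ?S) ?S y) = L.ip (?S x) (?S y)"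
        using xy L.bounded_opsD[OF Linf_bounded[OF S]] L.op_adj_inner[OF Linf_bounded[OF S]]
        by (simp del: L.op_add_apply L.op_scale_apply)
      also have "\<dots> = L.ip x (?R y)"
        using xy by (simp add: D L.op_adj_inner[OF Linf_bounded[OF T]] algebra_simps)
      finally show "L.ip x (op_mult ?H (op_adj ?H ?S) ?S y) = L.ip x (?R y)" .
    qed
    moreover have "g (op_mult ?H (op_adj ?H ?S) ?S) \<in> \<real>\<^sub>\<ge>\<^sub>0" using g S by (simp add: op_plf_def)
    moreover have "g ?R = g (op_mult ?H ?A T) + c * g ?A + cnj c * g T"
      using g T TA I one by (simp add: op_plf_def Linf_add Linf_scale Linf_mult)
    ultimately show ?thesis by simp
  qed
  have "Im (g (op_mult ?H ?A T)) = 0" using pos[of 0] by (simp add: complex_nonneg_Reals_iff)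
  then have conj: "g ?A = cnj (g T)"
    using pos[of 1] pos[of \<i>] by (simp add: complex_nonneg_Reals_iff complex_eq_iff)
  have "(cmod (g ?A))\<^sup>2 \<le> ?r * 0"
  proof (rule quadratic_nonneg_imp_discrim)
    fix c
    have "Re (c * g ?A + cnj c * g T) = 2 * Re (c * g ?A)" by (simp add: conj)
    then show "0 \<le> ?r + 2 * Re (c * g ?A) + (cmod c)\<^sup>2 * 0"
      using pos[of c] by (simp add: complex_nonneg_Reals_iff)
  qed simp
  then show ?thesis by (simp add: conj)
qed

section \<open>Weak* neighbourhoods of zero and normal functionals\<close>

abbreviation sqsum :: "(nat \<Rightarrow> (nat \<Rightarrow> 'a) set) \<Rightarrow> 'a \<Rightarrow> real" where
  "sqsum u b \<equiv> (\<Sum>n. (L.nrm (gns_pi lam b (u n)))\<^sup>2)"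

abbreviation ell2_vectors :: "(nat \<Rightarrow> (nat \<Rightarrow> 'a) set) set" where
  "ell2_vectors \<equiv> hcarrier (ell2 (L2 lam))"

lemma sqsum_sums: "u \<in> ell2_vectors \<Longrightarrow> (\<lambda>n. (L.nrm (gns_pi lam b (u n)))\<^sup>2) sums sqsum u b"
  using L.amplify_closed[of u b] by (auto simp: ell2_simps amplify_def intro: summable_sums)

lemma sqsum_nonneg: "u \<in> ell2_vectors \<Longrightarrow> 0 \<le> sqsum u b"
  using sums_summable[OF sqsum_sums] by (intro suminf_nonneg) auto

text \<open>The two sequences are interleaved over even and odd indices.\<close>

lemma sqsum_add:
  assumes u: "u \<in> ell2_vectors" and v: "v \<in> ell2_vectors"
  obtains w where "w \<in> ell2_vectors" "\<And>b. sqsum w b = sqsum u b + sqsum v b"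
proof
  let ?w = "\<lambda>n. if even n then u (n div 2) else v ((n - 1) div 2)"
  have *: "(\<lambda>n. (L.nrm (gns_pi lam b (?w n)))\<^sup>2) sums (sqsum u b + sqsum v b)" for b
  proof -
    have "(\<lambda>n. if even n then (L.nrm (gns_pi lam b (u (n div 2))))\<^sup>2
        else (L.nrm (gns_pi lam b (v ((n - 1) div 2))))\<^sup>2) sums (sqsum v b + sqsum u b)"
      by (rule sums_if[OF sqsum_sums[OF v] sqsum_sums[OF u]])
    moreover have "(\<lambda>n. (L.nrm (gns_pi lam b (?w n)))\<^sup>2) =
      (\<lambda>n. if even n then (L.nrm (gns_pi lam b (u (n div 2))))\<^sup>2
        else (L.nrm (gns_pi lam b (v ((n - 1) div 2))))\<^sup>2)" by auto
    ultimately show ?thesis by (simp add: add.commute)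
  qed
  show "sqsum ?w b = sqsum u b + sqsum v b" for b using * by (rule sums_unique[symmetric])
  have "?w n \<in> L.C" for n using u v by (simp add: ell2_simps)
  then show "?w \<in> ell2_vectors"
    using sums_summable[OF *[of 1]] by (simp add: ell2_simps)
qed

lemma sqsum_scale:
  assumes u: "u \<in> ell2_vectors" and c: "0 \<le> c"
  obtains w where "w \<in> ell2_vectors" "\<And>b. sqsum w b = c * sqsum u b"
proof
  let ?w = "\<lambda>n. hscale (L2 lam) (of_real (sqrt c)) (u n)"
  show "?w \<in> ell2_vectors" using L.ell2_scale_closed[OF u, of "of_real (sqrt c)"] by (simp add: ell2_simps)
  show "sqsum ?w b = c * sqsum u b" for b
    using u c sums_summable[OF sqsum_sums[OF u]]
    by (simp add: ell2_simps L.pi_scale_vec L.nrm_scale power_mult_distrib suminf_mult)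
qed

text \<open>Induction over the generated topology. The predual functional of \<open>u\<close> and
  \<open>v\<close> is bounded at \<open>star b * b\<close> by \<open>sqsum u b + sqsum v b\<close>,
  and intersections are handled by adding the controlling sums. Only elements
  \<open>star b * b\<close> are tracked, which is all that domination of functionals needs.\<close>

lemma weak_star_neighbourhood:
  assumes "generate_topology_on {{T \<in> Linf lam. f T \<in> U} | f U. f \<in> predual (L2 lam) (Linf lam) \<and> open U} V"
    and "gns_pi lam 0 \<in> V"
  shows "\<exists>u\<in>ell2_vectors. \<forall>b. sqsum u b < 1 \<longrightarrow> gns_pi lam (star b * b) \<in> V"
  using assms
proof (induction rule: generate_topology_on.induct)
  case (Int V W)
  then obtain u v where u: "u \<in> ell2_vectors" "\<And>b. sqsum u b < 1 \<Longrightarrow> gns_pi lam (star b * b) \<in> V"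
    and v: "v \<in> ell2_vectors" "\<And>b. sqsum v b < 1 \<Longrightarrow> gns_pi lam (star b * b) \<in> W" by blast
  obtain w where w: "w \<in> ell2_vectors" "\<And>b. sqsum w b = sqsum u b + sqsum v b"
    using sqsum_add[OF u(1) v(1)] by blast
  have "gns_pi lam (star b * b) \<in> V \<inter> W" if "sqsum w b < 1" for b
    using u(2)[of b] v(2)[of b] sqsum_nonneg[OF u(1), of b] sqsum_nonneg[OF v(1), of b] that w(2)[of b]
    by auto
  then show ?case using w(1) by blast
next
  case (UN K)
  then show ?case by blast
next
  case (Basis V)
  then obtain f U where V: "V = {T \<in> Linf lam. f T \<in> U}" and f: "f \<in> predual (L2 lam) (Linf lam)" and U: "open U"
    by blast
  from f obtain u v where f: "f = (\<lambda>T\<in>Linf lam. \<Sum>n. L.ip (T (u n)) (v n))"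
    and uv: "\<And>n. u n \<in> L.C" "\<And>n. v n \<in> L.C"
      "summable (\<lambda>n. (L.nrm (u n))\<^sup>2)" "summable (\<lambda>n. (L.nrm (v n))\<^sup>2)"
    unfolding predual_def by blast
  have u: "u \<in> ell2_vectors" and v: "v \<in> ell2_vectors" using uv by (simp_all add: ell2_simps)
  have "f (gns_pi lam 0) = 0" using uv by (simp add: f gns_pi_Linf L.pi_zero)
  then have "0 \<in> U" using Basis V by simp
  then obtain e where e: "e > 0" "ball 0 e \<subseteq> U" using U openE by blast
  obtain w where w: "w \<in> ell2_vectors" "\<And>b. sqsum w b = sqsum u b + sqsum v b"
    using sqsum_add[OF u v] by blast
  \<comment> \<open>Scaling by \<open>1 / e\<close> turns the radius \<open>e\<close> into the
    normalised bound 1.\<close>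
  obtain w' where w': "w' \<in> ell2_vectors" "\<And>b. sqsum w' b = (1 / e) * sqsum w b"
    using sqsum_scale[OF w(1), of "1 / e"] e by auto
  have "gns_pi lam (star b * b) \<in> V" if b: "sqsum w' b < 1" for b
  proof -
    let ?a = "\<lambda>n. L.ip (gns_pi lam b (u n)) (gns_pi lam b (v n))"
    let ?s = "\<lambda>n. (L.nrm (gns_pi lam b (u n)))\<^sup>2 + (L.nrm (gns_pi lam b (v n)))\<^sup>2"
    have s: "?s sums (sqsum u b + sqsum v b)" by (intro sums_add sqsum_sums u v)
    have le: "cmod (?a n) \<le> ?s n" for n using uv by (intro L.cmod_inner_le) auto
    have "summable (\<lambda>n. cmod (?a n))"
      by (rule summable_comparison_test[OF _ sums_summable[OF s]]) (use le in auto)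
    then have "cmod (\<Sum>n. ?a n) \<le> (\<Sum>n. cmod (?a n))" by (rule summable_norm)
    also have "\<dots> \<le> (\<Sum>n. ?s n)"
      by (rule suminf_le[OF le \<open>summable (\<lambda>n. cmod (?a n))\<close> sums_summable[OF s]])
    also have "\<dots> = sqsum w b" using sums_unique[OF s] w by simp
    also have "\<dots> < e" using b e by (simp add: w' field_simps)
    finally have "(\<Sum>n. ?a n) \<in> U" using e by (auto simp: dist_norm)
    moreover have "f (gns_pi lam (star b * b)) = (\<Sum>n. ?a n)"
      using uv by (simp add: f gns_pi_Linf L.pi_mult L.pi_star star_star)
    ultimately show ?thesis by (simp add: V gns_pi_Linf)
  qed
  then show ?case using w'(1) by blast
qed auto

text \<open>The zero functional belongs to the predual, and its preimage of \<open>UNIV\<close> is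
  all of \<open>Linf\<close>.\<close>

lemma topspace_weak_star: "topspace (weak_star_topology (L2 lam) (Linf lam)) = Linf lam"
proof -
  let ?f = "\<lambda>T\<in>Linf lam. \<Sum>n::nat. L.ip (T (hzero (L2 lam))) (hzero (L2 lam))"
  have "?f \<in> predual (L2 lam) (Linf lam)"
    unfolding predual_def by (auto intro!: exI[of _ "\<lambda>_. hzero (L2 lam)"])
  then have "\<exists>f U. Linf lam = {T \<in> Linf lam. f T \<in> U} \<and> f \<in> predual (L2 lam) (Linf lam) \<and> open U"
    by (intro exI[of _ ?f] exI[of _ UNIV]) auto
  then show ?thesis by (auto simp: weak_star_topology_def topology_generated_by_topspace)
qed

text \<open>Continuity at 0 yields \<open>u\<close> such that \<open>sqsum u b < 1\<close> implies
  \<open>sq \<nu> b < 1\<close>. Both quantities scale alike in \<open>b\<close>, so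
  \<open>sq \<nu> b \<le> sqsum u b\<close> and the domination criterion applies.\<close>

lemma normal_of_weak_star_continuous:
  assumes \<nu>: "plf \<nu>" and f: "\<And>a. f (gns_pi lam a) = \<nu> a"
    and cont: "weak_star_continuous (L2 lam) (Linf lam) f"
  shows "L.normal \<nu>"
proof -
  let ?V = "{T \<in> Linf lam. f T \<in> ball 0 1}"
  have "openin (weak_star_topology (L2 lam) (Linf lam)) ?V"
    using openin_continuous_map_preimage[OF cont[unfolded weak_star_continuous_def], of "ball 0 1"]
    by (simp add: topspace_weak_star)
  then have "generate_topology_on {{T \<in> Linf lam. f T \<in> U} | f U. f \<in> predual (L2 lam) (Linf lam) \<and> open U} ?V"
    by (simp add: weak_star_topology_def openin_topology_generated_by_iff)
  from weak_star_neighbourhood[OF this] obtain u where u: "u \<in> ell2_vectors"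
    "\<And>b. sqsum u b < 1 \<Longrightarrow> cmod (\<nu> (star b * b)) < 1"
    using \<nu> by (auto simp: gns_pi_Linf f plf_zero)
  have "sq \<nu> b \<le> sqsum u b" for b
  proof (rule ccontr)
    assume "\<not> sq \<nu> b \<le> sqsum u b"
    then have lt: "sqsum u b < sq \<nu> b" by simp
    then have p: "0 < sq \<nu> b" using sqsum_nonneg[OF u(1), of b] by linarith
    \<comment> \<open>Normalises \<open>sq \<nu>\<close> to 1 at \<open>t b\<close>, where
      \<open>sqsum u\<close> is still below 1.\<close>
    define t where "t = 1 / sqrt (sq \<nu> b)"
    have t: "t\<^sup>2 = 1 / sq \<nu> b" using p by (simp add: t_def power_divide)
    have n: "(L.nrm (gns_pi lam (of_real t *\<^sub>C b) (u n)))\<^sup>2 = t\<^sup>2 * (L.nrm (gns_pi lam b (u n)))\<^sup>2" for n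
      using u(1) by (simp add: ell2_simps L.pi_scaleC L.nrm_scale power_mult_distrib)
    have "sqsum u (of_real t *\<^sub>C b) = t\<^sup>2 * sqsum u b"
      unfolding n by (rule suminf_mult[OF sums_summable[OF sqsum_sums[OF u(1)]]])
    also have "\<dots> < 1" using lt p by (simp add: t field_simps)
    finally have "cmod (\<nu> (star (of_real t *\<^sub>C b) * (of_real t *\<^sub>C b))) < 1" by (rule u(2))
    moreover have "\<nu> (star (of_real t *\<^sub>C b) * (of_real t *\<^sub>C b)) = of_real (t\<^sup>2 * sq \<nu> b)"
      using \<nu> by (simp add: star_scaleC mult_scaleC_left mult_scaleC_right plf_scaleC plf_sq power2_eq_square)
    ultimately show False using p by (simp add: t)
  qed
  then show ?thesis using u(1) by (intro L.normal_if_dominated[OF \<nu>, of u]) (auto simp: ell2_simps)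
qed

text \<open>The series of vector functionals converges on all of \<open>Linf\<close> and is a
  predual functional with both sequences equal to \<open>w\<close>, so it is continuous by the
  choice of the topology.\<close>

lemma weak_star_continuous_of_normal:
  assumes \<nu>: "L.normal \<nu>"
  shows "\<exists>f. extends_to_Linf lam \<nu> f \<and> weak_star_continuous (L2 lam) (Linf lam) f"
proof -
  obtain w where w: "\<And>n. w n \<in> L.C" "\<And>b. (\<lambda>n. (L.nrm (gns_pi lam b (w n)))\<^sup>2) sums sq \<nu> b"
    using \<nu> by (auto simp: L.normal_def)
  have sw: "summable (\<lambda>n. (L.nrm (w n))\<^sup>2)" using sums_summable[OF w(2)[of 1]] w(1) by simp
  have nu: "plf \<nu>" using \<nu> by (rule L.normal_plf)
  have wE: "w \<in> ell2_vectors" using w sw by (simp add: ell2_simps)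
  define f where "f T = (\<Sum>n. L.ip (T (w n)) (w n))" for T
  have summ: "summable (\<lambda>n. L.ip (T (w n)) (w n))" and sumT: "summable (\<lambda>n. (L.nrm (T (w n)))\<^sup>2)"
    if T: "T \<in> bounded_ops (L2 lam)" for T
  proof -
    obtain K where K: "K \<ge> 0" "\<And>x. x \<in> L.C \<Longrightarrow> L.nrm (T x) \<le> K * L.nrm x"
      using L.bounded_ops_bound[OF T] by blast
    have "(L.nrm (T (w n)))\<^sup>2 \<le> K\<^sup>2 * (L.nrm (w n))\<^sup>2" for n
      using power_mono[OF K(2)[OF w(1)], of n 2] L.bounded_opsD(1)[OF T w(1)] by (simp add: power_mult_distrib)
    then show 1: "summable (\<lambda>n. (L.nrm (T (w n)))\<^sup>2)"
      by (intro summable_comparison_test[OF _ summable_mult[OF sw, of "K\<^sup>2"]]) auto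
    have "(\<lambda>n. T (w n)) \<in> ell2_vectors" using 1 L.bounded_opsD(1)[OF T w(1)] by (simp add: ell2_simps)
    from L.ell2_inner_summable[OF this wE] show "summable (\<lambda>n. L.ip (T (w n)) (w n))" .
  qed
  have plff: "op_plf (L2 lam) (Linf lam) f"
    unfolding op_plf_def
  proof (intro conjI ballI allI)
    fix S T assume "S \<in> Linf lam" "T \<in> Linf lam"
    then have ST: "S \<in> bounded_ops (L2 lam)" "T \<in> bounded_ops (L2 lam)" by (auto intro: Linf_bounded)
    show "f (op_add (L2 lam) S T) = f S + f T"
      using L.bounded_opsD[OF ST(1)] L.bounded_opsD[OF ST(2)] w(1) suminf_add[OF summ[OF ST(1)] summ[OF ST(2)]]
      by (simp add: f_def)
  next
    fix c T assume "T \<in> Linf lam"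
    then have T: "T \<in> bounded_ops (L2 lam)" by (rule Linf_bounded)
    show "f (op_scale (L2 lam) c T) = c * f T"
      using L.bounded_opsD[OF T] w(1) suminf_mult[OF summ[OF T], of c] by (simp add: f_def)
  next
    fix T assume "T \<in> Linf lam"
    then have T: "T \<in> bounded_ops (L2 lam)" by (rule Linf_bounded)
    have "f (op_mult (L2 lam) (op_adj (L2 lam) T) T) = (\<Sum>n. of_real ((L.nrm (T (w n)))\<^sup>2))"
      using L.bounded_opsD[OF T] w(1) by (simp add: f_def L.op_adj_inner'[OF T] L.inner_self)
    also have "\<dots> = of_real (\<Sum>n. (L.nrm (T (w n)))\<^sup>2)"
      by (rule suminf_of_real[OF sumT[OF T], symmetric])
    finally show "f (op_mult (L2 lam) (op_adj (L2 lam) T) T) \<in> \<real>\<^sub>\<ge>\<^sub>0"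
      using suminf_nonneg[OF sumT[OF T]] by (simp add: complex_nonneg_Reals_iff)
  qed
  have "(\<lambda>a. f (gns_pi lam a)) = \<nu>"
  proof (rule plf_eqI[OF plf_of_op_plf[OF plff] nu])
    fix b
    have "(\<Sum>n. L.ip (gns_pi lam (star b * b) (w n)) (w n)) = (\<Sum>n. of_real ((L.nrm (gns_pi lam b (w n)))\<^sup>2))"
      using w(1) by (simp add: L.pi_mult L.pi_star star_star L.inner_self)
    also have "\<dots> = of_real (sq \<nu> b)"
      using sums_unique[OF w(2)[of b]]
      by (simp only: suminf_of_real[OF sums_summable[OF w(2)[of b]], symmetric])
    finally show "sq (\<lambda>a. f (gns_pi lam a)) b = sq \<nu> b" unfolding f_def by (subst sq_def) simp
  qed
  then have ext: "extends_to_Linf lam \<nu> f" using plff by (auto simp: extends_to_Linf_def fun_eq_iff)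
  have "restrict f (Linf lam) \<in> predual (L2 lam) (Linf lam)"
    unfolding predual_def f_def using w(1) sw by blast
  then have "openin (weak_star_topology (L2 lam) (Linf lam)) {T \<in> Linf lam. restrict f (Linf lam) T \<in> U}"
    if "open U" for U
    unfolding weak_star_topology_def using that by (intro topology_generated_by_Basis) blast
  then have "weak_star_continuous (L2 lam) (Linf lam) f"
    by (simp add: weak_star_continuous_def continuous_map topspace_weak_star cong: conj_cong)
  with ext show ?thesis by blast
qed

lemma WC_iff: "\<nu> \<in> WC lam \<longleftrightarrow> L.normal \<nu> \<and> null_ideal lam \<subseteq> null_ideal \<nu>"
proof
  assume "\<nu> \<in> WC lam"
  then show "L.normal \<nu> \<and> null_ideal lam \<subseteq> null_ideal \<nu>"
    using normal_of_weak_star_continuous[of \<nu>] by (auto simp: WC_def extends_to_Linf_def)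
next
  assume "L.normal \<nu> \<and> null_ideal lam \<subseteq> null_ideal \<nu>"
  then show "\<nu> \<in> WC lam"
    using weak_star_continuous_of_normal[of \<nu>] L.normal_plf[of \<nu>] by (simp add: WC_def)
qed

lemma op_plf_add:
  "op_plf H M f \<Longrightarrow> op_plf H M g \<Longrightarrow> op_plf H M (\<lambda>T. f T + g T)"
  by (auto simp: op_plf_def algebra_simps)

text \<open>Singularity in terms of the order on \<open>A\<close>, with no extension in sight;
  \<open>WS_iff\<close> relates the two notions.\<close>

definition singular :: "('a \<Rightarrow> complex) \<Rightarrow> bool" where
  "singular \<mu> \<longleftrightarrow> plf \<mu> \<and> (\<forall>\<nu>. L.normal \<nu> \<longrightarrow> (\<forall>b. sq \<nu> b \<le> sq \<mu> b) \<longrightarrow> \<nu> = (\<lambda>a. 0))"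

text \<open>Given a normal \<open>\<nu> \<le> \<mu>\<close>, an extension of
  \<open>\<mu> - \<nu>\<close> plus the weak* continuous extension of \<open>\<nu>\<close> is an
  extension of \<open>\<mu>\<close> that majorizes the latter. Conversely, a weak* continuous
  \<open>g\<close> below an extension restricts to a normal functional below \<open>\<mu>\<close>;
  if this is zero, \<open>g\<close> vanishes at the identity and hence everywhere.\<close>

lemma WS_iff: "\<mu> \<in> WS lam \<longleftrightarrow> singular \<mu> \<and> null_ideal lam \<subseteq> null_ideal \<mu>"
proof
  assume "\<mu> \<in> WS lam"
  then have \<mu>: "plf \<mu>" "null_ideal lam \<subseteq> null_ideal \<mu>"
    and none: "\<And>f g. extends_to_Linf lam \<mu> f \<Longrightarrow> op_plf (L2 lam) (Linf lam) g \<Longrightarrow>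
      weak_star_continuous (L2 lam) (Linf lam) g \<Longrightarrow> op_plf_le (L2 lam) (Linf lam) g f \<Longrightarrow>
      \<forall>T\<in>Linf lam. g T = 0"
    by (auto simp: WS_def)
  have "\<nu> = (\<lambda>a. 0)" if \<nu>: "L.normal \<nu>" "\<And>b. sq \<nu> b \<le> sq \<mu> b" for \<nu>
  proof -
    have nu: "plf \<nu>" using \<nu> by (simp add: L.normal_plf)
    let ?d = "\<lambda>a. \<mu> a - \<nu> a"
    have d: "plf ?d" by (rule plf_minus_functional[OF \<mu>(1) nu \<nu>(2)])
    have "null_ideal \<mu> \<subseteq> null_ideal ?d"
      by (rule null_ideal_mono[OF \<mu>(1) d]) (use sq_nonneg[OF nu] in \<open>simp add: sq_diff\<close>)
    then have "null_ideal lam \<subseteq> null_ideal ?d" using \<mu>(2) by blast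
    then obtain e where e: "extends_to_Linf lam ?d e" using extension_exists[OF d] by blast
    obtain g where g: "extends_to_Linf lam \<nu> g" "weak_star_continuous (L2 lam) (Linf lam) g"
      using weak_star_continuous_of_normal[OF \<nu>(1)] by blast
    have "\<forall>T\<in>Linf lam. g T = 0"
    proof (rule none[of "\<lambda>T. e T + g T"])
      show "extends_to_Linf lam \<mu> (\<lambda>T. e T + g T)"
        using e g(1) by (simp add: extends_to_Linf_def op_plf_add)
      show "op_plf_le (L2 lam) (Linf lam) g (\<lambda>T. e T + g T)"
        using e by (simp add: op_plf_le_def extends_to_Linf_def)
    qed (use g in \<open>auto simp: extends_to_Linf_def\<close>)
    then show ?thesis using g(1) gns_pi_Linf by (auto simp: extends_to_Linf_def fun_eq_iff)
  qed
  then show "singular \<mu> \<and> null_ideal lam \<subseteq> null_ideal \<mu>" using \<mu> by (simp add: singular_def)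
next
  assume *: "singular \<mu> \<and> null_ideal lam \<subseteq> null_ideal \<mu>"
  have "\<forall>T\<in>Linf lam. g T = 0"
    if f: "extends_to_Linf lam \<mu> f" and g: "op_plf (L2 lam) (Linf lam) g"
      "weak_star_continuous (L2 lam) (Linf lam) g" and le: "op_plf_le (L2 lam) (Linf lam) g f" for f g
  proof -
    let ?\<nu> = "\<lambda>a. g (gns_pi lam a)"
    have nu: "plf ?\<nu>" by (rule plf_of_op_plf[OF g(1)])
    have "plf (\<lambda>a. f (gns_pi lam a) - g (gns_pi lam a))"
      using plf_of_op_plf[of "\<lambda>T. f T - g T"] le by (simp add: op_plf_le_def)
    then have "plf (\<lambda>a. \<mu> a - ?\<nu> a)" using f by (simp add: extends_to_Linf_def)
    then have "sq ?\<nu> b \<le> sq \<mu> b" for b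
      using sq_nonneg[of "\<lambda>a. \<mu> a - ?\<nu> a" b] by (simp add: sq_diff)
    moreover have "L.normal ?\<nu>" by (rule normal_of_weak_star_continuous[OF nu _ g(2)]) simp
    ultimately have "?\<nu> = (\<lambda>a. 0)" using * by (simp add: singular_def)
    then have "g (gns_pi lam 1) = 0" by meson
    then show ?thesis using op_plf_eq_zero[OF g(1)] by blast
  qed
  with * show "\<mu> \<in> WS lam" by (auto simp: WS_def singular_def)
qed

section \<open>The Lebesgue decomposition\<close>

lemma star_rep_class_L2:
  assumes "plf \<mu>"
  shows "star_rep_class (L2 \<mu>) (gns_pi \<mu>) L.normal"
  using gns.star_rep_L2[OF gns.intro[OF assms]] L.normal_class_normal by (rule star_rep_class.intro)

text \<open>The argument runs in the space of \<open>\<mu>\<close>, where \<open>\<mu>\<close> is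
  the vector functional of the cyclic vector, with the class of functionals that are normal for
  \<open>lam\<close>.\<close>

lemma normal_maximal_part:
  assumes \<mu>: "plf \<mu>"
  obtains \<nu> where "L.normal \<nu>" "\<And>b. sq \<nu> b \<le> sq \<mu> b"
    "\<And>\<rho> b. L.normal \<rho> \<Longrightarrow> (\<And>b. sq \<rho> b \<le> sq \<mu> b) \<Longrightarrow> sq \<rho> b \<le> sq \<nu> b"
proof -
  interpret M: gns \<mu> by (rule gns.intro[OF \<mu>])
  interpret S: star_rep_class "L2 \<mu>" "gns_pi \<mu>" L.normal by (rule star_rep_class_L2[OF \<mu>])
  have "M.L.\<omega> M.\<xi> = \<mu>" by (simp add: M.L.\<omega>_def fun_eq_iff M.inner_gns_pi_xi)
  with S.maximal_part[OF M.xi_closed] that show thesis by metis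
qed

text \<open>In the space of the sum, the cyclic vector represents the sum, and
  \<open>singular_add\<close> applies.\<close>

lemma singular_plus:
  assumes "singular \<sigma>" "singular \<sigma>'"
  shows "singular (\<lambda>a. \<sigma> a + \<sigma>' a)"
proof -
  let ?\<mu> = "\<lambda>a. \<sigma> a + \<sigma>' a"
  have \<mu>: "plf ?\<mu>" using assms by (simp add: singular_def plf_plus)
  interpret M: gns ?\<mu> by (rule gns.intro[OF \<mu>])
  interpret S: star_rep_class "L2 ?\<mu>" "gns_pi ?\<mu>" L.normal by (rule star_rep_class_L2[OF \<mu>])
  have \<omega>: "M.L.\<omega> M.\<xi> = ?\<mu>" by (simp add: M.L.\<omega>_def fun_eq_iff M.inner_gns_pi_xi)
  have "\<rho> = (\<lambda>a. 0)" if "L.normal \<rho>" "\<And>b. sq \<rho> b \<le> sq ?\<mu> b" for \<rho>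
  proof (rule S.singular_add[OF M.xi_closed M.xi_cyclic, of \<sigma> \<sigma>'])
    show "L.normal \<rho>" by (rule that)
    show "sq \<rho> b \<le> sq (M.L.\<omega> M.\<xi>) b" for b using that(2) \<omega> by simp
    show "M.L.\<omega> M.\<xi> b = \<sigma> b + \<sigma>' b" for b using \<omega> by simp
  qed (use assms in \<open>auto simp: singular_def\<close>)
  with \<mu> show ?thesis by (simp add: singular_def)
qed

end

context gns
begin

lemma lebesgueD:
  assumes "weak_star_lebesgue lam \<mu> \<nu> \<sigma>"
  shows "L.normal \<nu>" "singular \<sigma>" "plf \<nu>" "plf \<sigma>" "plf \<mu>" "\<mu> = (\<lambda>a. \<nu> a + \<sigma> a)"
    "sq \<mu> b = sq \<nu> b + sq \<sigma> b"
proof -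
  show 1: "L.normal \<nu>" "singular \<sigma>" "\<mu> = (\<lambda>a. \<nu> a + \<sigma> a)"
    using assms by (auto simp: weak_star_lebesgue_def WC_iff WS_iff)
  show 2: "plf \<nu>" "plf \<sigma>" using 1 by (auto simp: singular_def L.normal_plf)
  show "plf \<mu>" unfolding 1(3) by (rule plf_plus[OF 2])
  show "sq \<mu> b = sq \<nu> b + sq \<sigma> b" unfolding 1(3) by (rule sq_plus)
qed

text \<open>A normal \<open>\<rho>\<close> below \<open>\<mu> - \<nu>\<close> makes
  \<open>\<nu> + \<rho>\<close> a normal functional below \<open>\<mu>\<close>, so maximality of
  \<open>\<nu>\<close> forces \<open>\<rho> = 0\<close>.\<close>

lemma lebesgue_exists:
  assumes \<mu>: "plf \<mu>" "null_ideal lam \<subseteq> null_ideal \<mu>"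
  obtains \<nu> \<sigma> where "weak_star_lebesgue lam \<mu> \<nu> \<sigma>"
proof -
  obtain \<nu> where \<nu>: "L.normal \<nu>" "\<And>b. sq \<nu> b \<le> sq \<mu> b"
    and max: "\<And>\<rho> b. L.normal \<rho> \<Longrightarrow> (\<And>b. sq \<rho> b \<le> sq \<mu> b) \<Longrightarrow> sq \<rho> b \<le> sq \<nu> b"
    using normal_maximal_part[OF \<mu>(1)] by blast
  have nu: "plf \<nu>" by (rule L.normal_plf[OF \<nu>(1)])
  let ?\<sigma> = "\<lambda>a. \<mu> a - \<nu> a"
  have \<sigma>: "plf ?\<sigma>" by (rule plf_minus_functional[OF \<mu>(1) nu \<nu>(2)])
  have "\<rho> = (\<lambda>a. 0)" if \<rho>: "L.normal \<rho>" "\<And>b. sq \<rho> b \<le> sq ?\<sigma> b" for \<rho>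
  proof (rule plf_eqI[OF L.normal_plf[OF \<rho>(1)] plf_zero_functional])
    fix b
    have "sq (\<lambda>a. \<nu> a + \<rho> a) b \<le> sq \<nu> b"
      by (rule max[OF N.W_add[OF \<nu>(1) \<rho>(1)]]) (use \<rho>(2) in \<open>simp add: sq_plus sq_diff algebra_simps\<close>)
    then show "sq \<rho> b = sq (\<lambda>a. 0) b"
      using sq_nonneg[OF L.normal_plf[OF \<rho>(1)], of b] by (simp add: sq_plus sq_zero)
  qed
  then have "singular ?\<sigma>" using \<sigma> by (simp add: singular_def)
  moreover have "null_ideal \<mu> \<subseteq> null_ideal \<nu>" by (rule null_ideal_mono[OF \<mu>(1) nu \<nu>(2)])
  moreover have "null_ideal \<mu> \<subseteq> null_ideal ?\<sigma>"
    by (rule null_ideal_mono[OF \<mu>(1) \<sigma>]) (use sq_nonneg[OF nu] in \<open>simp add: sq_diff\<close>)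
  ultimately have "weak_star_lebesgue lam \<mu> \<nu> ?\<sigma>"
    using \<nu>(1) \<mu>(2) by (auto simp: weak_star_lebesgue_def WC_iff WS_iff)
  with that show thesis .
qed

text \<open>With \<open>m\<close> the maximal normal functional below \<open>\<mu>\<close>, the
  difference \<open>m - \<nu>\<close> is normal and lies below the singular part
  \<open>\<sigma>\<close>, so it is zero. The decomposition is arbitrary here, which makes this the
  source of uniqueness.\<close>

lemma lebesgue_maximal:
  assumes dec: "weak_star_lebesgue lam \<mu> \<nu> \<sigma>" and \<rho>: "L.normal \<rho>" "\<And>b. sq \<rho> b \<le> sq \<mu> b"
  shows "sq \<rho> b \<le> sq \<nu> b"
proof -
  note d = lebesgueD[OF dec]
  obtain m where m: "L.normal m" "\<And>b. sq m b \<le> sq \<mu> b"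
    and max: "\<And>\<rho> b. L.normal \<rho> \<Longrightarrow> (\<And>b. sq \<rho> b \<le> sq \<mu> b) \<Longrightarrow> sq \<rho> b \<le> sq m b"
    using normal_maximal_part[OF d(5)] by blast
  have mp: "plf m" by (rule L.normal_plf[OF m(1)])
  have le: "sq \<nu> b \<le> sq m b" for b
    by (rule max[OF d(1)]) (use sq_nonneg[OF d(4)] d(7) in simp)
  let ?e = "\<lambda>a. m a - \<nu> a"
  have e: "plf ?e" by (rule plf_minus_functional[OF mp d(3) le])
  have "L.normal ?e"
    by (rule N.W_mono[OF e m(1)]) (use sq_nonneg[OF d(3)] in \<open>simp add: sq_diff\<close>)
  moreover have "sq ?e b \<le> sq \<sigma> b" for b using m(2)[of b] d(7)[of b] by (simp add: sq_diff)
  ultimately have "?e = (\<lambda>a. 0)" using d(2) by (simp add: singular_def)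
  then have "m = \<nu>" by (simp add: fun_eq_iff)
  then show ?thesis using max[OF \<rho>] by simp
qed

lemma lebesgue_unique:
  assumes dec: "weak_star_lebesgue lam \<mu> \<nu> \<sigma>" and dec': "weak_star_lebesgue lam \<mu> \<nu>' \<sigma>'"
  shows "\<nu> = \<nu>'" "\<sigma> = \<sigma>'"
proof -
  note d = lebesgueD[OF dec] and d' = lebesgueD[OF dec']
  show 1: "\<nu> = \<nu>'"
  proof (rule plf_eqI[OF d(3) d'(3)], rule antisym)
    show "sq \<nu> b \<le> sq \<nu>' b" for b
      by (rule lebesgue_maximal[OF dec' d(1)]) (use sq_nonneg[OF d(4)] d(7) in simp)
    show "sq \<nu>' b \<le> sq \<nu> b" for b
      by (rule lebesgue_maximal[OF dec d'(1)]) (use sq_nonneg[OF d'(4)] d'(7) in simp)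
  qed
  show "\<sigma> = \<sigma>'" using d(6) d'(6) 1 by (auto simp: fun_eq_iff)
qed

lemma lebesgue_parts:
  assumes "weak_star_lebesgue lam \<mu> \<nu> \<sigma>"
  shows "wc_part lam \<mu> = \<nu>" "ws_part lam \<mu> = \<sigma>"
  unfolding wc_part_def ws_part_def using assms lebesgue_unique by blast+

lemma lebesgue_wc_ws:
  assumes "plf \<mu>" "null_ideal lam \<subseteq> null_ideal \<mu>"
  shows "weak_star_lebesgue lam \<mu> (wc_part lam \<mu>) (ws_part lam \<mu>)"
  using lebesgue_exists[OF assms] lebesgue_parts by metis

section \<open>Additivity of the decomposition and hereditary cones\<close>

lemma null_ideal_plus:
  assumes "plf \<mu>" "plf \<tau>" "null_ideal lam \<subseteq> null_ideal \<mu>" "null_ideal lam \<subseteq> null_ideal \<tau>"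
  shows "null_ideal lam \<subseteq> null_ideal (\<lambda>a. \<mu> a + \<tau> a)"
  using assms by (auto simp: null_ideal_def subset_iff)

lemma null_ideal_times:
  "null_ideal lam \<subseteq> null_ideal \<mu> \<Longrightarrow> null_ideal lam \<subseteq> null_ideal (\<lambda>a. complex_of_real r * \<mu> a)"
  by (auto simp: null_ideal_def)

lemma WC_plus: "\<mu> \<in> WC lam \<Longrightarrow> \<tau> \<in> WC lam \<Longrightarrow> (\<lambda>a. \<mu> a + \<tau> a) \<in> WC lam"
  by (simp add: WC_iff N.W_add null_ideal_plus L.normal_plf)

lemma WS_plus: "\<mu> \<in> WS lam \<Longrightarrow> \<tau> \<in> WS lam \<Longrightarrow> (\<lambda>a. \<mu> a + \<tau> a) \<in> WS lam"
  by (simp add: WS_iff singular_plus null_ideal_plus) (simp add: null_ideal_plus singular_def)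

text \<open>Both classes are closed under sums; combined with uniqueness this identifies the parts
  of a sum.\<close>

lemma lebesgue_plus:
  assumes "weak_star_lebesgue lam \<mu> \<nu> \<sigma>" "weak_star_lebesgue lam \<tau> \<nu>' \<sigma>'"
  shows "weak_star_lebesgue lam (\<lambda>a. \<mu> a + \<tau> a) (\<lambda>a. \<nu> a + \<nu>' a) (\<lambda>a. \<sigma> a + \<sigma>' a)"
  using assms by (auto simp: weak_star_lebesgue_def WC_plus WS_plus fun_eq_iff)

lemma hereditary_WC: "hereditary_cone (WC lam) {\<nu>. plf \<nu>}"
  unfolding hereditary_cone_def subcone_def
proof (intro conjI ballI allI impI)
  show "(\<lambda>a. 0) \<in> WC lam" by (simp add: WC_iff) (simp add: null_ideal_def)
next
  fix r :: real and s assume "0 \<le> r" "s \<in> WC lam"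
  then show "(\<lambda>a. complex_of_real r * s a) \<in> WC lam" by (simp add: WC_iff N.W_times null_ideal_times)
next
  fix s c assume s: "s \<in> WC lam" and c: "c \<in> {\<nu>. plf \<nu>}" and le: "plf_le c s"
  have sp: "plf s" using s by (simp add: WC_iff L.normal_plf)
  then have le: "sq c b \<le> sq s b" for b using c le by (simp add: plf_le_iff)
  show "c \<in> WC lam"
    using s c le N.W_mono[of c s] null_ideal_mono[OF sp, of c] by (auto simp: WC_iff)
next
  fix s t assume "s \<in> WC lam" "t \<in> WC lam"
  then show "(\<lambda>a. s a + t a) \<in> WC lam" by (rule WC_plus)
qed (auto simp: WC_iff L.normal_plf)

lemma hereditary_WS: "hereditary_cone (WS lam) {\<nu>. plf \<nu>}"
  unfolding hereditary_cone_def subcone_def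
proof (intro conjI ballI allI impI)
  have "\<nu> = (\<lambda>a. 0)" if "L.normal \<nu>" "\<forall>b. sq \<nu> b \<le> sq (\<lambda>a. 0) b" for \<nu>
    using that sq_nonneg[OF L.normal_plf[OF that(1)]]
    by (intro plf_eqI L.normal_plf) (auto simp: sq_zero intro: antisym)
  then have zero: "singular (\<lambda>a. 0)" by (simp add: singular_def)
  then show "(\<lambda>a. 0) \<in> WS lam" by (simp add: WS_iff) (simp add: null_ideal_def)
  fix r :: real and s assume r: "0 \<le> r" and s: "s \<in> WS lam"
  have "singular (\<lambda>a. complex_of_real r * s a)"
  proof (cases "r = 0")
    case False
    have sp: "plf s" "singular s" using s by (auto simp: WS_iff singular_def)
    have "\<nu> = (\<lambda>a. 0)" if \<nu>: "L.normal \<nu>" "\<forall>b. sq \<nu> b \<le> sq (\<lambda>a. complex_of_real r * s a) b" for \<nu>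
    proof -
      \<comment> \<open>Singularity of \<open>s\<close> is applied to \<open>\<nu> / r\<close>; for
        \<open>r = 0\<close> the multiple is the zero functional.\<close>
      have "L.normal (\<lambda>a. complex_of_real (1 / r) * \<nu> a)" by (rule N.W_times[OF \<nu>(1)]) (use r in simp)
      moreover have "sq (\<lambda>a. complex_of_real (1 / r) * \<nu> a) b \<le> sq s b" for b
        unfolding sq_times using \<nu>(2) r False by (simp add: sq_times field_simps)
      ultimately have "(\<lambda>a. complex_of_real (1 / r) * \<nu> a) = (\<lambda>a. 0)" using sp by (simp add: singular_def)
      then show ?thesis using False by (simp add: fun_eq_iff)
    qed
    then show ?thesis using sp r by (simp add: singular_def plf_times)
  qed (simp add: zero)
  then show "(\<lambda>a. complex_of_real r * s a) \<in> WS lam" using s by (simp add: WS_iff null_ideal_times)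
next
  fix s c assume s: "s \<in> WS lam" and c: "c \<in> {\<nu>. plf \<nu>}" and le: "plf_le c s"
  have sp: "plf s" using s by (simp add: WS_iff singular_def)
  then have le: "sq c b \<le> sq s b" for b using c le by (simp add: plf_le_iff)
  have "\<nu> = (\<lambda>a. 0)" if "L.normal \<nu>" "\<forall>b. sq \<nu> b \<le> sq c b" for \<nu>
  proof -
    have "\<forall>b. sq \<nu> b \<le> sq s b" using that(2) le order_trans by blast
    then show ?thesis using s that(1) by (simp add: WS_iff singular_def)
  qed
  then show "c \<in> WS lam"
    using s c le null_ideal_mono[OF sp, of c] by (auto simp: WS_iff singular_def)
next
  fix s t assume "s \<in> WS lam" "t \<in> WS lam"
  then show "(\<lambda>a. s a + t a) \<in> WS lam" by (rule WS_plus)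
qed (auto simp: WS_iff singular_def)

end

theorem theorem2:
  fixes \<mu> lam \<tau> :: "'a::cstar_algebra \<Rightarrow> complex"
  assumes "plf \<mu>" and "plf lam" and "plf \<tau>"
    and "null_ideal lam \<subseteq> null_ideal \<mu>" and "null_ideal lam \<subseteq> null_ideal \<tau>"
  shows
    "((\<exists>!p. weak_star_lebesgue lam \<mu> (fst p) (snd p)) \<and>
      weak_star_lebesgue lam \<mu> (wc_part lam \<mu>) (ws_part lam \<mu>) \<and>
      plf_le (wc_part lam \<mu>) \<mu> \<and>
      (\<forall>\<nu>\<in>WC lam. plf_le \<nu> \<mu> \<longrightarrow> plf_le \<nu> (wc_part lam \<mu>))) \<and>
     (hereditary_cone (WC lam) {\<nu>. plf \<nu>} \<and> hereditary_cone (WS lam) {\<nu>. plf \<nu>}) \<and>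
     (wc_part lam (\<lambda>a. \<mu> a + \<tau> a) = (\<lambda>a. wc_part lam \<mu> a + wc_part lam \<tau> a) \<and>
      ws_part lam (\<lambda>a. \<mu> a + \<tau> a) = (\<lambda>a. ws_part lam \<mu> a + ws_part lam \<tau> a)) \<and>
     (plf_le \<mu> \<tau> \<longrightarrow>
      plf_le (wc_part lam \<mu>) (wc_part lam \<tau>) \<and> plf_le (ws_part lam \<mu>) (ws_part lam \<tau>))"
proof -
  interpret gns lam by (rule gns.intro[OF assms(2)])
  note \<mu> = lebesgue_wc_ws[OF assms(1,4)] and \<tau> = lebesgue_wc_ws[OF assms(3,5)]
  note d\<mu> = lebesgueD[OF \<mu>]
  have unique: "\<exists>!p. weak_star_lebesgue lam \<mu> (fst p) (snd p)"
  proof (rule ex1I[of _ "(wc_part lam \<mu>, ws_part lam \<mu>)"])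
    show "p = (wc_part lam \<mu>, ws_part lam \<mu>)" if "weak_star_lebesgue lam \<mu> (fst p) (snd p)" for p
      using lebesgue_parts[OF that] by (simp add: prod_eq_iff)
  qed (use \<mu> in simp)
  have le: "plf_le (wc_part lam \<mu>) \<mu>"
    using d\<mu> sq_nonneg[OF d\<mu>(4)] by (simp only: plf_le_iff) (simp add: d\<mu>(7))
  have max: "\<forall>\<nu>\<in>WC lam. plf_le \<nu> \<mu> \<longrightarrow> plf_le \<nu> (wc_part lam \<mu>)"
    using lebesgue_maximal[OF \<mu>] d\<mu>(3,5) by (auto simp: WC_iff plf_le_iff L.normal_plf)
  have mono: "plf_le (wc_part lam \<mu>) (wc_part lam \<tau>) \<and> plf_le (ws_part lam \<mu>) (ws_part lam \<tau>)"
    if "plf_le \<mu> \<tau>"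
  proof -
    \<comment> \<open>Monotonicity is additivity for
      \<open>\<tau> = \<mu> + (\<tau> - \<mu>)\<close>: the parts of \<open>\<tau>\<close> exceed
      those of \<open>\<mu>\<close> by the parts of the difference, which are positive.\<close>
    let ?d = "\<lambda>a. \<tau> a - \<mu> a"
    have d: "plf ?d" using that by (simp add: plf_le_def)
    have "null_ideal \<tau> \<subseteq> null_ideal ?d"
      by (rule null_ideal_mono[OF assms(3) d]) (use sq_nonneg[OF assms(1)] in \<open>simp add: sq_diff\<close>)
    then have dec: "weak_star_lebesgue lam ?d (wc_part lam ?d) (ws_part lam ?d)"
      using assms(5) by (intro lebesgue_wc_ws[OF d]) blast
    have "(\<lambda>a. \<mu> a + ?d a) = \<tau>" by simp
    with lebesgue_parts[OF lebesgue_plus[OF \<mu> dec]]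
    have "wc_part lam \<tau> = (\<lambda>a. wc_part lam \<mu> a + wc_part lam ?d a)"
      "ws_part lam \<tau> = (\<lambda>a. ws_part lam \<mu> a + ws_part lam ?d a)" by simp_all
    then show ?thesis using lebesgueD(3,4)[OF dec] by (simp add: plf_le_def)
  qed
  show ?thesis
    using unique \<mu> le max hereditary_WC hereditary_WS lebesgue_parts[OF lebesgue_plus[OF \<mu> \<tau>]] mono
    by blast
qed

end
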